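(* Let $c>0$ and $\nu>-1$, and let $$Q_N(\zeta)=-\tfrac1N\log\Bigl[K_\nu\bigl(\tfrac{N^2|\zeta|}{c^2}\bigr)\cdot|\zeta|^\nu\Bigr]-\Bigl(\tfrac N{c^2}-1\Bigr)\operatorname{Re}\zeta,\qquad\zeta\in\mathbb{C},$$ where $K_\nu$ is the modified Bessel function of the second kind. Let $\{\zeta_j\}_1^N$ be a random sample from the Gibbs measure associated with $Q_N$ (at $\beta=1$), let $\mathbf{R}_N$ be its $1$-point function, and let $c_N(\xi)=\tfrac1N\int_{\mathbb{R}}\mathbf{R}_N(\xi+i\eta)\,d\eta$. Then, for each $\xi$ with $0<\xi<4$, $$\lim_{N\to\infty}c_N(\xi)=\pi\cdot\sigma_{\mathrm{MP}}(\xi),\qquad\sigma_{\mathrm{MP}}(\xi)=\tfrac1{2\pi\xi}\sqrt{(4-\xi)\xi}\cdot\mathbf{1}_{[0,4]}(\xi).$$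
   Context: $dA(\zeta)=\tfrac1\pi\,d\xi\,d\eta$ ($\zeta=\xi+i\eta$) is normalized Lebesgue measure on $\mathbb{C}$ and $dA_N=(dA)^{\otimes N}$. For a potential $Q_N$ put $H_N=\sum_{j\ne k}\log\frac1{|\zeta_j-\zeta_k|}+N\sum_{j=1}^NQ_N(\zeta_j)$. The Gibbs measure at $\beta=1$ is $d\mathbf{P}_N=\frac1{Z_N}e^{-H_N}\,dA_N$ on $\mathbb{C}^N$, with $Z_N$ the normalizing constant. The $1$-point function is $\mathbf{R}_N(\zeta)=\lim_{\varepsilon\to0}\varepsilon^{-2}\,\mathbf{E}_N[\#(\{\zeta_j\}_1^N\cap D(\zeta,\varepsilon))]$, where $D(\zeta,\varepsilon)$ is the open disc with center $\zeta$ and radius $\varepsilon$. *)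

theory Defs
  imports "HOL-Probability.Probability"
begin

text \<open>The modified Bessel function of the second kind (Macdonald function) of real order, for
  positive argument (DLMF 10.32.9). This integral covers integer and non-integer orders uniformly.
  For \<open>x \<le> 0\<close> the value is the default value of a divergent integral and carries no meaning.\<close>

definition bessel_K :: "real \<Rightarrow> real \<Rightarrow> real" where
  "bessel_K \<nu> x = (LBINT t:{0<..}. exp (- x * cosh t) * cosh (\<nu> * t))"

definition dA :: "complex measure" where
  "dA = density lborel (\<lambda>_. ennreal (1 / pi))"

text \<open>Points of \<open>\<complex>\<^sup>N\<close> are functions on the index set \<open>{..<N}\<close>.\<close>

definition dA_prod :: "nat \<Rightarrow> (nat \<Rightarrow> complex) measure" where
  "dA_prod N = (\<Pi>\<^sub>M j\<in>{..<N}. dA)"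

text \<open>The energy is mathematically \<open>+\<infinity>\<close> where two points coincide; there \<open>ln\<close> takes the default value
  \<open>ln (1 / 0) = 0\<close>. This is a null set of \<open>dA_prod N\<close>, so the Gibbs measure is unaffected.\<close>

definition energy :: "nat \<Rightarrow> (complex \<Rightarrow> real) \<Rightarrow> (nat \<Rightarrow> complex) \<Rightarrow> real" where
  "energy N Q z =
     (\<Sum>j<N. \<Sum>k\<in>{..<N} - {j}. ln (1 / cmod (z j - z k))) + real N * (\<Sum>j<N. Q (z j))"

definition partition_fun :: "nat \<Rightarrow> (complex \<Rightarrow> real) \<Rightarrow> ennreal" where
  "partition_fun N Q = (\<integral>\<^sup>+ z. ennreal (exp (- energy N Q z)) \<partial>dA_prod N)"

definition gibbs :: "nat \<Rightarrow> (complex \<Rightarrow> real) \<Rightarrow> (nat \<Rightarrow> complex) measure" where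
  "gibbs N Q =
     density (dA_prod N) (\<lambda>z. ennreal (exp (- energy N Q z)) / partition_fun N Q)"

text \<open>Points are counted with multiplicity, as indices.\<close>

definition one_point :: "nat \<Rightarrow> (complex \<Rightarrow> real) \<Rightarrow> complex \<Rightarrow> real" where
  "one_point N Q \<zeta> =
     Lim (at_right 0)
       (\<lambda>\<epsilon>. (LINT z|gibbs N Q. real (card {j. j < N \<and> z j \<in> ball \<zeta> \<epsilon>})) / \<epsilon>\<^sup>2)"

definition cross_section :: "nat \<Rightarrow> (complex \<Rightarrow> real) \<Rightarrow> real \<Rightarrow> real" where
  "cross_section N Q \<xi> = (1 / real N) * (LINT \<eta>|lborel. one_point N Q (Complex \<xi> \<eta>))"

text \<open>The value at \<open>\<zeta> = 0\<close>, where the Bessel function is singular, is a default value; a single point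
  is negligible for the Gibbs measure. For this potential the partition function is finite
  only when \<open>N > c\<^sup>2 / 2\<close>, hence for all large \<open>N\<close>.\<close>

definition Q_bessel :: "real \<Rightarrow> real \<Rightarrow> nat \<Rightarrow> complex \<Rightarrow> real" where
  "Q_bessel c \<nu> N \<zeta> =
     - (1 / real N) * ln (bessel_K \<nu> ((real N)\<^sup>2 * cmod \<zeta> / c\<^sup>2) * cmod \<zeta> powr \<nu>)
     - (real N / c\<^sup>2 - 1) * Re \<zeta>"

definition sigma_MP :: "real \<Rightarrow> real" where
  "sigma_MP \<xi> = 1 / (2 * pi * \<xi>) * sqrt ((4 - \<xi>) * \<xi>) * indicator {0..4} \<xi>"

end

theory Submission
  imports Defs "Jordan_Normal_Form.Determinant" "HOL-Real_Asymp.Real_Asymp"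
begin

text \<open>
  Why the cross-section converges to the Marchenko-Pastur law. Put \<open>a = N\<^sup>2 / c\<^sup>2\<close>, \<open>b = a - N\<close> and
  \<open>\<tau> = b / a\<close>. Up to a constant factor, \<open>exp (- N Q\<^sub>N)\<close> is the weight
  \<open>|z|\<^sup>\<nu> K\<^sub>\<nu>(a |z|) exp (b Re z)\<close>, and the integral representation of the Macdonald function exhibits
  it as a positive mixture of Gaussians in the plane (\<open>nn_integral_mixture\<close>). Every integral against
  it therefore reduces to a Gaussian integral followed by a Gamma integral. Combined with the
  generating function of the Laguerre polynomials this shows that \<open>L\<^sub>n\<^sup>\<nu>(\<kappa> z)\<close>, with
  \<open>\<kappa> = (a\<^sup>2 - b\<^sup>2) / (2 b)\<close>, are orthogonal, with squared norms proportional to \<open>\<tau>\<^sup>-\<^sup>2\<^sup>n V\<^sub>n\<close>, where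
  \<open>V\<^sub>n = \<Gamma>(n + \<nu> + 1) / (n! \<Gamma>(\<nu> + 1))\<close> (\<open>lag_orthogonal\<close>). The Gibbs measure at this temperature is
  determinantal, so its one-point function is the sum of the first \<open>N\<close> normalised densities
  (\<open>expected_count_orthogonal_polynomials\<close>, \<open>one_point_bessel\<close>), and \<open>c\<^sub>N(x)\<close> is the average of the
  integrals \<open>A\<^sub>n\<close> of these densities along the vertical line through \<open>x\<close>.

  The individual \<open>A\<^sub>n\<close> oscillate, but only their sum over \<open>n < N\<close> matters, so a Tauberian argument
  replaces the asymptotics of Laguerre polynomials. Consider the masses \<open>V\<^sub>n A\<^sub>n / N\<^bsup>\<nu>+1\<^esup>\<close> at the points
  \<open>n / N\<close>. Their Laplace transform at \<open>\<lambda>\<close> is an Abel sum of \<open>|L\<^sub>n\<^sup>\<nu>(\<kappa> z)|\<^sup>2\<close>, which Parseval's identity turns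
  into the integral over a circle of the squared modulus of the generating function, that is, of the
  exponential of a linear function of \<open>z\<close> (\<open>laguerre_parseval\<close>). Integrating this along the line
  against the Gaussian mixture is elementary and leaves a single Macdonald function of large argument
  (\<open>abel_sum_on_line\<close>). Dominated convergence gives, with \<open>D = |1 - exp (i \<theta>)|\<^sup>2\<close>, the limit
  \[ \frac{x^\nu}{2 \Gamma(\nu+1)} \int_0^{2\pi} D^{-\nu-1} e^{-\lambda x / D}\, d\theta \]
  (\<open>scal_atom_abel_tendsto\<close>). Hence the masses converge weakly to the image of
  \<open>x\<^sup>\<nu> D\<^bsup>-\<nu>-1\<^esup> d\<theta> / (2 \<Gamma>(\<nu>+1))\<close> under \<open>s = x / D\<close>: in the variable \<open>exp (- s)\<close> this is convergence of
  all moments on the unit interval (\<open>discrete_moment_convergence\<close>). Since \<open>V\<^sub>n / N\<^sup>\<nu>\<close> is close to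
  \<open>s\<^sup>\<nu> / \<Gamma>(\<nu>+1)\<close> at \<open>s = n / N\<close>, integrating \<open>\<Gamma>(\<nu>+1) s\<^bsup>-\<nu>\<^esup>\<close> over \<open>s < 1\<close> recovers the sum of the \<open>A\<^sub>n / N\<close>, up to the
  indices \<open>n < x N / 6\<close>. These lie below the support \<open>s \<ge> x / 4\<close> of the limit, and their contribution is
  exponentially small (\<open>small_index_sum_tendsto\<close>). What remains is
  \<open>(1/2) \<integral> d\<theta> / D\<close> over \<open>D > x\<close>, which is \<open>sqrt ((4 - x) x) / (2 x)\<close> (\<open>integral_inverse_chord\<close>).
\<close>

section \<open>Determinants of polynomials\<close>

text \<open>Column operations turn monomials into arbitrary polynomials of the right degrees, so the determinant
  is the Vandermonde product times the leading coefficients. The induction avoids column operations: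
  expanded along the last row, the determinant is a polynomial of degree at most \<open>n\<close> in the last point,
  and it vanishes at the other \<open>n\<close> points.\<close>

lemma det_polynomials_vandermonde:
  fixes p :: "nat \<Rightarrow> complex poly" and z :: "nat \<Rightarrow> complex"
  assumes deg: "\<And>j. degree (p j) = j"
  shows "Determinant.det (Matrix.mat n n (\<lambda>(i, j). poly (p j) (z i))) =
           (\<Prod>j<n. lead_coeff (p j)) * (\<Prod>k<n. \<Prod>i<k. z k - z i)"
proof (induction n)
  case 0
  show ?case by (simp add: Determinant.det_def)
next
  case (Suc n)
  define M where "M = Matrix.mat (Suc n) (Suc n) (\<lambda>(i, j). poly (p j) (z i))"
  \<comment> \<open>The matrix with its last point replaced by a variable; its determinant is the polynomial \<open>q\<close>.\<close>
  define W where "W x = Matrix.mat (Suc n) (Suc n) (\<lambda>(i, j). poly (p j) (if i = n then x else z i))" for x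
  define cf where "cf j = cofactor M n j" for j
  define q where "q = (\<Sum>j<Suc n. Polynomial.smult (cf j) (p j))"
  have del: "mat_delete (W x) n j = mat_delete M n j" if "j < Suc n" for x j
    using that by (intro eq_matI) (auto simp: W_def M_def mat_delete_def)
  have detW: "Determinant.det (W x) = poly q x" for x
  proof -
    have "Determinant.det (W x) = (\<Sum>j<Suc n. W x $$ (n, j) * cofactor (W x) n j)"
      by (rule laplace_expansion_row) (auto simp: W_def)
    also have "\<dots> = (\<Sum>j<Suc n. cf j * poly (p j) x)"
      by (intro sum.cong refl) (auto simp: cf_def Determinant.cofactor_def del, simp add: W_def)
    also have "\<dots> = poly q x"
      by (simp add: q_def poly_sum)
    finally show ?thesis .
  qed
  have "mat_delete M n n = Matrix.mat n n (\<lambda>(i, j). poly (p j) (z i))"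
    by (intro eq_matI) (auto simp: M_def mat_delete_def)
  hence cfn: "cf n = (\<Prod>j<n. lead_coeff (p j)) * (\<Prod>k<n. \<Prod>i<k. z k - z i)"
    using Suc by (simp add: cf_def Determinant.cofactor_def flip: mult_2)
  have MW: "M = W (z n)"
    by (intro eq_matI) (auto simp: M_def W_def)
  show ?case
  proof (cases "inj_on z {..<Suc n}")
    case False
    then obtain i j where ij: "i < j" "j < Suc n" "z i = z j"
      unfolding inj_on_def by (metis lessThan_iff linorder_neqE_nat)
    have "Determinant.det M = 0"
      by (rule Determinant.det_identical_rows[of _ "Suc n" i j]) (use ij in \<open>auto simp: M_def Matrix.row_def\<close>)
    moreover have "(\<Prod>k<Suc n. \<Prod>i<k. z k - z i) = 0"
    proof -
      have "\<exists>k\<in>{..<Suc n}. \<exists>i\<in>{..<k}. z k - z i = 0"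
        using ij by (intro bexI[of _ j] bexI[of _ i]) auto
      thus ?thesis by (simp del: prod.lessThan_Suc lessThan_Suc)
    qed
    ultimately show ?thesis by (simp add: M_def)
  next
    case True
    define V where "V = (\<Prod>i<n. [:- z i, 1:])"
    define g where "g = Polynomial.smult (cf n * lead_coeff (p n)) V"
    have degV: "degree V = n"
      unfolding V_def by (subst degree_prod_eq_sum_degree) auto
    have lcV: "coeff V n = 1"
      using degV lead_coeff_prod[of "\<lambda>i. [:- z i, 1:]" "{..<n}"] by (simp add: V_def)
    have "degree q \<le> n"
      unfolding q_def
      by (intro degree_sum_le) (auto intro: order.trans[OF degree_smult_le] simp: deg)
    moreover have "coeff q n = cf n * lead_coeff (p n)"
    proof -
      have "coeff q n = (\<Sum>j<Suc n. cf j * coeff (p j) n)"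
        by (simp add: q_def coeff_sum)
      also have "\<dots> = (\<Sum>j<Suc n. if j = n then cf n * lead_coeff (p n) else 0)"
        by (intro sum.cong refl) (auto simp: deg intro!: coeff_eq_0)
      finally show ?thesis by simp
    qed
    moreover have "degree g \<le> n"
      unfolding g_def using degV degree_smult_le[of "cf n * lead_coeff (p n)" V] by simp
    moreover have "coeff g n = cf n * lead_coeff (p n)"
      by (simp add: g_def lcV)
    moreover have "card (z ` {..<n}) = n"
      using True by (subst card_image) (auto simp: inj_on_def)
    moreover have "poly q (z i) = poly g (z i)" if "i < n" for i
    proof -
      have "Determinant.det (W (z i)) = 0"
        by (rule Determinant.det_identical_rows[of _ "Suc n" i n]) (use that in \<open>auto simp: W_def Matrix.row_def\<close>)
      moreover have "poly V (z i) = 0"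
        unfolding V_def poly_prod using that by (intro prod_zero bexI[of _ i]) auto
      ultimately show ?thesis by (simp add: detW g_def)
    qed
    ultimately have "q = g"
      by (intro poly_eqI_degree_lead_coeff[of q n g "z ` {..<n}"]) auto
    hence "Determinant.det M = cf n * lead_coeff (p n) * poly V (z n)"
      unfolding MW detW by (simp add: g_def)
    also have "poly V (z n) = (\<Prod>i<n. z n - z i)"
      by (simp add: V_def poly_prod)
    finally show ?thesis
      by (simp add: M_def cfn mult_ac)
  qed
qed

text \<open>The Leibniz form is what product measures can be applied to, factor by factor.\<close>

lemma sum_permutations_vandermonde:
  fixes p :: "nat \<Rightarrow> complex poly" and z :: "nat \<Rightarrow> complex"
  assumes deg: "\<And>j. degree (p j) = j"
  shows "(\<Sum>\<sigma> | \<sigma> permutes {..<n}. of_int (sign \<sigma>) * (\<Prod>i<n. poly (p (\<sigma> i)) (z i))) =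
           (\<Prod>j<n. lead_coeff (p j)) * (\<Prod>k<n. \<Prod>i<k. z k - z i)"
proof -
  have "(\<Prod>i = 0..<n. Matrix.mat n n (\<lambda>(i, j). poly (p j) (z i)) $$ (i, \<sigma> i)) = (\<Prod>i<n. poly (p (\<sigma> i)) (z i))"
    if "\<sigma> permutes {..<n}" for \<sigma>
    using permutes_in_image[OF that] by (intro prod.cong) (auto simp: atLeast0LessThan)
  hence "Determinant.det (Matrix.mat n n (\<lambda>(i, j). poly (p j) (z i))) =
    (\<Sum>\<sigma> | \<sigma> permutes {..<n}. of_int (sign \<sigma>) * (\<Prod>i<n. poly (p (\<sigma> i)) (z i)))"
    by (simp add: Determinant.det_def atLeast0LessThan)
  thus ?thesis
    using det_polynomials_vandermonde[OF deg] by simp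
qed

text \<open>Expanding the squared modulus of an alternant gives a double sum over permutations of products, each
  factor of which depends on one point only.\<close>

lemma integral_alternant_norm_square:
  fixes N :: nat and \<mu> :: "complex measure" and P :: "nat \<Rightarrow> complex \<Rightarrow> complex" and f :: "nat \<Rightarrow> complex \<Rightarrow> real"
  assumes sf: "sigma_finite_measure \<mu>"
    and int: "\<And>k m n. k < N \<Longrightarrow> integrable \<mu> (\<lambda>z. of_real (f k z) * (P m z * cnj (P n z)))"
  defines "A \<equiv> \<lambda>z. \<Sum>\<sigma> | \<sigma> permutes {..<N}. of_int (sign \<sigma>) * (\<Prod>i<N. P (\<sigma> i) (z i))"
  shows "integrable (\<Pi>\<^sub>M j\<in>{..<N}. \<mu>) (\<lambda>z. (\<Prod>k<N. f k (z k)) * (cmod (A z))\<^sup>2)"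
    and "of_real (LINT z|(\<Pi>\<^sub>M j\<in>{..<N}. \<mu>). (\<Prod>k<N. f k (z k)) * (cmod (A z))\<^sup>2) =
          (\<Sum>\<sigma> | \<sigma> permutes {..<N}. \<Sum>\<pi> | \<pi> permutes {..<N}. of_int (sign \<sigma>) * of_int (sign \<pi>) *
            (\<Prod>k<N. LINT z|\<mu>. of_real (f k z) * (P (\<sigma> k) z * cnj (P (\<pi> k) z))))"
proof -
  interpret \<mu>: sigma_finite_measure \<mu> by (rule sf)
  interpret pr: product_sigma_finite "\<lambda>_::nat. \<mu>" by unfold_locales
  define \<Phi> where "\<Phi> k m n z = of_real (f k z) * (P m z * cnj (P n z))" for k m n z
  have eq: "complex_of_real ((\<Prod>k<N. f k (z k)) * (cmod (A z))\<^sup>2) =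
      (\<Sum>\<sigma> | \<sigma> permutes {..<N}. \<Sum>\<pi> | \<pi> permutes {..<N}. of_int (sign \<sigma>) * of_int (sign \<pi>) *
            (\<Prod>k<N. \<Phi> k (\<sigma> k) (\<pi> k) (z k)))" for z
  proof -
    have "complex_of_real ((\<Prod>k<N. f k (z k)) * (cmod (A z))\<^sup>2) =
            (\<Prod>k<N. of_real (f k (z k))) * (A z * cnj (A z))"
      by (simp only: of_real_mult complex_norm_square of_real_prod)
    also have "A z * cnj (A z) = (\<Sum>\<sigma> | \<sigma> permutes {..<N}. \<Sum>\<pi> | \<pi> permutes {..<N}.
       (of_int (sign \<sigma>) * (\<Prod>i<N. P (\<sigma> i) (z i))) * (of_int (sign \<pi>) * (\<Prod>i<N. cnj (P (\<pi> i) (z i)))))"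
      unfolding A_def by (simp add: sum_product)
    also have "(\<Prod>k<N. of_real (f k (z k))) * \<dots> = (\<Sum>\<sigma> | \<sigma> permutes {..<N}. \<Sum>\<pi> | \<pi> permutes {..<N}.
       of_int (sign \<sigma>) * of_int (sign \<pi>) * (\<Prod>k<N. \<Phi> k (\<sigma> k) (\<pi> k) (z k)))"
      unfolding sum_distrib_left \<Phi>_def prod.distrib
      by (intro sum.cong refl) (simp add: mult_ac)
    finally show ?thesis .
  qed
  have int': "integrable (\<Pi>\<^sub>M j\<in>{..<N}. \<mu>) (\<lambda>z. \<Prod>k<N. \<Phi> k (\<sigma> k) (\<pi> k) (z k))" for \<sigma> \<pi>
    by (intro pr.product_integrable_prod) (auto simp: \<Phi>_def intro!: int)
  have "integrable (\<Pi>\<^sub>M j\<in>{..<N}. \<mu>) (\<lambda>z. complex_of_real ((\<Prod>k<N. f k (z k)) * (cmod (A z))\<^sup>2))"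
    unfolding eq by (intro Bochner_Integration.integrable_sum integrable_mult_right int')
  thus int2: "integrable (\<Pi>\<^sub>M j\<in>{..<N}. \<mu>) (\<lambda>z. (\<Prod>k<N. f k (z k)) * (cmod (A z))\<^sup>2)"
    by (rule complex_of_real_integrable_eq[THEN iffD1])
  have "of_real (LINT z|(\<Pi>\<^sub>M j\<in>{..<N}. \<mu>). (\<Prod>k<N. f k (z k)) * (cmod (A z))\<^sup>2) =
      (LINT z|(\<Pi>\<^sub>M j\<in>{..<N}. \<mu>). complex_of_real ((\<Prod>k<N. f k (z k)) * (cmod (A z))\<^sup>2))"
    by (rule integral_complex_of_real[symmetric])
  also have "\<dots> = (\<Sum>\<sigma> | \<sigma> permutes {..<N}. \<Sum>\<pi> | \<pi> permutes {..<N}. of_int (sign \<sigma>) * of_int (sign \<pi>) *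
            (LINT z|(\<Pi>\<^sub>M j\<in>{..<N}. \<mu>). (\<Prod>k<N. \<Phi> k (\<sigma> k) (\<pi> k) (z k))))"
    unfolding eq
    by (subst Bochner_Integration.integral_sum, intro Bochner_Integration.integrable_sum integrable_mult_right int',
        intro sum.cong refl, subst Bochner_Integration.integral_sum,
        intro integrable_mult_right int', simp)
  also have "\<dots> = (\<Sum>\<sigma> | \<sigma> permutes {..<N}. \<Sum>\<pi> | \<pi> permutes {..<N}. of_int (sign \<sigma>) * of_int (sign \<pi>) *
            (\<Prod>k<N. LINT z|\<mu>. \<Phi> k (\<sigma> k) (\<pi> k) z))"
    by (intro sum.cong refl arg_cong2[where f = "(*)"] pr.product_integral_prod)
       (auto simp: \<Phi>_def intro!: int)
  finally show "of_real (LINT z|(\<Pi>\<^sub>M j\<in>{..<N}. \<mu>). (\<Prod>k<N. f k (z k)) * (cmod (A z))\<^sup>2) =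
          (\<Sum>\<sigma> | \<sigma> permutes {..<N}. \<Sum>\<pi> | \<pi> permutes {..<N}. of_int (sign \<sigma>) * of_int (sign \<pi>) *
            (\<Prod>k<N. LINT z|\<mu>. of_real (f k z) * (P (\<sigma> k) z * cnj (P (\<pi> k) z))))"
    unfolding \<Phi>_def .
qed

lemma sum_over_permutations_values:
  fixes G :: "nat \<Rightarrow> real"
  shows "(\<Sum>i<N. \<Sum>\<sigma> | \<sigma> permutes {..<N}. G (\<sigma> i)) = fact N * (\<Sum>n<N. G n)"
proof -
  have "(\<Sum>i<N. \<Sum>\<sigma> | \<sigma> permutes {..<N}. G (\<sigma> i)) = (\<Sum>\<sigma> | \<sigma> permutes {..<N}. \<Sum>i<N. G (\<sigma> i))"
    by (rule sum.swap)
  also have "\<dots> = (\<Sum>\<sigma> | \<sigma> permutes {..<N}. \<Sum>i<N. G i)"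
  proof (rule sum.cong[OF refl])
    fix \<sigma> assume "\<sigma> \<in> {\<sigma>. \<sigma> permutes {..<N}}"
    thus "(\<Sum>i<N. G (\<sigma> i)) = (\<Sum>i<N. G i)"
      using sum.permute[of \<sigma> "{..<N}" G] by (simp add: o_def)
  qed
  also have "\<dots> = fact N * (\<Sum>n<N. G n)"
    by (simp add: card_permutations[OF refl])
  finally show ?thesis .
qed

text \<open>A factor \<open>f\<close> at a single point leaves orthogonality intact at all others, so two permutations contribute
  only if they agree off one index, and hence everywhere. Summing over the position of \<open>f\<close> makes each
  polynomial appear \<open>N!\<close> times.\<close>

lemma integral_orthogonal_alternant:
  fixes N :: nat and \<mu> :: "complex measure" and P :: "nat \<Rightarrow> complex \<Rightarrow> complex" and w f :: "complex \<Rightarrow> real"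
  assumes sf: "sigma_finite_measure \<mu>"
    and Pint: "\<And>m n. integrable \<mu> (\<lambda>z. of_real (w z) * (P m z * cnj (P n z)))"
    and orth: "\<And>m n. (LINT z|\<mu>. of_real (w z) * (P m z * cnj (P n z))) = (if m = n then of_real (h n) else 0)"
    and hpos: "\<And>n. h n > 0"
    and [measurable]: "f \<in> borel_measurable \<mu>" and fb: "\<And>z. \<bar>f z\<bar> \<le> 1"
    and w: "\<And>z. w z \<ge> 0"
  defines "A \<equiv> \<lambda>z. \<Sum>\<sigma> | \<sigma> permutes {..<N}. of_int (sign \<sigma>) * (\<Prod>i<N. P (\<sigma> i) (z i))"
  shows "integrable (\<Pi>\<^sub>M j\<in>{..<N}. \<mu>) (\<lambda>z. (\<Sum>i<N. f (z i)) * ((\<Prod>k<N. w (z k)) * (cmod (A z))\<^sup>2))"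
    and "(LINT z|(\<Pi>\<^sub>M j\<in>{..<N}. \<mu>). (\<Sum>i<N. f (z i)) * ((\<Prod>k<N. w (z k)) * (cmod (A z))\<^sup>2)) =
           fact N * (\<Prod>n<N. h n) * (\<Sum>n<N. (LINT z|\<mu>. f z * (w z * (cmod (P n z))\<^sup>2)) / h n)"
proof -
  define F where "F n = (LINT z|\<mu>. f z * (w z * (cmod (P n z))\<^sup>2))" for n
  \<comment> \<open>The test function is attached to the weight of the \<open>i\<close>-th point.\<close>
  define g where "g i k z = (if k = i then f z * w z else w z)" for i k :: nat and z
  have Fint: "integrable \<mu> (\<lambda>z. of_real (f z * w z) * (P m z * cnj (P n z)))" for m n
  proof (rule Bochner_Integration.integrable_bound[OF Pint])
    show "(\<lambda>z. of_real (f z * w z) * (P m z * cnj (P n z))) \<in> borel_measurable \<mu>"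
      using borel_measurable_integrable[OF Pint[of m n]]
      by (simp add: mult.assoc)
    show "AE z in \<mu>. norm (of_real (f z * w z) * (P m z * cnj (P n z))) \<le> norm (of_real (w z) * (P m z * cnj (P n z)))"
      using fb w by (intro AE_I2) (auto simp: norm_mult abs_mult intro!: mult_left_le_one_le mult_right_mono)
  qed
  have gint: "integrable \<mu> (\<lambda>z. of_real (g i k z) * (P m z * cnj (P n z)))" for i k m n
    using Fint[of m n] Pint[of m n] by (cases "k = i") (simp_all add: g_def)
  have prod_g: "(\<Prod>k<N. g i k (z k)) = f (z i) * (\<Prod>k<N. w (z k))" if "i < N" for i z
  proof -
    have "(\<Prod>k<N. g i k (z k)) = (\<Prod>k<N. (if k = i then f (z i) else 1) * w (z k))"
      by (intro prod.cong) (auto simp: g_def)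
    thus ?thesis using that by (simp add: prod.distrib)
  qed
  have val: "(LINT z|\<mu>. of_real (g i k z) * (P m z * cnj (P n z))) = (if m = n then of_real (h n) else 0)"
    if "k \<noteq> i" for i k m n
    using that orth[of m n] by (simp add: g_def)
  have valF: "(LINT z|\<mu>. of_real (g i i z) * (P m z * cnj (P m z))) = of_real (F m)" for i m
  proof -
    have "(LINT z|\<mu>. of_real (g i i z) * (P m z * cnj (P m z))) =
       (LINT z|\<mu>. complex_of_real (f z * (w z * (cmod (P m z))\<^sup>2)))"
      by (intro Bochner_Integration.integral_cong refl)
         (simp only: g_def simp_thms if_True of_real_mult complex_norm_square mult.assoc)
    thus ?thesis unfolding F_def by (simp only: integral_complex_of_real)
  qed
  have one: "integrable (\<Pi>\<^sub>M j\<in>{..<N}. \<mu>) (\<lambda>z. f (z i) * ((\<Prod>k<N. w (z k)) * (cmod (A z))\<^sup>2))"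
     "(LINT z|(\<Pi>\<^sub>M j\<in>{..<N}. \<mu>). f (z i) * ((\<Prod>k<N. w (z k)) * (cmod (A z))\<^sup>2)) =
       (\<Prod>n<N. h n) * (\<Sum>\<sigma> | \<sigma> permutes {..<N}. F (\<sigma> i) / h (\<sigma> i))" if i: "i < N" for i
  proof -
    note * = integral_alternant_norm_square[OF sf, where N = N and f = "g i" and P = P, OF gint]
    show "integrable (\<Pi>\<^sub>M j\<in>{..<N}. \<mu>) (\<lambda>z. f (z i) * ((\<Prod>k<N. w (z k)) * (cmod (A z))\<^sup>2))"
      using *(1) unfolding A_def by (simp add: prod_g[OF i] mult.assoc)
    have diag: "(\<Prod>k<N. LINT z|\<mu>. of_real (g i k z) * (P (\<sigma> k) z * cnj (P (\<pi> k) z))) =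
       (if \<sigma> = \<pi> then of_real ((\<Prod>n<N. h n) * (F (\<sigma> i) / h (\<sigma> i))) else 0)"
      if \<sigma>: "\<sigma> permutes {..<N}" and \<pi>: "\<pi> permutes {..<N}" for \<sigma> \<pi>
    proof (cases "\<sigma> = \<pi>")
      case True
      have "(\<Prod>k<N. LINT z|\<mu>. of_real (g i k z) * (P (\<sigma> k) z * cnj (P (\<pi> k) z))) =
             (\<Prod>k<N. of_real (h (\<sigma> k) * (if k = i then F (\<sigma> i) / h (\<sigma> i) else 1)))"
      proof (intro prod.cong refl)
        fix k assume "k \<in> {..<N}"
        show "(LINT z|\<mu>. of_real (g i k z) * (P (\<sigma> k) z * cnj (P (\<pi> k) z))) =
               of_real (h (\<sigma> k) * (if k = i then F (\<sigma> i) / h (\<sigma> i) else 1))"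
        proof (cases "k = i")
          case True
          thus ?thesis using valF[of i "\<sigma> i"] hpos[of "\<sigma> i"] \<open>\<sigma> = \<pi>\<close> by simp
        next
          case False
          thus ?thesis using val[OF False, of "\<sigma> k" "\<pi> k"] \<open>\<sigma> = \<pi>\<close> by simp
        qed
      qed
      also have "\<dots> = of_real ((\<Prod>k<N. h (\<sigma> k)) * (F (\<sigma> i) / h (\<sigma> i)))"
        using i by (simp add: prod.distrib flip: of_real_prod)
      also have "(\<Prod>k<N. h (\<sigma> k)) = (\<Prod>n<N. h n)"
        using prod.permute[OF \<sigma>, of h] by simp
      finally show ?thesis using True by simp
    next
      case False
      have "\<exists>k<N. k \<noteq> i \<and> \<sigma> k \<noteq> \<pi> k"
      proof (rule ccontr)
        assume "\<not> ?thesis"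
        hence agree: "\<sigma> k = \<pi> k" if "k \<noteq> i" for k
          using that \<sigma> \<pi> by (metis lessThan_iff permutes_not_in)
        have "\<sigma> i = \<pi> i"
          using agree \<sigma> \<pi> by (metis permutes_inv_eq)
        with agree have "\<sigma> = \<pi>" by (intro ext) metis
        with False show False by simp
      qed
      then obtain k where "k < N" "k \<noteq> i" "\<sigma> k \<noteq> \<pi> k" by blast
      thus ?thesis
        using False val[of k i "\<sigma> k" "\<pi> k"] by (auto intro!: prod_zero bexI[of _ k])
    qed
    have "complex_of_real (LINT z|(\<Pi>\<^sub>M j\<in>{..<N}. \<mu>). f (z i) * ((\<Prod>k<N. w (z k)) * (cmod (A z))\<^sup>2)) =
      (\<Sum>\<sigma> | \<sigma> permutes {..<N}. \<Sum>\<pi> | \<pi> permutes {..<N}. of_int (sign \<sigma>) * of_int (sign \<pi>) *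
            (\<Prod>k<N. LINT z|\<mu>. of_real (g i k z) * (P (\<sigma> k) z * cnj (P (\<pi> k) z))))"
      using *(2) unfolding A_def by (simp add: prod_g[OF i] mult.assoc)
    also have "\<dots> = (\<Sum>\<sigma> | \<sigma> permutes {..<N}. \<Sum>\<pi> | \<pi> permutes {..<N}. of_int (sign \<sigma>) * of_int (sign \<pi>) *
            (if \<sigma> = \<pi> then of_real ((\<Prod>n<N. h n) * (F (\<sigma> i) / h (\<sigma> i))) else 0))"
      by (intro sum.cong refl arg_cong2[where f = "(*)"] diag) auto
    also have "\<dots> = (\<Sum>\<sigma> | \<sigma> permutes {..<N}. \<Sum>\<pi> | \<pi> permutes {..<N}. 
            (if \<pi> = \<sigma> then of_real ((\<Prod>n<N. h n) * (F (\<sigma> i) / h (\<sigma> i))) else 0))"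
      by (intro sum.cong refl) (auto simp: sign_def)
    also have "\<dots> = (\<Sum>\<sigma> | \<sigma> permutes {..<N}. of_real ((\<Prod>n<N. h n) * (F (\<sigma> i) / h (\<sigma> i))))"
      by (intro sum.cong refl) (simp add: finite_permutations)
    also have "\<dots> = of_real ((\<Prod>n<N. h n) * (\<Sum>\<sigma> | \<sigma> permutes {..<N}. F (\<sigma> i) / h (\<sigma> i)))"
      by (simp add: sum_distrib_left)
    finally show "(LINT z|(\<Pi>\<^sub>M j\<in>{..<N}. \<mu>). f (z i) * ((\<Prod>k<N. w (z k)) * (cmod (A z))\<^sup>2)) =
       (\<Prod>n<N. h n) * (\<Sum>\<sigma> | \<sigma> permutes {..<N}. F (\<sigma> i) / h (\<sigma> i))"
      unfolding of_real_eq_iff .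
  qed
  show "integrable (\<Pi>\<^sub>M j\<in>{..<N}. \<mu>) (\<lambda>z. (\<Sum>i<N. f (z i)) * ((\<Prod>k<N. w (z k)) * (cmod (A z))\<^sup>2))"
    unfolding sum_distrib_right by (intro Bochner_Integration.integrable_sum one) simp
  have "(LINT z|(\<Pi>\<^sub>M j\<in>{..<N}. \<mu>). (\<Sum>i<N. f (z i)) * ((\<Prod>k<N. w (z k)) * (cmod (A z))\<^sup>2)) =
      (\<Sum>i<N. LINT z|(\<Pi>\<^sub>M j\<in>{..<N}. \<mu>). f (z i) * ((\<Prod>k<N. w (z k)) * (cmod (A z))\<^sup>2))"
    unfolding sum_distrib_right by (intro Bochner_Integration.integral_sum one) simp
  also have "\<dots> = (\<Prod>n<N. h n) * (\<Sum>i<N. \<Sum>\<sigma> | \<sigma> permutes {..<N}. F (\<sigma> i) / h (\<sigma> i))"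
    unfolding sum_distrib_left by (intro sum.cong refl) (simp add: one sum_distrib_left)
  also have "\<dots> = fact N * (\<Prod>n<N. h n) * (\<Sum>n<N. F n / h n)"
    by (subst sum_over_permutations_values[of "\<lambda>n. F n / h n"]) simp
  finally show "(LINT z|(\<Pi>\<^sub>M j\<in>{..<N}. \<mu>). (\<Sum>i<N. f (z i)) * ((\<Prod>k<N. w (z k)) * (cmod (A z))\<^sup>2)) =
           fact N * (\<Prod>n<N. h n) * (\<Sum>n<N. (LINT z|\<mu>. f z * (w z * (cmod (P n z))\<^sup>2)) / h n)"
    unfolding F_def .
qed

section \<open>The expected number of points in a set\<close>

lemma prod_distances_eq_vandermonde:
  fixes N :: nat and z :: "nat \<Rightarrow> complex"
  shows "(\<Prod>j<N. \<Prod>k\<in>{..<N} - {j}. cmod (z j - z k)) = (cmod (\<Prod>k<N. \<Prod>i<k. z k - z i))\<^sup>2"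
proof (induction N)
  case (Suc N)
  have "(\<Prod>j<Suc N. \<Prod>k\<in>{..<Suc N} - {j}. cmod (z j - z k)) =
      (\<Prod>j<N. \<Prod>k\<in>insert N ({..<N} - {j}). cmod (z j - z k)) * (\<Prod>k<N. cmod (z N - z k))"
  proof -
    have "{..<Suc N} - {j} = insert N ({..<N} - {j})" if "j < N" for j
      using that by auto
    moreover have "{..<Suc N} - {N} = {..<N}"
      by auto
    ultimately show ?thesis
      unfolding prod.lessThan_Suc by (intro arg_cong2[where f = "(*)"] prod.cong) simp_all
  qed
  also have "(\<Prod>j<N. \<Prod>k\<in>insert N ({..<N} - {j}). cmod (z j - z k)) =
      (\<Prod>j<N. cmod (z N - z j)) * (\<Prod>j<N. \<Prod>k\<in>{..<N} - {j}. cmod (z j - z k))"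
    by (simp add: prod.distrib norm_minus_commute)
  finally show ?case
    by (simp add: Suc.IH norm_mult power_mult_distrib prod_norm[symmetric] power2_eq_square)
qed simp

lemma sets_dA [measurable_cong, simp]: "sets dA = sets borel"
  by (simp add: dA_def)

lemma space_dA [simp]: "space dA = UNIV"
  by (simp add: dA_def)

lemma sigma_finite_dA: "sigma_finite_measure dA"
  unfolding dA_def by (subst sigma_finite_measure.sigma_finite_iff_density_finite[OF sigma_finite_lborel]) auto

text \<open>On this set of full measure the convention \<open>ln (1 / 0) = 0\<close> in the energy is never used.\<close>

lemma AE_dA_prod_distinct: "AE z in dA_prod N. inj_on z {..<N}"
proof -
  interpret dA: sigma_finite_measure dA by (rule sigma_finite_dA)
  interpret pr: product_sigma_finite "\<lambda>_::nat. dA" by unfold_locales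
  have null: "AE z in dA_prod N. z j \<noteq> z k" if jk: "j < N" "k < N" "j \<noteq> k" for j k
  proof -
    define I where "I = {..<N} - {j}"
    have I: "insert j I = {..<N}" "finite I" "j \<notin> I" "k \<in> I"
      using jk by (auto simp: I_def)
    have m: "{z \<in> space (dA_prod N). z j = z k} \<in> sets (dA_prod N)"
    proof -
      have [measurable]: "(\<lambda>z. z i) \<in> borel_measurable (dA_prod N)" if "i < N" for i
        using that measurable_component_singleton[of i "{..<N}" "\<lambda>_. dA"]
        by (simp add: dA_prod_def cong: measurable_cong_sets)
      show ?thesis using jk by measurable
    qed
    have "emeasure (dA_prod N) {z \<in> space (dA_prod N). z j = z k} =
       (\<integral>\<^sup>+ z. indicator {z \<in> space (dA_prod N). z j = z k} z \<partial>dA_prod N)"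
      using m by simp
    also have "\<dots> = (\<integral>\<^sup>+ x. (\<integral>\<^sup>+ y. indicator {z \<in> space (dA_prod N). z j = z k} (x(j := y)) \<partial>dA) \<partial>(\<Pi>\<^sub>M i\<in>I. dA))"
      using pr.product_nn_integral_insert[of I j "indicator {z \<in> space (dA_prod N). z j = z k}"] I m
      by (simp add: dA_prod_def)
    also have "\<dots> \<le> (\<integral>\<^sup>+ x. (\<integral>\<^sup>+ y. indicator {x k} y \<partial>dA) \<partial>(\<Pi>\<^sub>M i\<in>I. dA))"
      using jk by (intro nn_integral_mono) (auto split: split_indicator)
    also have "\<dots> = (\<integral>\<^sup>+ x. 0 \<partial>(\<Pi>\<^sub>M i\<in>I. dA))"
      by (intro nn_integral_cong) (simp add: dA_def emeasure_density nn_integral_cmult_indicator)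
    finally have "emeasure (dA_prod N) {z \<in> space (dA_prod N). z j = z k} = 0"
      by simp
    thus ?thesis
      using m by (intro AE_I[where N = "{z \<in> space (dA_prod N). z j = z k}"]) auto
  qed
  have "AE z in dA_prod N. \<forall>j\<in>{..<N}. \<forall>k\<in>{..<N}. j \<noteq> k \<longrightarrow> z j \<noteq> z k"
    by (intro AE_finite_allI finite_lessThan) (use null in auto)
  thus ?thesis
    by eventually_elim (auto simp: inj_on_def)
qed

text \<open>The interaction contributes each distance twice, hence the square of the Vandermonde product.\<close>

lemma exp_energy:
  assumes "inj_on z {..<N}"
  shows "exp (- energy N Q z) =
           (\<Prod>k<N. exp (- real N * Q (z k))) * (cmod (\<Prod>k<N. \<Prod>i<k. z k - z i))\<^sup>2"
proof -
  have "- energy N Q z =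
     (\<Sum>j<N. \<Sum>k\<in>{..<N} - {j}. - ln (1 / cmod (z j - z k))) + (\<Sum>k<N. - real N * Q (z k))"
    by (simp add: energy_def sum_negf sum_distrib_left)
  hence "exp (- energy N Q z) =
     (\<Prod>j<N. \<Prod>k\<in>{..<N} - {j}. exp (- ln (1 / cmod (z j - z k)))) * (\<Prod>k<N. exp (- real N * Q (z k)))"
    by (simp only: exp_add exp_sum finite_lessThan finite_Diff)
  also have "(\<Prod>j<N. \<Prod>k\<in>{..<N} - {j}. exp (- ln (1 / cmod (z j - z k)))) =
      (\<Prod>j<N. \<Prod>k\<in>{..<N} - {j}. cmod (z j - z k))"
    using assms by (intro prod.cong refl) (auto simp: inj_on_def ln_div)
  finally show ?thesis
    by (simp add: prod_distances_eq_vandermonde)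
qed

text \<open>Both the partition function and the expectation are integrals of alternants, the former with \<open>f = 1\<close>;
  the factors \<open>N!\<close>, the norms and the leading coefficients cancel in the quotient.\<close>

lemma expected_count_orthogonal_polynomials:
  fixes N :: nat and p :: "nat \<Rightarrow> complex poly" and Q :: "complex \<Rightarrow> real"
  defines "w \<equiv> \<lambda>z. exp (- real N * Q z)"
  assumes N: "N > 0" and Q [measurable]: "Q \<in> borel_measurable borel" 
    and deg: "\<And>j. degree (p j) = j"
    and Pint: "\<And>m n. integrable dA (\<lambda>z. of_real (w z) * (poly (p m) z * cnj (poly (p n) z)))"
    and orth: "\<And>m n. (LINT z|dA. of_real (w z) * (poly (p m) z * cnj (poly (p n) z))) =
                 (if m = n then of_real (h n) else 0)"
    and hpos: "\<And>n. h n > 0"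
    and B [measurable]: "B \<in> sets borel"
  shows "(LINT z|gibbs N Q. real (card {j. j < N \<and> z j \<in> B})) =
           (\<Sum>n<N. (LINT z|dA. indicator B z * (w z * (cmod (poly (p n) z))\<^sup>2)) / h n)"
proof -
  define V where "V z = (\<Prod>k<N. \<Prod>i<k. z k - z i)" for z :: "nat \<Rightarrow> complex"
  define c where "c = (cmod (\<Prod>j<N. lead_coeff (p j)))\<^sup>2"
  define J where "J z = (\<Prod>k<N. w (z k)) * (cmod (V z))\<^sup>2" for z
  have "lead_coeff (p j) \<noteq> 0" if "j < N" for j
  proof
    assume "lead_coeff (p j) = 0"
    hence "p j = 0" by simp
    hence "(LINT z|dA. of_real (w z) * (poly (p j) z * cnj (poly (p j) z))) = 0"
      by simp
    thus False using orth[of j j] hpos[of j] by simp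
  qed
  hence c: "c > 0"
    by (auto simp: c_def)
  have alt: "(cmod (\<Sum>\<sigma> | \<sigma> permutes {..<N}. of_int (sign \<sigma>) * (\<Prod>i<N. poly (p (\<sigma> i)) (z i))))\<^sup>2 =
      c * (cmod (V z))\<^sup>2" for z
    unfolding sum_permutations_vandermonde[OF deg] c_def V_def norm_mult power_mult_distrib ..
  have wpos: "w z > 0" for z by (simp add: w_def)
  have Jpos: "J z \<ge> 0" for z
    unfolding J_def using wpos by (intro mult_nonneg_nonneg prod_nonneg) (auto intro: less_imp_le)
  define H where "H = fact N * (\<Prod>n<N. h n)"
  have H: "H > 0" by (auto simp: H_def hpos intro!: mult_pos_pos prod_pos)
  have int: "integrable (dA_prod N) (\<lambda>z. (\<Sum>i<N. f (z i)) * J z)" (is ?A)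
    and val: "(LINT z|dA_prod N. (\<Sum>i<N. f (z i)) * J z) =
       H / c * (\<Sum>n<N. (LINT z|dA. f z * (w z * (cmod (poly (p n) z))\<^sup>2)) / h n)" (is ?B)
    if [measurable]: "f \<in> borel_measurable borel" and fb: "\<And>z. \<bar>f z\<bar> \<le> 1" for f :: "complex \<Rightarrow> real"
  proof -
    have fm: "f \<in> borel_measurable dA" by measurable
    note * = integral_orthogonal_alternant[OF sigma_finite_dA Pint orth hpos fm fb, of N,
        unfolded alt, folded dA_prod_def, OF less_imp_le[OF wpos]]
    have eq: "(\<Sum>i<N. f (z i)) * ((\<Prod>k<N. w (z k)) * (c * (cmod (V z))\<^sup>2)) = c * ((\<Sum>i<N. f (z i)) * J z)" for z
      by (simp add: J_def)
    have "integrable (dA_prod N) (\<lambda>z. c * ((\<Sum>i<N. f (z i)) * J z))"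
      using *(1) unfolding eq .
    thus ?A using c by simp
    have "c * (LINT z|dA_prod N. (\<Sum>i<N. f (z i)) * J z) =
       H * (\<Sum>n<N. (LINT z|dA. f z * (w z * (cmod (poly (p n) z))\<^sup>2)) / h n)"
      using *(2) unfolding eq H_def by simp
    thus ?B using c by (simp add: field_simps)
  qed
  have hn: "(LINT z|dA. w z * (cmod (poly (p n) z))\<^sup>2) = h n" for n
  proof -
    have "complex_of_real (LINT z|dA. w z * (cmod (poly (p n) z))\<^sup>2) =
       (LINT z|dA. complex_of_real (w z * (cmod (poly (p n) z))\<^sup>2))"
      by (rule integral_complex_of_real[symmetric])
    also have "\<dots> = of_real (h n)"
      using orth[of n n] by (simp only: of_real_mult complex_norm_square if_True simp_thms)
    finally show ?thesis by simp
  qed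
  have [simp]: "h n \<noteq> 0" for n using hpos[of n] by simp
  have J_int: "integrable (dA_prod N) J"
    using int[of "\<lambda>_. 1"] N by simp
  have J_val: "(LINT z|dA_prod N. J z) = H / c"
    using val[of "\<lambda>_. 1"] N c by (simp add: hn field_simps)
  have wm [measurable]: "w \<in> borel_measurable borel"
    unfolding w_def by measurable
  have [measurable]: "(\<lambda>z. z i) \<in> borel_measurable (dA_prod N)" if "i < N" for i
    using that measurable_component_singleton[of i "{..<N}" "\<lambda>_. dA"]
    by (simp add: dA_prod_def cong: measurable_cong_sets)
  have "(\<lambda>z. ln (1 / cmod (z j - z k))) \<in> borel_measurable (dA_prod N)"
    and "(\<lambda>z. Q (z j)) \<in> borel_measurable (dA_prod N)" if [simp]: "j < N" "k < N" for j k
    by measurable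
  hence [measurable]: "energy N Q \<in> borel_measurable (dA_prod N)"
    unfolding energy_def[abs_def]
    by (intro borel_measurable_add borel_measurable_sum borel_measurable_times borel_measurable_const) auto
  have ae: "AE z in dA_prod N. exp (- energy N Q z) = J z"
    using AE_dA_prod_distinct by eventually_elim (simp add: exp_energy J_def w_def V_def)
  have Z: "partition_fun N Q = ennreal (H / c)"
  proof -
    have "partition_fun N Q = (\<integral>\<^sup>+ z. ennreal (J z) \<partial>dA_prod N)"
      unfolding partition_fun_def using ae by (intro nn_integral_cong_AE) auto
    also have "\<dots> = ennreal (H / c)"
      using nn_integral_eq_integral[OF J_int] Jpos J_val by simp
    finally show ?thesis .
  qed
  have count: "real (card {j. j < N \<and> z j \<in> B}) = (\<Sum>i<N. indicator B (z i))" for z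
  proof -
    have "{j. j < N \<and> z j \<in> B} = {..<N} \<inter> {j. z j \<in> B}" by auto
    thus ?thesis
      by (simp add: indicator_def sum.If_cases)
  qed
  have "gibbs N Q = density (dA_prod N) (\<lambda>z. ennreal (exp (- energy N Q z) / (H / c)))"
    unfolding gibbs_def Z using H c by (simp add: divide_ennreal)
  hence "(LINT z|gibbs N Q. real (card {j. j < N \<and> z j \<in> B})) =
     (LINT z|dA_prod N. (exp (- energy N Q z) / (H / c)) * (\<Sum>i<N. indicator B (z i)))"
    using H c by (simp add: count, subst integral_density) auto
  also have "\<dots> = (LINT z|dA_prod N. (\<Sum>i<N. indicator B (z i)) * J z / (H / c))"
  proof (rule integral_cong_AE)
    have "J \<in> borel_measurable (dA_prod N)"
      using J_int by (rule borel_measurable_integrable)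
    thus "(\<lambda>z. (\<Sum>i<N. indicator B (z i)) * J z / (H / c)) \<in> borel_measurable (dA_prod N)"
      by measurable
    show "AE z in dA_prod N. exp (- energy N Q z) / (H / c) * (\<Sum>i<N. indicator B (z i)) =
        (\<Sum>i<N. indicator B (z i)) * J z / (H / c)"
      using ae by eventually_elim simp
  qed measurable
  also have "\<dots> = (\<Sum>n<N. (LINT z|dA. indicator B z * (w z * (cmod (poly (p n) z))\<^sup>2)) / h n)"
    using val[of "indicator B"] H c by (simp add: indicator_def abs_if)
  finally show ?thesis .
qed

section \<open>Gaussian and Gamma integrals\<close>

lemma measurable_Complex [measurable]: "(\<lambda>(x, y). Complex x y) \<in> borel \<Otimes>\<^sub>M borel \<rightarrow>\<^sub>M borel"
proof -
  have "(\<lambda>(x, y). Complex x y) = (\<lambda>p. of_real (fst p) + \<i> * of_real (snd p))"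
    by (auto simp: complex_eq_iff)
  thus ?thesis by simp
qed

text \<open>Transports Fubini's theorem from the product of two lines to the complex plane.\<close>

lemma lborel_complex_eq: "distr (lborel \<Otimes>\<^sub>M lborel) borel (\<lambda>(x, y). Complex x y) = lborel"
proof (rule lborel_eqI[symmetric])
  fix l u :: complex
  assume le: "\<And>b. b \<in> Basis \<Longrightarrow> l \<bullet> b \<le> u \<bullet> b"
  have le': "Re l \<le> Re u" "Im l \<le> Im u"
    using le[of 1] le[of \<i>] by (simp_all add: Basis_complex_def)
  have "(\<lambda>(x, y). Complex x y) -` box l u \<inter> space (lborel \<Otimes>\<^sub>M lborel) =
      {Re l<..<Re u} \<times> {Im l<..<Im u}"
    by (auto simp: space_pair_measure box_def Basis_complex_def)
  hence "emeasure (distr (lborel \<Otimes>\<^sub>M lborel) borel (\<lambda>(x, y). Complex x y)) (box l u) =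
      emeasure (lborel \<Otimes>\<^sub>M lborel) ({Re l<..<Re u} \<times> {Im l<..<Im u})"
    by (subst emeasure_distr) auto
  also have "\<dots> = ennreal (Re u - Re l) * ennreal (Im u - Im l)"
    using le' by (subst lborel.emeasure_pair_measure_Times) auto
  also have "\<dots> = ennreal (\<Prod>b\<in>Basis. (u - l) \<bullet> b)"
    using le' by (simp add: Basis_complex_def ennreal_mult)
  finally show "emeasure (distr (lborel \<Otimes>\<^sub>M lborel) borel (\<lambda>(x, y). Complex x y)) (box l u) =
     ennreal (\<Prod>b\<in>Basis. (u - l) \<bullet> b)" .
qed simp

lemma nn_integral_complex_iterated:
  fixes f :: "complex \<Rightarrow> ennreal"
  assumes [measurable]: "f \<in> borel_measurable borel"
  shows "(\<integral>\<^sup>+ z. f z \<partial>lborel) = (\<integral>\<^sup>+ x. \<integral>\<^sup>+ y. f (Complex x y) \<partial>lborel \<partial>lborel)"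
proof -
  have "(\<integral>\<^sup>+ z. f z \<partial>lborel) = (\<integral>\<^sup>+ p. f (case p of (x, y) \<Rightarrow> Complex x y) \<partial>(lborel \<Otimes>\<^sub>M lborel))"
    by (subst lborel_complex_eq[symmetric], subst nn_integral_distr) auto
  also have "\<dots> = (\<integral>\<^sup>+ x. \<integral>\<^sup>+ y. f (Complex x y) \<partial>lborel \<partial>lborel)"
    by (subst lborel.nn_integral_fst[symmetric]) auto
  finally show ?thesis .
qed

lemma integral_complex_product:
  fixes f g :: "real \<Rightarrow> complex"
  assumes f: "integrable lborel f" and g: "integrable lborel g"
  shows "(LINT z|lborel. f (Re z) * g (Im z)) = (LINT x|lborel. f x) * (LINT y|lborel. g y)"
proof -
  have [measurable]: "f \<in> borel_measurable borel" "g \<in> borel_measurable borel"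
    using f g borel_measurable_integrable by fastforce+
  have int: "integrable (lborel \<Otimes>\<^sub>M lborel) (\<lambda>p. f (fst p) * g (snd p))"
    by (rule lborel_pair.Fubini_integrable) (use f g in \<open>simp_all add: norm_mult\<close>)
  have "(LINT z|lborel. f (Re z) * g (Im z)) = (LINT p|(lborel \<Otimes>\<^sub>M lborel). f (fst p) * g (snd p))"
    by (subst lborel_complex_eq[symmetric], subst integral_distr) (auto simp: case_prod_beta)
  also have "\<dots> = (LINT x|lborel. LINT y|lborel. f x * g y)"
    using lborel_pair.integral_fst'[OF int] by simp
  finally show ?thesis by simp
qed

text \<open>Completing the square reduces Gaussian integrals to the normalisation of the normal density.\<close>

lemma exp_gaussian_eq_normal_density:
  fixes s u x :: real
  assumes s: "s > 0"
  shows "exp (u * x - s * x\<^sup>2) =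
           (sqrt (pi / s) * exp (u\<^sup>2 / (4 * s))) * normal_density (u / (2 * s)) (1 / sqrt (2 * s)) x"
proof -
  have 1: "sqrt (2 * pi * (1 / sqrt (2 * s))\<^sup>2) = sqrt (pi / s)"
    using s by (simp add: power_divide)
  have 2: "u * x - s * x\<^sup>2 = u\<^sup>2 / (4 * s) - (x - u / (2 * s))\<^sup>2 / (2 * (1 / sqrt (2 * s))\<^sup>2)"
    using s by (simp add: power_divide) (simp add: power2_eq_square field_simps)
  have "exp (u * x - s * x\<^sup>2) =
      exp (u\<^sup>2 / (4 * s)) * exp (- (x - u / (2 * s))\<^sup>2 / (2 * (1 / sqrt (2 * s))\<^sup>2))"
    unfolding 2 exp_add[symmetric] by simp
  thus ?thesis
    unfolding normal_density_def 1 using s by simp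
qed

lemma has_bochner_integral_exp_gaussian:
  fixes s u :: real
  assumes s: "s > 0"
  shows "integrable lborel (\<lambda>x. exp (u * x - s * x\<^sup>2))"
    and "(LINT x|lborel. exp (u * x - s * x\<^sup>2)) = sqrt (pi / s) * exp (u\<^sup>2 / (4 * s))"
  unfolding exp_gaussian_eq_normal_density[OF s] using s by simp_all

lemma nn_integral_exp_gaussian:
  fixes s u :: real
  assumes s: "s > 0"
  shows "(\<integral>\<^sup>+ x. ennreal (exp (u * x - s * x\<^sup>2)) \<partial>lborel) = ennreal (sqrt (pi / s) * exp (u\<^sup>2 / (4 * s)))"
  using has_bochner_integral_exp_gaussian[OF s]
  by (subst nn_integral_eq_integral) auto

text \<open>A rescaling of the characteristic function of the standard normal distribution.\<close>

lemma gaussian_fourier: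
  fixes s v :: real
  assumes s: "s > 0"
  shows "integrable lborel (\<lambda>y. exp (\<i> * of_real (v * y) - of_real (s * y\<^sup>2)))"
    and "(LINT y|lborel. exp (\<i> * of_real (v * y) - of_real (s * y\<^sup>2))) =
           complex_of_real (sqrt (pi / s) * exp (- (v\<^sup>2 / (4 * s))))"
proof -
  have norm: "norm (exp (\<i> * of_real (v * y) - of_real (s * y\<^sup>2))) = exp (0 * y - s * y\<^sup>2)" for y
    by simp
  show int: "integrable lborel (\<lambda>y. exp (\<i> * of_real (v * y) - of_real (s * y\<^sup>2)))"
  proof (rule Bochner_Integration.integrable_bound[OF has_bochner_integral_exp_gaussian(1)[OF s, of 0]])
    show "AE y in lborel. norm (exp (\<i> * of_real (v * y) - of_real (s * y\<^sup>2))) \<le> norm (exp (0 * y - s * y\<^sup>2))"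
      unfolding norm by simp
  qed measurable
  define c where "c = 1 / sqrt (2 * s)"
  have c: "c > 0" "s * c\<^sup>2 = 1 / 2" using s by (auto simp: c_def power_divide)
  have "(LINT y|lborel. exp (\<i> * of_real (v * y) - of_real (s * y\<^sup>2))) =
     \<bar>c\<bar> *\<^sub>R (LINT y|lborel. exp (\<i> * of_real (v * (0 + c * y)) - of_real (s * (0 + c * y)\<^sup>2)))"
    by (rule lborel_integral_real_affine) (use c in simp)
  also have "(LINT y|lborel. exp (\<i> * of_real (v * (0 + c * y)) - of_real (s * (0 + c * y)\<^sup>2))) =
     (LINT y|lborel. sqrt (2 * pi) *\<^sub>R (std_normal_density y *\<^sub>R exp (\<i> * of_real ((v * c) * y))))"
  proof (intro Bochner_Integration.integral_cong refl)
    fix y :: real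
    have "s * (0 + c * y)\<^sup>2 = y\<^sup>2 / 2"
      using c by (simp add: power_mult_distrib flip: mult.assoc)
    have "\<i> * complex_of_real (v * (0 + c * y)) - of_real (s * (0 + c * y)\<^sup>2) =
        of_real (- (y\<^sup>2 / 2)) + \<i> * of_real ((v * c) * y)"
      by (simp only: \<open>s * (0 + c * y)\<^sup>2 = y\<^sup>2 / 2\<close>) simp
    hence "exp (\<i> * of_real (v * (0 + c * y)) - of_real (s * (0 + c * y)\<^sup>2)) =
       of_real (exp (- (y\<^sup>2 / 2))) * exp (\<i> * of_real ((v * c) * y))"
      by (simp only: exp_add exp_of_real)
    thus "exp (\<i> * of_real (v * (0 + c * y)) - of_real (s * (0 + c * y)\<^sup>2)) =
        sqrt (2 * pi) *\<^sub>R (std_normal_density y *\<^sub>R exp (\<i> * of_real ((v * c) * y)))"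
      by (simp add: std_normal_density_def scaleR_conv_of_real)
  qed
  also have "\<dots> = sqrt (2 * pi) *\<^sub>R (LINT y|lborel. std_normal_density y *\<^sub>R exp (\<i> * of_real ((v * c) * y)))"
    by (simp only: integral_scaleR_right)
  also have "\<dots> = sqrt (2 * pi) *\<^sub>R char std_normal_distribution (v * c)"
    unfolding char_def by (subst integral_density) simp_all
  also have "char std_normal_distribution (v * c) = of_real (exp (- ((v * c)\<^sup>2) / 2))"
    by (simp add: char_std_normal_distribution)
  also have "(v * c)\<^sup>2 / 2 = v\<^sup>2 / (4 * s)"
    using s by (simp add: c_def power_mult_distrib power_divide)
  hence "- ((v * c)\<^sup>2) / 2 = - (v\<^sup>2 / (4 * s))" by simp
  also have "\<bar>c\<bar> *\<^sub>R (sqrt (2 * pi) *\<^sub>R complex_of_real (exp (- (v\<^sup>2 / (4 * s))))) =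
      complex_of_real (sqrt (pi / s) * exp (- (v\<^sup>2 / (4 * s))))"
  proof -
    have "\<bar>c\<bar> * sqrt (2 * pi) = sqrt (pi / s)"
      using s by (simp add: c_def real_sqrt_mult real_sqrt_divide)
    thus ?thesis by (simp add: scaleR_conv_of_real flip: of_real_mult mult.assoc)
  qed
  finally show "(LINT y|lborel. exp (\<i> * of_real (v * y) - of_real (s * y\<^sup>2))) =
           complex_of_real (sqrt (pi / s) * exp (- (v\<^sup>2 / (4 * s))))" .
qed

lemma nn_integral_exp_gaussian_plane:
  fixes s u v :: real
  assumes s: "s > 0"
  shows "(\<integral>\<^sup>+ z. ennreal (exp (u * Re z + v * Im z - s * (cmod z)\<^sup>2)) \<partial>lborel) =
           ennreal (pi / s * exp ((u\<^sup>2 + v\<^sup>2) / (4 * s)))"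
proof -
  have "(\<integral>\<^sup>+ z. ennreal (exp (u * Re z + v * Im z - s * (cmod z)\<^sup>2)) \<partial>lborel) =
      (\<integral>\<^sup>+ x. \<integral>\<^sup>+ y. ennreal (exp (u * x - s * x\<^sup>2)) * ennreal (exp (v * y - s * y\<^sup>2)) \<partial>lborel \<partial>lborel)"
    by (subst nn_integral_complex_iterated, simp, intro nn_integral_cong)
       (simp add: ennreal_mult[symmetric] cmod_def exp_add[symmetric] algebra_simps)
  also have "\<dots> = ennreal (sqrt (pi / s) * exp (u\<^sup>2 / (4 * s))) * ennreal (sqrt (pi / s) * exp (v\<^sup>2 / (4 * s)))"
    by (subst nn_integral_cmult, simp, subst nn_integral_multc, simp)
       (simp only: nn_integral_exp_gaussian[OF s])
  also have "\<dots> = ennreal ((sqrt (pi / s) * sqrt (pi / s)) * (exp (u\<^sup>2 / (4 * s)) * exp (v\<^sup>2 / (4 * s))))"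
    using s by (subst ennreal_mult[symmetric]) (simp_all only: mult_ac, simp_all)
  also have "\<dots> = ennreal (pi / s * exp ((u\<^sup>2 + v\<^sup>2) / (4 * s)))"
    using s by (simp add: exp_add[symmetric] add_divide_distrib)
  finally show ?thesis .
qed

lemma integral_exp_gaussian_plane:
  fixes s u v :: real
  assumes s: "s > 0"
  shows "(LINT z|lborel. exp (of_real (u * Re z) + \<i> * of_real (v * Im z) - of_real (s * (cmod z)\<^sup>2))) =
           complex_of_real (pi / s * exp ((u\<^sup>2 - v\<^sup>2) / (4 * s)))"
proof -
  have *: "exp (of_real (u * Re z) + \<i> * of_real (v * Im z) - of_real (s * (cmod z)\<^sup>2)) =
      complex_of_real (exp (u * Re z - s * (Re z)\<^sup>2)) * exp (\<i> * of_real (v * Im z) - of_real (s * (Im z)\<^sup>2))" for z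
  proof -
    have "of_real (u * Re z) + \<i> * of_real (v * Im z) - of_real (s * (cmod z)\<^sup>2) =
        of_real (u * Re z - s * (Re z)\<^sup>2) + (\<i> * of_real (v * Im z) - complex_of_real (s * (Im z)\<^sup>2))"
      by (simp add: cmod_power2 algebra_simps)
    thus ?thesis by (simp only: exp_add exp_of_real)
  qed
  have "(LINT z|lborel. exp (of_real (u * Re z) + \<i> * of_real (v * Im z) - of_real (s * (cmod z)\<^sup>2))) =
     (LINT x|lborel. complex_of_real (exp (u * x - s * x\<^sup>2))) *
     (LINT y|lborel. exp (\<i> * of_real (v * y) - of_real (s * y\<^sup>2)))"
    unfolding * 
    by (rule integral_complex_product)
       (use has_bochner_integral_exp_gaussian(1)[OF s] gaussian_fourier(1)[OF s] in \<open>auto intro: integrable_of_real\<close>)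
  also have "(LINT x|lborel. complex_of_real (exp (u * x - s * x\<^sup>2))) = of_real (sqrt (pi / s) * exp (u\<^sup>2 / (4 * s)))"
    using has_bochner_integral_exp_gaussian[OF s] by simp
  also have "(LINT y|lborel. exp (\<i> * of_real (v * y) - of_real (s * y\<^sup>2))) =
      complex_of_real (sqrt (pi / s) * exp (- (v\<^sup>2 / (4 * s))))"
    by (rule gaussian_fourier[OF s])
  also have "complex_of_real (sqrt (pi / s) * exp (u\<^sup>2 / (4 * s))) * complex_of_real (sqrt (pi / s) * exp (- (v\<^sup>2 / (4 * s)))) =
      complex_of_real ((sqrt (pi / s) * sqrt (pi / s)) * (exp (u\<^sup>2 / (4 * s)) * exp (- (v\<^sup>2 / (4 * s)))))"
    by (simp only: of_real_mult mult_ac)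
  also have "\<dots> = complex_of_real (pi / s * exp ((u\<^sup>2 - v\<^sup>2) / (4 * s)))"
    using s by (simp add: exp_add[symmetric] diff_divide_distrib)
  finally show ?thesis .
qed

text \<open>Euler's integral after the substitution \<open>s = exp t\<close>; the translation \<open>t \<mapsto> t - ln d\<close> produces the
  power of \<open>d\<close>. In this logarithmic form all later rescalings are translations of the line.\<close>

lemma nn_integral_exp_Gamma:
  fixes \<mu> d :: real
  assumes \<mu>: "\<mu> > 0" and d: "d > 0"
  shows "(\<integral>\<^sup>+ t. ennreal (exp (\<mu> * t - d * exp t)) \<partial>lborel) = ennreal (Gamma \<mu> * d powr (- \<mu>))"
proof -
  define f where "f t = exp (\<mu> * t - exp t)" for t :: real
  have f_ln: "f (ln s) / s = s powr (\<mu> - 1) / exp s" if "s > 0" for s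
    using that by (simp add: f_def exp_diff powr_diff) (simp add: powr_def)
  have hi: "((\<lambda>s. s powr (\<mu> - 1) / exp s) has_integral Gamma \<mu>) {0<..}"
  proof -
    have "((\<lambda>s. if s \<in> {0<..} then s powr (\<mu> - 1) / exp s else 0) has_integral Gamma \<mu>) {0..}"
      by (rule has_integral_spike[OF _ _ Gamma_integral_real[OF \<mu>], of "{0}"]) auto
    thus ?thesis by (subst (asm) has_integral_restrict) auto
  qed
  have ln0: "((ereal \<circ> ln \<circ> real_of_ereal) \<longlongrightarrow> -\<infinity>) (at_right 0)"
    using ln_at_0 by (simp add: zero_ereal_def ereal_tendsto_simps)
  have lninf: "((ereal \<circ> ln \<circ> real_of_ereal) \<longlongrightarrow> \<infinity>) (at_left \<infinity>)"
    using ln_at_top by (simp add: ereal_tendsto_simps)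
  have e0: "einterval 0 \<infinity> = {0<..}"
    by (auto simp: einterval_def zero_ereal_def)
  have absint: "(\<lambda>s. s powr (\<mu> - 1) / exp s) absolutely_integrable_on {0<..}"
    using hi by (intro nonnegative_absolutely_integrable_1) (auto simp: has_integral_integrable)
  hence si: "set_integrable lborel {0<..} (\<lambda>s. s powr (\<mu> - 1) / exp s)"
    unfolding set_integrable_def by (subst (asm) integrable_completion) auto
  have si': "set_integrable lborel (einterval 0 \<infinity>) (\<lambda>s. f (ln s) * (1 / s))"
    unfolding e0 using si by (rule set_integrable_cong[THEN iffD1, rotated 3]) (auto simp: f_ln)
  note S = interval_integral_substitution_nonneg[of 0 \<infinity> ln "\<lambda>s. 1 / s" f "-\<infinity>" \<infinity>, OF _ _ _ _ _ _ ln0 lninf si']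
  have contf: "isCont f t" for t
    unfolding f_def[abs_def] by (intro continuous_intros)
  have S1: "set_integrable lborel (einterval (-\<infinity>) \<infinity>) f"
    by (rule S(1)) (auto simp: contf f_def zero_ereal_def intro!: derivative_eq_intros continuous_intros)
  have S2: "(LBINT x=-\<infinity>..\<infinity>. f x) = (LBINT s=0..\<infinity>. f (ln s) * (1 / s))"
    by (rule S(2)) (auto simp: contf f_def zero_ereal_def intro!: derivative_eq_intros continuous_intros)
  have int: "integrable lborel f"
    using S1 by (simp add: set_integrable_def)
  have "(LINT t|lborel. f t) = (LBINT s:{0<..}. s powr (\<mu> - 1) / exp s)"
    using S2 f_ln unfolding interval_lebesgue_integral_def e0
    by (auto simp: set_lebesgue_integral_def intro!: Bochner_Integration.integral_cong split: split_indicator)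
  also have "\<dots> = Gamma \<mu>"
    using set_borel_integral_eq_integral(2)[OF si] integral_unique[OF hi] by simp
  finally have val: "(LINT t|lborel. f t) = Gamma \<mu>" .
  have "(\<integral>\<^sup>+ t. ennreal (exp (\<mu> * t - d * exp t)) \<partial>lborel) =
     ennreal \<bar>1\<bar> * (\<integral>\<^sup>+ t. ennreal (exp (\<mu> * (- ln d + 1 * t) - d * exp (- ln d + 1 * t))) \<partial>lborel)"
    by (rule nn_integral_real_affine) auto
  also have "\<dots> = (\<integral>\<^sup>+ t. ennreal (d powr (- \<mu>)) * ennreal (f t) \<partial>lborel)"
    using d by (simp only: abs_one ennreal_1 mult_1, intro nn_integral_cong)
       (simp add: f_def exp_diff exp_add exp_minus powr_def field_simps flip: ennreal_mult)
  also have "\<dots> = ennreal (d powr (- \<mu>)) * ennreal (Gamma \<mu>)"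
  proof -
    have "(\<integral>\<^sup>+ t. ennreal (f t) \<partial>lborel) = ennreal (Gamma \<mu>)"
      using nn_integral_eq_integral[OF int] val by (simp add: f_def)
    moreover have "(\<lambda>t. ennreal (f t)) \<in> borel_measurable lborel"
      unfolding f_def by measurable
    ultimately show ?thesis by (simp add: nn_integral_cmult)
  qed
  also have "\<dots> = ennreal (Gamma \<mu> * d powr (- \<mu>))"
    using \<mu> by (simp add: ennreal_mult[symmetric] Gamma_real_nonneg mult.commute)
  finally show ?thesis .
qed

section \<open>The Macdonald function\<close>

lemma cosh_ge_quadratic: "cosh t \<ge> 1 + t\<^sup>2 / 2" for t :: real
proof -
  have *: "(\<lambda>n. if even n then t ^ n /\<^sub>R fact n else 0) sums cosh t"
    by (rule cosh_converges)
  have "(\<Sum>n<3. if even n then t ^ n /\<^sub>R fact n else 0) \<le> cosh t"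
    unfolding sums_unique[OF *]
    by (rule sum_le_suminf) (use * in \<open>auto simp: sums_iff zero_le_even_power\<close>)
  thus ?thesis by (simp add: eval_nat_numeral field_simps)
qed

text \<open>\<open>2 K\<^sub>\<mu>(X)\<close> for \<open>X > 0\<close>, written as an integral over the whole line so that translations apply to it.\<close>

definition bessel_line :: "real \<Rightarrow> real \<Rightarrow> real" where
  "bessel_line \<mu> X = (LINT t|lborel. exp (\<mu> * t - X * cosh t))"

lemma borel_measurable_cosh_real [measurable]: "(cosh :: real \<Rightarrow> real) \<in> borel_measurable borel"
  by (intro borel_measurable_continuous_onI continuous_intros)

lemma integrable_bessel_line:
  fixes \<mu> X :: real
  assumes X: "X > 0"
  shows "integrable lborel (\<lambda>t. exp (\<mu> * t - X * cosh t))"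
proof (rule Bochner_Integration.integrable_bound)
  show "integrable lborel (\<lambda>t. exp (- X) * exp (\<mu> * t - (X / 2) * t\<^sup>2))"
    using X by (intro integrable_mult_right has_bochner_integral_exp_gaussian) simp
  show "AE t in lborel. norm (exp (\<mu> * t - X * cosh t)) \<le> norm (exp (- X) * exp (\<mu> * t - (X / 2) * t\<^sup>2))"
  proof (intro AE_I2)
    fix t :: real
    have "X * (1 + t\<^sup>2 / 2) \<le> X * cosh t"
      using X cosh_ge_quadratic[of t] by (intro mult_left_mono) auto
    thus "norm (exp (\<mu> * t - X * cosh t)) \<le> norm (exp (- X) * exp (\<mu> * t - (X / 2) * t\<^sup>2))"
      by (simp add: exp_add[symmetric] algebra_simps)
  qed
qed measurable

lemma bessel_line_nonneg: "bessel_line \<mu> X \<ge> 0"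
  unfolding bessel_line_def by simp

text \<open>The integrand over the whole line is folded at the origin; its even part in \<open>\<mu>\<close> is the hyperbolic cosine.\<close>

lemma bessel_K_eq_bessel_line:
  assumes x: "x > 0"
  shows "bessel_K \<nu> x = bessel_line \<nu> x / 2"
proof -
  define f where "f t = exp (\<nu> * t - x * cosh t)" for t
  have int: "integrable lborel f"
    unfolding f_def using x by (rule integrable_bessel_line)
  hence [measurable]: "f \<in> borel_measurable borel"
    using borel_measurable_integrable by fastforce
  have int_m: "integrable lborel (\<lambda>t. f (0 + (-1) * t))"
    using int by (rule lborel_integrable_real_affine) simp
  have "bessel_line \<nu> x = (LINT t|lborel. indicator {0<..} t * f t + indicator {..<0} t * f t)"
    unfolding bessel_line_def f_def[symmetric]
    by (intro integral_cong_AE)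
       (auto intro!: AE_mp[OF AE_lborel_singleton[of 0] AE_I2] split: split_indicator)
  also have "\<dots> = (LINT t|lborel. indicator {0<..} t * f t) + (LINT t|lborel. indicator {..<0} t * f t)"
    by (intro Bochner_Integration.integral_add) (use int in \<open>auto intro!: integrable_real_mult_indicator simp: mult.commute\<close>)
  also have "(LINT t|lborel. indicator {..<0} t * f t) = (LINT t|lborel. indicator {0<..} t * f (- t))"
    using lborel_integral_real_affine[of "-1" "\<lambda>t. indicator {..<0} t * f t" 0]
    by (simp add: indicator_def)
  also have "(LINT t|lborel. indicator {0<..} t * f t) + (LINT t|lborel. indicator {0<..} t * f (- t)) =
      (LINT t|lborel. indicator {0<..} t * f t + indicator {0<..} t * f (- t))"
    by (intro Bochner_Integration.integral_add[symmetric])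
       (use int int_m in \<open>auto intro!: integrable_real_mult_indicator simp: mult.commute\<close>)
  also have "\<dots> = (LINT t|lborel. 2 * (indicator {0<..} t * (exp (- x * cosh t) * cosh (\<nu> * t))))"
  proof (intro Bochner_Integration.integral_cong refl)
    fix t :: real
    have "f t + f (- t) = 2 * (exp (- x * cosh t) * cosh (\<nu> * t))"
      by (simp add: f_def cosh_def[of "\<nu> * t"] exp_diff exp_minus field_simps)
    thus "indicator {0<..} t * f t + indicator {0<..} t * f (- t) =
        2 * (indicator {0<..} t * (exp (- x * cosh t) * cosh (\<nu> * t)))"
      by (auto split: split_indicator)
  qed
  also have "\<dots> = 2 * bessel_K \<nu> x"
    by (simp add: bessel_K_def set_lebesgue_integral_def)
  finally show ?thesis by simp
qed

lemma bessel_line_pos: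
  assumes x: "x > 0"
  shows "bessel_line \<nu> x > 0"
proof -
  have "bessel_line \<nu> x \<noteq> 0"
  proof
    assume "bessel_line \<nu> x = 0"
    hence "AE t in lborel. exp (\<nu> * t - x * cosh t) = 0"
      unfolding bessel_line_def
      by (subst (asm) integral_nonneg_eq_0_iff_AE) (use integrable_bessel_line[OF x] in auto)
    hence "AE t in (lborel :: real measure). False" by simp
    thus False by (rule AE_E) (auto simp: top_unique)
  qed
  thus ?thesis using bessel_line_nonneg[of \<nu> x] by simp
qed

text \<open>The leading behaviour \<open>exp (- X) / sqrt X\<close> at infinity is divided out, so that the result is bounded and
  has a limit.\<close>

definition bessel_scaled :: "real \<Rightarrow> real \<Rightarrow> real" where
  "bessel_scaled \<mu> X = sqrt X * exp X * bessel_line \<mu> X"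

text \<open>Laplace's method: the substitution \<open>t = v / sqrt X\<close> makes the integrand converge to a Gaussian.\<close>

lemma bessel_scaled_eq:
  assumes X: "X > 0"
  shows "bessel_scaled \<mu> X = (LINT v|lborel. exp (\<mu> * (v / sqrt X) - X * (cosh (v / sqrt X) - 1)))"
proof -
  have "bessel_line \<mu> X = (1 / sqrt X) * (LINT v|lborel. exp (\<mu> * (v / sqrt X) - X * cosh (v / sqrt X)))"
    using lborel_integral_real_affine[of "1 / sqrt X" "\<lambda>t. exp (\<mu> * t - X * cosh t)" 0] X
    by (simp add: bessel_line_def)
  hence "bessel_scaled \<mu> X = exp X * (LINT v|lborel. exp (\<mu> * (v / sqrt X) - X * cosh (v / sqrt X)))"
    using X by (simp add: bessel_scaled_def)
  also have "\<dots> = (LINT v|lborel. exp X * exp (\<mu> * (v / sqrt X) - X * cosh (v / sqrt X)))"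
    by simp
  also have "\<dots> = (LINT v|lborel. exp (\<mu> * (v / sqrt X) - X * (cosh (v / sqrt X) - 1)))"
    by (intro Bochner_Integration.integral_cong refl) (simp add: exp_add[symmetric] algebra_simps)
  finally show ?thesis .
qed

text \<open>The integral of the majorant used in Laplace's method below.\<close>

definition bessel_scaled_bound :: "real \<Rightarrow> real" where
  "bessel_scaled_bound \<mu> = (LINT v|lborel. exp (\<bar>\<mu>\<bar> * \<bar>v\<bar> - v\<^sup>2 / 2))"

lemma integrable_exp_abs_gaussian: "integrable lborel (\<lambda>v. exp (m * \<bar>v\<bar> - v\<^sup>2 / 2))" for m :: real
proof (rule Bochner_Integration.integrable_bound)
  show "integrable lborel (\<lambda>v. exp (m * v - (1 / 2) * v\<^sup>2) + exp ((- m) * v - (1 / 2) * v\<^sup>2))"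
    by (intro Bochner_Integration.integrable_add has_bochner_integral_exp_gaussian) simp_all
  show "AE v in lborel. norm (exp (m * \<bar>v\<bar> - v\<^sup>2 / 2)) \<le>
      norm (exp (m * v - (1 / 2) * v\<^sup>2) + exp ((- m) * v - (1 / 2) * v\<^sup>2))"
  proof (intro AE_I2)
    fix v :: real
    have "exp (m * \<bar>v\<bar> - v\<^sup>2 / 2) \<le> exp (m * v - (1 / 2) * v\<^sup>2) + exp ((- m) * v - (1 / 2) * v\<^sup>2)"
      by (cases "v \<ge> 0") (simp_all add: add_increasing add_increasing2)
    thus "norm (exp (m * \<bar>v\<bar> - v\<^sup>2 / 2)) \<le> norm (exp (m * v - (1 / 2) * v\<^sup>2) + exp ((- m) * v - (1 / 2) * v\<^sup>2))"
      by simp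
  qed
qed measurable

text \<open>The majorant does not depend on \<open>X\<close>, because \<open>cosh t \<ge> 1 + t\<^sup>2 / 2\<close>.\<close>

lemma bessel_scaled_integrand_bound:
  assumes X: "X \<ge> 1"
  shows "norm (exp (\<mu> * (v / sqrt X) - X * (cosh (v / sqrt X) - 1))) \<le> exp (\<bar>\<mu>\<bar> * \<bar>v\<bar> - v\<^sup>2 / 2)"
proof -
  have "\<mu> * (v / sqrt X) \<le> \<bar>\<mu> * (v / sqrt X)\<bar>" by (rule abs_ge_self)
  also have "\<dots> = \<bar>\<mu>\<bar> * \<bar>v\<bar> / sqrt X" using X by (simp add: abs_mult)
  also have "\<dots> \<le> \<bar>\<mu>\<bar> * \<bar>v\<bar>"
    using X mult_left_mono[of 1 "sqrt X" "\<bar>\<mu>\<bar> * \<bar>v\<bar>"] by (simp add: divide_le_eq)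
  finally have 1: "\<mu> * (v / sqrt X) \<le> \<bar>\<mu>\<bar> * \<bar>v\<bar>" .
  have "v\<^sup>2 / 2 = X * ((v / sqrt X)\<^sup>2 / 2)" using X by (simp add: power_divide)
  also have "\<dots> \<le> X * (cosh (v / sqrt X) - 1)"
    using X cosh_ge_quadratic[of "v / sqrt X"] by (intro mult_left_mono) auto
  finally show ?thesis using 1 by simp
qed

lemma bessel_scaled_le_bound:
  assumes X: "X \<ge> 1"
  shows "bessel_scaled \<mu> X \<le> bessel_scaled_bound \<mu>"
proof -
  have "bessel_scaled \<mu> X = (LINT v|lborel. exp (\<mu> * (v / sqrt X) - X * (cosh (v / sqrt X) - 1)))"
    using X by (intro bessel_scaled_eq) simp
  also have "\<dots> \<le> bessel_scaled_bound \<mu>"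
    unfolding bessel_scaled_bound_def
  proof (rule integral_mono[OF Bochner_Integration.integrable_bound])
    show "integrable lborel (\<lambda>v. exp (\<bar>\<mu>\<bar> * \<bar>v\<bar> - v\<^sup>2 / 2))"
      by (rule integrable_exp_abs_gaussian)
    thus "integrable lborel (\<lambda>v. exp (\<bar>\<mu>\<bar> * \<bar>v\<bar> - v\<^sup>2 / 2))" .
    show "AE v in lborel. norm (exp (\<mu> * (v / sqrt X) - X * (cosh (v / sqrt X) - 1))) \<le> norm (exp (\<bar>\<mu>\<bar> * \<bar>v\<bar> - v\<^sup>2 / 2))"
      using bessel_scaled_integrand_bound[OF X] by (intro AE_I2) auto
    show "exp (\<mu> * (v / sqrt X) - X * (cosh (v / sqrt X) - 1)) \<le> exp (\<bar>\<mu>\<bar> * \<bar>v\<bar> - v\<^sup>2 / 2)" for v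
      using bessel_scaled_integrand_bound[OF X, of \<mu> v] by simp
  qed measurable
  finally show ?thesis .
qed

lemma bessel_scaled_nonneg: "X \<ge> 0 \<Longrightarrow> bessel_scaled \<mu> X \<ge> 0"
  unfolding bessel_scaled_def using bessel_line_nonneg by simp

lemma tendsto_scaled_cosh:
  "((\<lambda>X. X * (cosh (v / sqrt X) - 1)) \<longlongrightarrow> v\<^sup>2 / 2) at_top" for v :: real
proof -
  have "((\<lambda>X. X * (cosh (v / sqrt X) - 1)) \<longlongrightarrow> v * v / 2) at_top"
    unfolding cosh_field_def by real_asymp
  thus ?thesis by (simp add: power2_eq_square)
qed

lemma bessel_scaled_tendsto: "(bessel_scaled \<mu> \<longlongrightarrow> sqrt (2 * pi)) at_top"
proof -
  have "((\<lambda>X. LINT v|lborel. exp (\<mu> * (v / sqrt X) - X * (cosh (v / sqrt X) - 1))) \<longlongrightarrow>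
         (LINT v|lborel. exp (0 * v - (1 / 2) * v\<^sup>2))) at_top"
  proof (rule integral_dominated_convergence_at_top[where w = "\<lambda>v. exp (\<bar>\<mu>\<bar> * \<bar>v\<bar> - v\<^sup>2 / 2)"])
    show "integrable lborel (\<lambda>v. exp (\<bar>\<mu>\<bar> * \<bar>v\<bar> - v\<^sup>2 / 2))"
      by (rule integrable_exp_abs_gaussian)
    show "\<forall>\<^sub>F X in at_top. AE v in lborel. norm (exp (\<mu> * (v / sqrt X) - X * (cosh (v / sqrt X) - 1))) \<le> exp (\<bar>\<mu>\<bar> * \<bar>v\<bar> - v\<^sup>2 / 2)"
      using eventually_ge_at_top[of 1] by eventually_elim (use bessel_scaled_integrand_bound in auto)
    show "AE v in lborel. ((\<lambda>X. exp (\<mu> * (v / sqrt X) - X * (cosh (v / sqrt X) - 1))) \<longlongrightarrow> exp (0 * v - (1 / 2) * v\<^sup>2)) at_top"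
    proof (intro AE_I2 tendsto_exp tendsto_diff)
      fix v :: real
      show "((\<lambda>X. \<mu> * (v / sqrt X)) \<longlongrightarrow> 0 * v) at_top" by real_asymp
      show "((\<lambda>X. X * (cosh (v / sqrt X) - 1)) \<longlongrightarrow> 1 / 2 * v\<^sup>2) at_top"
        using tendsto_scaled_cosh[of v] by simp
    qed
  qed measurable
  also have "(LINT v|lborel. exp (0 * v - (1 / 2) * v\<^sup>2)) = sqrt (2 * pi)"
    by (subst has_bochner_integral_exp_gaussian(2)) (simp_all add: mult.commute)
  finally show ?thesis
    by (rule Lim_transform_eventually)
       (use eventually_gt_at_top[of 0] in eventually_elim, simp add: bessel_scaled_eq)
qed

text \<open>The translation by half of \<open>ln (q / p)\<close> makes the two exponentials symmetric.\<close>

lemma nn_integral_gaussian_mixture: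
  fixes p q \<mu> :: real
  assumes p: "p > 0" and q: "q > 0"
  shows "(\<integral>\<^sup>+ t. ennreal (exp (\<mu> * t - p * exp t - q * exp (- t))) \<partial>lborel) =
           ennreal ((q / p) powr (\<mu> / 2) * bessel_line \<mu> (2 * sqrt (p * q)))"
proof -
  define h where "h = ln (q / p) / 2"
  have eh: "(exp h)\<^sup>2 = q / p"
    using p q by (simp add: exp_double[symmetric] h_def)
  have "(p * exp h)\<^sup>2 = p * q"
    unfolding power_mult_distrib eh using p by (simp add: power2_eq_square)
  hence e1: "p * exp h = sqrt (p * q)"
    using p by (intro real_sqrt_unique[symmetric]) simp_all
  have "(q * exp (- h))\<^sup>2 = q\<^sup>2 * inverse ((exp h)\<^sup>2)"
    by (simp add: power_mult_distrib exp_minus power_inverse)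
  also have "\<dots> = p * q"
    unfolding eh using p q by (simp add: power2_eq_square field_simps)
  finally have e2: "q * exp (- h) = sqrt (p * q)"
    using q by (intro real_sqrt_unique[symmetric]) simp_all
  have "(\<integral>\<^sup>+ t. ennreal (exp (\<mu> * t - p * exp t - q * exp (- t))) \<partial>lborel) =
     ennreal \<bar>1\<bar> * (\<integral>\<^sup>+ t. ennreal (exp (\<mu> * (h + 1 * t) - p * exp (h + 1 * t) - q * exp (- (h + 1 * t)))) \<partial>lborel)"
    by (rule nn_integral_real_affine) auto
  also have "\<dots> = (\<integral>\<^sup>+ t. ennreal ((q / p) powr (\<mu> / 2)) * ennreal (exp (\<mu> * t - (2 * sqrt (p * q)) * cosh t)) \<partial>lborel)"
  proof (simp, intro nn_integral_cong)
    fix t :: real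
    have "p * exp (h + t) = sqrt (p * q) * exp t"
      by (simp add: exp_add e1[symmetric])
    moreover have "q * exp (- h - t) = sqrt (p * q) * exp (- t)"
      using e2 by (simp add: exp_add[of "-h" "-t", simplified] e2[symmetric])
    moreover have "(q / p) powr (\<mu> / 2) = exp (\<mu> * h)"
      using p q by (simp add: powr_def h_def)
    ultimately show "ennreal (exp (\<mu> * (h + t) - p * exp (h + t) - q * exp (- h - t))) =
       ennreal ((q / p) powr (\<mu> / 2)) * ennreal (exp (\<mu> * t - 2 * sqrt (p * q) * cosh t))"
      by (simp add: ennreal_mult[symmetric] exp_add[symmetric] cosh_def algebra_simps)
  qed
  also have "\<dots> = ennreal ((q / p) powr (\<mu> / 2)) * ennreal (bessel_line \<mu> (2 * sqrt (p * q)))"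
    using integrable_bessel_line[of "2 * sqrt (p * q)" \<mu>] p q
    by (subst nn_integral_cmult, simp, subst nn_integral_eq_integral) (auto simp: bessel_line_def)
  also have "\<dots> = ennreal ((q / p) powr (\<mu> / 2) * bessel_line \<mu> (2 * sqrt (p * q)))"
    by (simp add: ennreal_mult[symmetric] bessel_line_nonneg)
  finally show ?thesis .
qed

section \<open>Laguerre polynomials\<close>

lemma borel_measurable_cnj [measurable]: "cnj \<in> borel_measurable borel"
  by (intro borel_measurable_continuous_onI continuous_intros)

text \<open>The modulus of the coefficient of \<open>z\<^sup>k\<close> in the Laguerre polynomial \<open>L\<^sub>n\<^sup>\<nu>\<close>; the sign \<open>(-1)\<^sup>k\<close> is kept apart so
  that positivity, which drives all convergence arguments, is visible.\<close>

definition lag_coeff :: "real \<Rightarrow> nat \<Rightarrow> nat \<Rightarrow> real" where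
  "lag_coeff \<nu> n k = pochhammer (\<nu> + real k + 1) (n - k) / (fact (n - k) * fact k)"

definition laguerre :: "real \<Rightarrow> nat \<Rightarrow> complex \<Rightarrow> complex" where
  "laguerre \<nu> n z = (\<Sum>k\<le>n. of_real (lag_coeff \<nu> n k) * (- z) ^ k)"

lemma lag_coeff_pos: "\<nu> > -1 \<Longrightarrow> lag_coeff \<nu> n k > 0"
  unfolding lag_coeff_def by (intro divide_pos_pos mult_pos_pos pochhammer_pos) auto

lemma binomial_series_pochhammer:
  fixes t :: complex
  assumes t: "norm t < 1"
  shows "(\<lambda>j. of_real (pochhammer \<mu> j / fact j) * t ^ j) sums ((1 - t) powr of_real (- \<mu>))"
proof -
  have "(\<lambda>j. (of_real (- \<mu>) gchoose j) * (- t) ^ j) sums (1 + - t) powr of_real (- \<mu>)"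
    by (rule gen_binomial_complex) (use t in simp)
  moreover have "(of_real (- \<mu>) gchoose j) * (- t) ^ j = of_real (pochhammer \<mu> j / fact j) * t ^ j" for j
  proof -
    have "(of_real (- \<mu>) gchoose j) * (- t) ^ j = ((-1) ^ j * (-1) ^ j) * (of_real (pochhammer \<mu> j / fact j) * t ^ j)"
      by (simp add: gbinomial_pochhammer pochhammer_of_real power_minus[of t] mult_ac)
    also have "(-1 :: complex) ^ j * (-1) ^ j = 1"
      by (simp flip: power_mult_distrib)
    finally show ?thesis by simp
  qed
  ultimately show ?thesis by simp
qed

lemma binomial_series_pochhammer_real:
  fixes t :: real
  assumes t: "0 \<le> t" "t < 1"
  shows "(\<lambda>j. pochhammer \<mu> j / fact j * t ^ j) sums ((1 - t) powr (- \<mu>))"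
proof -
  have "(\<lambda>j. complex_of_real (pochhammer \<mu> j / fact j * t ^ j)) sums of_real ((1 - t) powr (- \<mu>))"
    using binomial_series_pochhammer[of "of_real t" \<mu>] t by (simp flip: powr_of_real)
  thus ?thesis by (simp only: sums_of_real_iff)
qed

text \<open>Summed first over \<open>n\<close>, the double series of coefficients is a binomial series for each \<open>k\<close>, and the
  sum over \<open>k\<close> is then an exponential series. The exchange is justified by the same computation for
  \<open>|t|\<close> and \<open>- |z|\<close>, where all terms are positive.\<close>

lemma laguerre_generating_function:
  fixes t z :: complex
  assumes \<nu>: "\<nu> > -1" and t: "norm t < 1"
  shows "(\<lambda>n. t ^ n * laguerre \<nu> n z) sums ((1 - t) powr of_real (- (\<nu> + 1)) * exp (- z * t / (1 - t)))"
    and "summable (\<lambda>n. norm t ^ n * (\<Sum>k\<le>n. lag_coeff \<nu> n k * norm z ^ k))"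
proof -
  define r where "r = norm t"
  define R where "R = norm z"
  have r: "0 \<le> r" "r < 1" using t by (auto simp: r_def)
  define F where "F = (\<lambda>(k, j). of_real (lag_coeff \<nu> (k + j) k) * (- z) ^ k * t ^ (k + j))"
  define G where "G k = (- z * t) ^ k / fact k * (1 - t) powr of_real (- (\<nu> + real k + 1))" for k
  define Gr where "Gr k = (R * r) ^ k / fact k * (1 - r) powr (- (\<nu> + real k + 1))" for k
  have t1: "1 - t \<noteq> 0" using t by auto
  have F_eq: "F (k, j) = (- z * t) ^ k / fact k * (of_real (pochhammer (\<nu> + real k + 1) j / fact j) * t ^ j)" for k j
    unfolding F_def lag_coeff_def power_mult_distrib power_add by (simp add: mult_ac)
  have nF: "norm (F (k, j)) = (R * r) ^ k / fact k * (pochhammer (\<nu> + real k + 1) j / fact j * r ^ j)" for k j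
    unfolding F_eq using \<nu> pochhammer_pos[of "\<nu> + real k + 1" j]
    by (simp add: norm_mult norm_power norm_divide R_def r_def power_mult_distrib)
  have nFs: "(\<lambda>j. norm (F (k, j))) sums Gr k" for k
    unfolding nF Gr_def by (intro sums_mult binomial_series_pochhammer_real r)
  hence F_inner: "((\<lambda>j. F (k, j)) has_sum G k) UNIV" for k
    unfolding F_eq G_def
    by (intro norm_summable_imp_has_sum sums_mult binomial_series_pochhammer t)
       (auto simp: F_eq sums_iff)
  have nF_inner: "((\<lambda>j. norm (F (k, j))) has_sum Gr k) UNIV" for k
    using nFs[of k] by (intro norm_summable_imp_has_sum) (auto simp: sums_iff)
  have Gr_eq: "Gr k = (1 - r) powr (- (\<nu> + 1)) * ((R * r / (1 - r)) ^ k /\<^sub>R fact k)" for k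
  proof -
    have "(1 - r) powr (- (\<nu> + real k + 1)) = (1 - r) powr (- (\<nu> + 1) + - real k)"
      by (simp add: algebra_simps)
    also have "\<dots> = (1 - r) powr (- (\<nu> + 1)) * (1 / (1 - r) ^ k)"
      using r by (subst powr_add) (simp add: powr_minus powr_realpow inverse_eq_divide)
    finally show ?thesis by (simp add: Gr_def power_divide field_simps)
  qed
  have G_eq: "G k = (1 - t) powr of_real (- (\<nu> + 1)) * ((- z * t / (1 - t)) ^ k /\<^sub>R fact k)" for k
  proof -
    have "(1 - t) powr of_real (- (\<nu> + real k + 1)) = (1 - t) powr (of_real (- (\<nu> + 1)) + - of_nat k)"
      by (simp add: algebra_simps)
    also have "\<dots> = (1 - t) powr (of_real (- (\<nu> + 1))) * (1 / (1 - t) ^ k)"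
      using t1 by (subst powr_add) (simp add: powr_minus powr_nat inverse_eq_divide)
    finally show ?thesis
      unfolding G_def power_divide scaleR_conv_of_real by (simp add: mult_ac divide_inverse)
  qed
  have Gr_sums: "Gr sums ((1 - r) powr (- (\<nu> + 1)) * exp (R * r / (1 - r)))"
    unfolding Gr_eq by (intro sums_mult exp_converges)
  have Gr_nonneg: "Gr k \<ge> 0" for k
    using r by (auto simp: Gr_def R_def)
  have Gr_has: "(Gr has_sum ((1 - r) powr (- (\<nu> + 1)) * exp (R * r / (1 - r)))) UNIV"
    using Gr_sums Gr_nonneg by (intro norm_summable_imp_has_sum) (auto simp: sums_iff)
  have G_sums: "G sums ((1 - t) powr of_real (- (\<nu> + 1)) * exp (- z * t / (1 - t)))"
    unfolding G_eq by (intro sums_mult exp_converges)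
  have nG: "norm (G k) \<le> Gr k" for k
  proof -
    have "norm (G k) = norm (\<Sum>j. F (k, j))"
      using F_inner[of k] by (metis has_sum_imp_sums sums_unique)
    also have "\<dots> \<le> (\<Sum>j. norm (F (k, j)))"
      using nFs[of k] by (intro summable_norm) (auto simp: sums_iff)
    finally show ?thesis using nFs[of k] by (simp add: sums_iff)
  qed
  have G_has: "(G has_sum ((1 - t) powr of_real (- (\<nu> + 1)) * exp (- z * t / (1 - t)))) UNIV"
    using G_sums
  proof (intro norm_summable_imp_has_sum)
    show "summable (\<lambda>k. norm (G k))"
      by (rule summable_comparison_test'[of Gr 0]) (use Gr_sums nG in \<open>auto simp: sums_iff\<close>)
  qed
  have abs: "(\<lambda>p. norm (F p)) summable_on (Sigma UNIV (\<lambda>_. UNIV))"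
    unfolding Infinite_Sum.abs_summable_on_Sigma_iff
  proof safe
    show "(\<lambda>j. norm (F (k, j))) summable_on UNIV" for k
      using nF_inner[of k] by (auto simp: summable_on_def)
    have "(\<lambda>k. infsum (\<lambda>j. norm (F (k, j))) UNIV) = Gr"
      using nF_inner by (auto simp: infsumI)
    thus "(\<lambda>k. norm (infsum (\<lambda>j. norm (F (k, j))) UNIV)) summable_on UNIV"
      using Gr_has Gr_nonneg by (auto simp: summable_on_def)
  qed
  have bij: "bij_betw (\<lambda>(n, k). (k, n - k)) (Sigma UNIV (\<lambda>n. {..n})) (Sigma UNIV (\<lambda>_. UNIV :: nat set))"
    by (rule bij_betwI[of _ _ _ "\<lambda>(k, j). (k + j, k)"]) auto
  have "(F has_sum ((1 - t) powr of_real (- (\<nu> + 1)) * exp (- z * t / (1 - t)))) (Sigma UNIV (\<lambda>_. UNIV))"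
    by (rule has_sum_SigmaI[OF F_inner G_has]) (use abs in \<open>auto intro: Infinite_Sum.abs_summable_summable\<close>)
  hence "((\<lambda>p. F ((\<lambda>(n, k). (k, n - k)) p)) has_sum ((1 - t) powr of_real (- (\<nu> + 1)) * exp (- z * t / (1 - t))))
           (Sigma UNIV (\<lambda>n. {..n}))"
    by (subst has_sum_reindex_bij_betw[OF bij])
  hence "((\<lambda>n. \<Sum>k\<le>n. F (k, n - k)) has_sum ((1 - t) powr of_real (- (\<nu> + 1)) * exp (- z * t / (1 - t)))) UNIV"
    by (rule has_sum_SigmaD) (auto intro!: has_sum_finiteI)
  moreover have "(\<Sum>k\<le>n. F (k, n - k)) = t ^ n * laguerre \<nu> n z" for n
    unfolding laguerre_def sum_distrib_left by (intro sum.cong) (auto simp: F_def)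
  ultimately show "(\<lambda>n. t ^ n * laguerre \<nu> n z) sums ((1 - t) powr of_real (- (\<nu> + 1)) * exp (- z * t / (1 - t)))"
    by (simp add: has_sum_imp_sums)
  have "(\<lambda>p. norm (F p)) summable_on (Sigma UNIV (\<lambda>_. UNIV))"
    using abs by simp
  then obtain S where "((\<lambda>p. norm (F p)) has_sum S) (Sigma UNIV (\<lambda>_. UNIV))"
    by (auto simp: summable_on_def)
  hence "((\<lambda>p. norm (F ((\<lambda>(n, k). (k, n - k)) p))) has_sum S) (Sigma UNIV (\<lambda>n. {..n}))"
    by (subst has_sum_reindex_bij_betw[OF bij, where f = "\<lambda>p. norm (F p)"])
  hence "((\<lambda>n. \<Sum>k\<le>n. norm (F (k, n - k))) has_sum S) UNIV"
    by (rule has_sum_SigmaD) (auto intro!: has_sum_finiteI)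
  moreover have "(\<Sum>k\<le>n. norm (F (k, n - k))) = norm t ^ n * (\<Sum>k\<le>n. lag_coeff \<nu> n k * norm z ^ k)" for n
    unfolding sum_distrib_left using lag_coeff_pos[OF \<nu>, of n]
    by (intro sum.cong) (auto simp: F_def norm_mult norm_power less_imp_le)
  ultimately show "summable (\<lambda>n. norm t ^ n * (\<Sum>k\<le>n. lag_coeff \<nu> n k * norm z ^ k))"
    by (auto dest: has_sum_imp_sums simp: sums_iff)
qed

lemma laguerre_minus_real:
  "laguerre \<nu> n (- of_real R) = of_real (\<Sum>k\<le>n. lag_coeff \<nu> n k * R ^ k)"
  by (simp add: laguerre_def)

lemma norm_laguerre_le:
  assumes \<nu>: "\<nu> > -1"
  shows "norm (laguerre \<nu> n z) \<le> (\<Sum>k\<le>n. lag_coeff \<nu> n k * norm z ^ k)"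
  unfolding laguerre_def using lag_coeff_pos[OF \<nu>, of n]
  by (intro sum_norm_le) (auto simp: norm_mult norm_power less_imp_le)

text \<open>At \<open>- R\<close> all terms of a Laguerre polynomial are positive, so its generating function there majorises
  every \<open>L\<^sub>n\<^sup>\<nu>\<close> on the circle of radius \<open>R\<close>.\<close>

lemma laguerre_majorant_sums:
  fixes r R :: real
  assumes \<nu>: "\<nu> > -1" and r: "0 \<le> r" "r < 1"
  shows "(\<lambda>n. r ^ n * (\<Sum>k\<le>n. lag_coeff \<nu> n k * R ^ k)) sums ((1 - r) powr (- (\<nu> + 1)) * exp (R * r / (1 - r)))"
proof -
  have "(\<lambda>n. complex_of_real (r ^ n * (\<Sum>k\<le>n. lag_coeff \<nu> n k * R ^ k))) sums
      of_real ((1 - r) powr (- (\<nu> + 1)) * exp (R * r / (1 - r)))"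
    using laguerre_generating_function(1)[OF \<nu>, of "of_real r" "- of_real R"] r
    by (simp add: laguerre_minus_real powr_of_real[symmetric] exp_of_real[symmetric])
  thus ?thesis by (simp only: sums_of_real_iff)
qed

lemma integral_exp_circle:
  fixes k :: int
  shows "(LINT \<theta>|restrict_space lborel {0..2*pi}. exp (\<i> * of_int k * of_real \<theta>)) = (if k = 0 then 2 * pi else 0)"
proof -
  have "(LINT \<theta>|restrict_space lborel {0..2*pi}. exp (\<i> * of_int k * of_real \<theta>)) =
      (LINT \<theta>|lborel. indicator {0..2*pi} \<theta> *\<^sub>R exp (\<i> * of_int k * complex_of_real \<theta>))"
    by (subst integral_restrict_space) auto
  also have "\<dots> = (if k = 0 then 2 * pi else 0)"
  proof (cases "k = 0")
    case False
    define g where "g \<theta> = exp (\<i> * of_int k * complex_of_real \<theta>) / (\<i> * of_int k)" for \<theta> :: real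
    have "(LINT \<theta>|lborel. indicator {0..2*pi} \<theta> *\<^sub>R exp (\<i> * of_int k * complex_of_real \<theta>)) = g (2 * pi) - g 0"
    proof (rule integral_FTC_Icc)
      show "(g has_vector_derivative exp (\<i> * of_int k * complex_of_real x)) (at x within {0..2*pi})" for x
        unfolding g_def using False
        by (auto intro!: derivative_eq_intros has_vector_derivative_real_field simp: field_simps)
    qed (auto intro!: continuous_intros)
    also have "g (2 * pi) = g 0"
    proof -
      have "exp (\<i> * of_int k * complex_of_real (2 * pi)) = 1"
        by (auto simp: exp_eq_1 intro!: exI[of _ k])
      thus ?thesis by (simp add: g_def)
    qed
    finally show ?thesis using False by simp
  qed (simp add: scaleR_conv_of_real)
  finally show ?thesis .
qed

text \<open>Absolute summability of the coefficients lets the orthogonality of the exponentials be applied term by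
  term.\<close>

lemma parseval_circle:
  fixes a :: "nat \<Rightarrow> complex"
  assumes a: "summable (\<lambda>n. norm (a n))"
  defines "f \<equiv> \<lambda>\<theta>::real. \<Sum>n. a n * exp (\<i> * of_nat n * of_real \<theta>)"
  shows "(\<lambda>n. 2 * pi * (norm (a n))\<^sup>2) sums (LINT \<theta>|restrict_space lborel {0..2*pi}. (norm (f \<theta>))\<^sup>2)"
    and "integrable (restrict_space lborel {0..2*pi}) (\<lambda>\<theta>. (norm (f \<theta>))\<^sup>2)"
proof -
  define M where "M = restrict_space lborel {0..2*pi}"
  interpret finite_measure M
    by (rule finite_measureI) (simp add: M_def emeasure_restrict_space)
  define e where "e n \<theta> = exp (\<i> * of_nat n * complex_of_real \<theta>)" for n :: nat and \<theta> :: real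
  have ne: "norm (e n \<theta>) = 1" for n \<theta>
    by (simp add: e_def)
  have [measurable]: "e n \<in> borel_measurable M" for n
    unfolding e_def[abs_def] M_def by (intro measurable_restrict_space1) measurable
  define A where "A = (\<Sum>n. norm (a n))"
  have sum1: "summable (\<lambda>n. norm (a n * e n \<theta>))" for \<theta>
    using a by (simp add: norm_mult ne)
  have nf: "norm (f \<theta>) \<le> A" for \<theta>
    unfolding f_def A_def e_def[symmetric]
    using summable_norm[OF sum1[of \<theta>]] by (simp add: norm_mult ne)
  have A0: "A \<ge> 0" unfolding A_def by (rule suminf_nonneg[OF a]) simp
  have [measurable]: "f \<in> borel_measurable M"
    unfolding f_def e_def[symmetric] by measurable
  show "integrable (restrict_space lborel {0..2*pi}) (\<lambda>\<theta>. (norm (f \<theta>))\<^sup>2)"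
    unfolding M_def[symmetric]
    by (rule integrable_const_bound[of _ "A\<^sup>2"]) (auto intro!: power_mono nf)
  have inner: "(LINT \<theta>|M. e m \<theta> * cnj (f \<theta>)) = 2 * pi * cnj (a m)" for m
  proof -
    have eq: "e m \<theta> * cnj (f \<theta>) = (\<Sum>n. cnj (a n) * (e m \<theta> * cnj (e n \<theta>)))" for \<theta>
    proof -
      have "(\<lambda>n. e m \<theta> * cnj (a n * e n \<theta>)) sums (e m \<theta> * cnj (f \<theta>))"
        unfolding f_def e_def[symmetric]
        by (intro sums_mult sums_cnj[THEN iffD2] summable_sums summable_norm_cancel[OF sum1])
      thus ?thesis by (simp add: sums_iff mult_ac)
    qed
    have val: "(LINT \<theta>|M. cnj (a n) * (e m \<theta> * cnj (e n \<theta>))) = (if n = m then 2 * pi * cnj (a m) else 0)" for n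
    proof -
      have "e m \<theta> * cnj (e n \<theta>) = exp (\<i> * of_int (int m - int n) * of_real \<theta>)" for \<theta>
        by (simp add: e_def exp_cnj exp_add[symmetric] algebra_simps)
      thus ?thesis using integral_exp_circle[of "int m - int n"] by (simp add: M_def)
    qed
    have "(\<lambda>n. LINT \<theta>|M. cnj (a n) * (e m \<theta> * cnj (e n \<theta>))) sums
            (LINT \<theta>|M. (\<Sum>n. cnj (a n) * (e m \<theta> * cnj (e n \<theta>))))"
    proof (rule sums_integral)
      show "integrable M (\<lambda>\<theta>. cnj (a n) * (e m \<theta> * cnj (e n \<theta>)))" for n
        by (rule integrable_const_bound[of _ "norm (a n)"]) (auto simp: norm_mult ne)
      show "AE \<theta> in M. summable (\<lambda>n. norm (cnj (a n) * (e m \<theta> * cnj (e n \<theta>))))"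
        using a by (simp add: norm_mult ne)
      show "summable (\<lambda>n. LINT \<theta>|M. norm (cnj (a n) * (e m \<theta> * cnj (e n \<theta>))))"
        using a by (simp add: norm_mult ne summable_mult)
    qed
    hence "(\<lambda>n. if n = m then 2 * pi * cnj (a m) else 0) sums (LINT \<theta>|M. e m \<theta> * cnj (f \<theta>))"
      unfolding val eq by simp
    moreover have "(\<lambda>n. if n = m then 2 * pi * cnj (a m) else 0) sums (2 * pi * cnj (a m))"
      using sums_If_finite_set[of "{m}" "\<lambda>_. 2 * pi * cnj (a m)"] by simp
    ultimately show ?thesis by (rule sums_unique2)
  qed
  have "(\<lambda>n. LINT \<theta>|M. a n * (e n \<theta> * cnj (f \<theta>))) sums (LINT \<theta>|M. (\<Sum>n. a n * (e n \<theta> * cnj (f \<theta>))))"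
  proof (rule sums_integral)
    show "integrable M (\<lambda>\<theta>. a n * (e n \<theta> * cnj (f \<theta>)))" for n
      by (rule integrable_const_bound[of _ "norm (a n) * A"]) (auto simp: norm_mult ne nf mult_left_mono)
    show "AE \<theta> in M. summable (\<lambda>n. norm (a n * (e n \<theta> * cnj (f \<theta>))))"
      using a by (simp add: norm_mult ne summable_mult2 flip: mult.assoc)
    show "summable (\<lambda>n. LINT \<theta>|M. norm (a n * (e n \<theta> * cnj (f \<theta>))))"
      using a by (simp add: norm_mult ne summable_mult2)
  qed
  moreover have "(\<Sum>n. a n * (e n \<theta> * cnj (f \<theta>))) = complex_of_real ((norm (f \<theta>))\<^sup>2)" for \<theta>
  proof -
    have "(\<lambda>n. (a n * e n \<theta>) * cnj (f \<theta>)) sums (f \<theta> * cnj (f \<theta>))"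
      unfolding f_def e_def[symmetric]
      by (intro sums_mult2 summable_sums summable_norm_cancel[OF sum1])
    thus ?thesis unfolding complex_norm_square by (simp add: sums_iff mult.assoc)
  qed
  moreover have "(LINT \<theta>|M. a n * (e n \<theta> * cnj (f \<theta>))) = complex_of_real (2 * pi * (norm (a n))\<^sup>2)" for n
  proof -
    have "(LINT \<theta>|M. a n * (e n \<theta> * cnj (f \<theta>))) = a n * (2 * pi * cnj (a n))"
      using inner[of n] by simp
    also have "\<dots> = complex_of_real (2 * pi * (norm (a n))\<^sup>2)"
      unfolding of_real_mult complex_norm_square by simp
    finally show ?thesis .
  qed
  ultimately have "(\<lambda>n. complex_of_real (2 * pi * (norm (a n))\<^sup>2)) sums
       (LINT \<theta>|M. complex_of_real ((norm (f \<theta>))\<^sup>2))"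
    by simp
  thus "(\<lambda>n. 2 * pi * (norm (a n))\<^sup>2) sums (LINT \<theta>|restrict_space lborel {0..2*pi}. (norm (f \<theta>))\<^sup>2)"
    unfolding integral_complex_of_real sums_of_real_iff M_def .
qed

lemma norm_laguerre_generating_function:
  fixes z t :: complex
  assumes t: "norm t < 1"
  shows "(norm ((1 - t) powr of_real (- (\<nu> + 1)) * exp (- z * t / (1 - t))))\<^sup>2 =
           ((cmod (1 - t))\<^sup>2) powr (- (\<nu> + 1)) * exp (- 2 * Re (z * (t / (1 - t))))"
proof -
  have "1 - t \<noteq> 0" using t by auto
  hence "(norm ((1 - t) powr of_real (- (\<nu> + 1))))\<^sup>2 = ((cmod (1 - t))\<^sup>2) powr (- (\<nu> + 1))"
    by (simp add: norm_powr_real_powr' power2_eq_square powr_mult)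
  moreover have "(norm (exp (- z * t / (1 - t))))\<^sup>2 = exp (- 2 * Re (z * (t / (1 - t))))"
    by (simp add: exp_double[symmetric])
  ultimately show ?thesis
    by (simp only: norm_mult power_mult_distrib)
qed

text \<open>Parseval's identity for the generating function on the circle of radius \<open>\<rho>\<close>. The right-hand side depends
  on \<open>z\<close> only through the exponential of a linear function, which is what makes its integral against a
  Gaussian explicit.\<close>

lemma laguerre_parseval:
  fixes z :: complex and \<rho> :: real
  assumes \<nu>: "\<nu> > -1" and \<rho>: "0 < \<rho>" "\<rho> < 1"
  defines "t \<equiv> \<lambda>\<theta>::real. of_real \<rho> * exp (\<i> * of_real \<theta>)"
  shows "(\<Sum>n. ennreal (\<rho> ^ (2 * n) * (cmod (laguerre \<nu> n z))\<^sup>2)) =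
      ennreal (1 / (2 * pi)) * (\<integral>\<^sup>+ \<theta>. ennreal (((cmod (1 - t \<theta>))\<^sup>2) powr (- (\<nu> + 1)) *
         exp (- 2 * Re (z * (t \<theta> / (1 - t \<theta>))))) \<partial>restrict_space lborel {0..2*pi})"
proof -
  define a where "a n = of_real \<rho> ^ n * laguerre \<nu> n z" for n
  have nt: "norm (t \<theta>) = \<rho>" for \<theta>
    using \<rho> by (simp add: t_def norm_mult)
  have "summable (\<lambda>n. norm (a n))"
  proof (rule summable_comparison_test')
    show "summable (\<lambda>n. norm (complex_of_real \<rho>) ^ n * (\<Sum>k\<le>n. lag_coeff \<nu> n k * norm z ^ k))"
      by (rule laguerre_generating_function(2)[OF \<nu>]) (use \<rho> in simp)
    show "norm (norm (a n)) \<le> norm (complex_of_real \<rho>) ^ n * (\<Sum>k\<le>n. lag_coeff \<nu> n k * norm z ^ k)" for n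
      using norm_laguerre_le[OF \<nu>, of n z] \<rho>
      by (auto simp: a_def norm_mult norm_power intro!: mult_left_mono)
  qed
  note P = parseval_circle[OF this]
  have f: "(\<Sum>n. a n * exp (\<i> * of_nat n * of_real \<theta>)) =
      (1 - t \<theta>) powr of_real (- (\<nu> + 1)) * exp (- z * t \<theta> / (1 - t \<theta>))" for \<theta>
  proof -
    have "a n * exp (\<i> * of_nat n * of_real \<theta>) = t \<theta> ^ n * laguerre \<nu> n z" for n
      by (simp add: a_def t_def power_mult_distrib exp_of_nat_mult[symmetric] mult_ac)
    thus ?thesis
      using laguerre_generating_function(1)[OF \<nu>, of "t \<theta>" z] nt \<rho> by (simp add: sums_iff)
  qed
  define g where "g \<theta> = ((cmod (1 - t \<theta>))\<^sup>2) powr (- (\<nu> + 1)) * exp (- 2 * Re (z * (t \<theta> / (1 - t \<theta>))))" for \<theta>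
  have g: "(norm (\<Sum>n. a n * exp (\<i> * of_nat n * of_real \<theta>)))\<^sup>2 = g \<theta>" for \<theta>
    unfolding f g_def by (rule norm_laguerre_generating_function) (use nt \<rho> in simp)
  have S: "(\<lambda>n. 2 * pi * (norm (a n))\<^sup>2) sums (LINT \<theta>|restrict_space lborel {0..2*pi}. g \<theta>)"
    and I: "integrable (restrict_space lborel {0..2*pi}) g"
    using P unfolding g by simp_all
  have "(\<lambda>n. 1 / (2 * pi) * (2 * pi * (norm (a n))\<^sup>2)) sums (1 / (2 * pi) * (LINT \<theta>|restrict_space lborel {0..2*pi}. g \<theta>))"
    by (rule sums_mult[OF S])
  moreover have "1 / (2 * pi) * (2 * pi * (norm (a n))\<^sup>2) = \<rho> ^ (2 * n) * (cmod (laguerre \<nu> n z))\<^sup>2" for n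
    using \<rho> by (simp add: a_def norm_mult norm_power power_mult_distrib power_mult[symmetric] mult.commute)
  ultimately have S': "(\<lambda>n. \<rho> ^ (2 * n) * (cmod (laguerre \<nu> n z))\<^sup>2) sums
       (1 / (2 * pi) * (LINT \<theta>|restrict_space lborel {0..2*pi}. g \<theta>))"
    by simp
  have "(\<Sum>n. ennreal (\<rho> ^ (2 * n) * (cmod (laguerre \<nu> n z))\<^sup>2)) =
      ennreal (1 / (2 * pi) * (LINT \<theta>|restrict_space lborel {0..2*pi}. g \<theta>))"
    using S' \<rho> by (subst suminf_ennreal2) (auto simp: sums_iff)
  also have "\<dots> = ennreal (1 / (2 * pi)) * ennreal (LINT \<theta>|restrict_space lborel {0..2*pi}. g \<theta>)"
    by (rule ennreal_mult) (auto simp: g_def)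
  also have "ennreal (LINT \<theta>|restrict_space lborel {0..2*pi}. g \<theta>) = (\<integral>\<^sup>+ \<theta>. ennreal (g \<theta>) \<partial>restrict_space lborel {0..2*pi})"
    by (rule nn_integral_eq_integral[symmetric, OF I]) (auto simp: g_def)
  finally show ?thesis unfolding g_def .
qed

section \<open>Exchange of sum and integral, uniqueness of power series\<close>

lemma sums_integral_dominated:
  fixes f :: "nat \<Rightarrow> 'a \<Rightarrow> complex"
  assumes g: "integrable M g" and fm [measurable]: "\<And>n. f n \<in> borel_measurable M"
    and F [measurable]: "F \<in> borel_measurable M"
    and sums: "AE x in M. (\<lambda>n. f n x) sums F x"
    and dom: "\<And>N x. norm (\<Sum>n<N. f n x) \<le> g x"
  shows "(\<lambda>n. LINT x|M. f n x) sums (LINT x|M. F x)"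
proof -
  have ps: "integrable M (\<lambda>x. \<Sum>n<N. f n x)" for N
    by (rule Bochner_Integration.integrable_bound[OF g]) (auto intro!: AE_I2 order.trans[OF dom])
  have int: "integrable M (f n)" for n
  proof -
    have "integrable M (\<lambda>x. (\<Sum>k<Suc n. f k x) - (\<Sum>k<n. f k x))"
      by (intro Bochner_Integration.integrable_diff ps)
    thus ?thesis by simp
  qed
  have "(\<lambda>N. LINT x|M. (\<Sum>n<N. f n x)) \<longlonglongrightarrow> (LINT x|M. F x)"
    by (rule integral_dominated_convergence[where w = g]) (use g sums dom in \<open>auto simp: sums_def\<close>)
  thus ?thesis
    by (simp add: sums_def Bochner_Integration.integral_sum int)
qed

text \<open>The first non-zero coefficient would be the limit at \<open>0\<close> of the series divided by a power of \<open>t\<close>. Real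
  arguments on one side suffice.\<close>

lemma powser_coeff_zero:
  fixes d :: "nat \<Rightarrow> complex" and t0 :: real
  assumes t0: "t0 > 0" and z: "\<And>t. 0 < t \<Longrightarrow> t < t0 \<Longrightarrow> (\<lambda>n. d n * of_real t ^ n) sums 0"
  shows "d n = 0"
proof (induction n rule: less_induct)
  case (less n)
  define c where "c j = d (j + n)" for j
  have c0: "(\<lambda>j. c j * of_real t ^ j) sums 0" if t: "0 < t" "t < t0" for t
  proof -
    have "(\<lambda>j. d (j + n) * of_real t ^ (j + n)) sums (0 - (\<Sum>k<n. d k * of_real t ^ k))"
      using z[OF t] by (subst sums_iff_shift) simp
    hence "(\<lambda>j. inverse (of_real t ^ n) * (d (j + n) * of_real t ^ (j + n))) sums
             (inverse (of_real t ^ n) * (0 - (\<Sum>k<n. d k * of_real t ^ k)))"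
      by (rule sums_mult)
    moreover have "(\<Sum>k<n. d k * of_real t ^ k) = 0" using less by simp
    moreover have "inverse (of_real t ^ n) * (d (j + n) * of_real t ^ (j + n)) = c j * of_real t ^ j" for j
      using t by (simp add: c_def power_add field_simps)
    ultimately show ?thesis by simp
  qed
  define K where "K = t0 / 2"
  have K: "0 < K" "K < t0" using t0 by (auto simp: K_def)
  define g where "g x = (\<Sum>j. c j * x ^ j)" for x :: complex
  have "isCont g 0"
    unfolding g_def
    by (rule isCont_powser[where K = "of_real K"]) (use c0[OF K] K in \<open>auto simp: sums_iff\<close>)
  hence lim: "((\<lambda>x. g (of_real x)) \<longlongrightarrow> g 0) (at_right 0)"
    by (intro isCont_tendsto_compose[of 0 g]) (auto intro!: tendsto_eq_intros)
  have "\<forall>\<^sub>F x in at_right 0. g (of_real x) = 0"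
    unfolding eventually_at_right_field
    by (rule exI[of _ K]) (use c0 K in \<open>force simp: g_def sums_iff\<close>)
  hence "((\<lambda>x. g (of_real x)) \<longlongrightarrow> 0) (at_right 0)"
    by (rule tendsto_eventually)
  hence "g 0 = 0"
    using lim by (intro tendsto_unique[of "at_right (0::real)"]) auto
  moreover have "g 0 = c 0" by (simp add: g_def)
  ultimately show ?case by (simp add: c_def)
qed

lemma powser_coeff_unique:
  fixes d e :: "nat \<Rightarrow> complex" and t0 :: real
  assumes t0: "t0 > 0" 
    and d: "\<And>t. 0 < t \<Longrightarrow> t < t0 \<Longrightarrow> (\<lambda>n. d n * of_real t ^ n) sums S t"
    and e: "\<And>t. 0 < t \<Longrightarrow> t < t0 \<Longrightarrow> (\<lambda>n. e n * of_real t ^ n) sums S t"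
  shows "d n = e n"
proof -
  have "(\<lambda>n. (d n - e n) * of_real t ^ n) sums 0" if "0 < t" "t < t0" for t
    using sums_diff[OF d[OF that] e[OF that]] by (simp add: algebra_simps)
  from powser_coeff_zero[OF t0 this, of n] show ?thesis by simp
qed

section \<open>The weight as a mixture of Gaussians\<close>

lemma borel_measurable_bessel_line [measurable]: "bessel_line \<mu> \<in> borel_measurable borel"
  unfolding bessel_line_def[abs_def] by measurable

lemma continuous_bessel_line:
  assumes X: "X > 0"
  shows "isCont (bessel_line \<mu>) X"
  unfolding continuous_at_sequentially o_def
proof safe
  fix x :: "nat \<Rightarrow> real" assume x: "x \<longlonglongrightarrow> X"
  have "\<forall>\<^sub>F n in sequentially. x n > X / 2"
    using x X by (intro order_tendstoD) auto
  then obtain n0 where n0: "\<And>n. n \<ge> n0 \<Longrightarrow> x n > X / 2"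
    by (auto simp: eventually_sequentially)
  have "(\<lambda>n. bessel_line \<mu> (x (n + n0))) \<longlonglongrightarrow> bessel_line \<mu> X"
    unfolding bessel_line_def
  proof (rule integral_dominated_convergence[where w = "\<lambda>t. exp (\<mu> * t - X / 2 * cosh t)"])
    show "integrable lborel (\<lambda>t. exp (\<mu> * t - X / 2 * cosh t))"
      using X by (intro integrable_bessel_line) simp
    show "AE t in lborel. (\<lambda>n. exp (\<mu> * t - x (n + n0) * cosh t)) \<longlonglongrightarrow> exp (\<mu> * t - X * cosh t)"
      using LIMSEQ_ignore_initial_segment[OF x, of n0] by (intro AE_I2 tendsto_intros)
    show "AE t in lborel. norm (exp (\<mu> * t - x (n + n0) * cosh t)) \<le> exp (\<mu> * t - X / 2 * cosh t)" for n
    proof (intro AE_I2)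
      fix t :: real
      have "X / 2 * cosh t \<le> x (n + n0) * cosh t"
        using n0[of "n + n0"] by (intro mult_right_mono) auto
      thus "norm (exp (\<mu> * t - x (n + n0) * cosh t)) \<le> exp (\<mu> * t - X / 2 * cosh t)"
        by simp
    qed
  qed measurable
  thus "(\<lambda>n. bessel_line \<mu> (x n)) \<longlonglongrightarrow> bessel_line \<mu> X"
    by (rule LIMSEQ_offset)
qed

locale bessel_weight =
  fixes a b \<nu> :: real
  assumes b_pos: "0 < b" and b_less: "b < a" and nu: "\<nu> > -1"
begin

text \<open>One component of the mixture, a Gaussian in \<open>z\<close> of variance proportional to \<open>exp t\<close>, tilted by
  \<open>exp (b Re z)\<close>.\<close>

definition mixture :: "real \<Rightarrow> complex \<Rightarrow> real" where
  "mixture t z = exp (b * Re z + \<nu> * t - exp t - a\<^sup>2 * (cmod z)\<^sup>2 / 4 * exp (- t))"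

text \<open>Proportional to \<open>|z|\<^sup>\<nu> K\<^sub>\<nu>(a |z|) exp (b Re z)\<close>, normalised so that the mixture has no further constants.
  The value at \<open>0\<close> is a default value.\<close>

definition weight :: "complex \<Rightarrow> real" where
  "weight z = exp (b * Re z) * ((a * cmod z / 2) powr \<nu> * bessel_line \<nu> (a * cmod z))"

lemma a_pos: "a > 0" using b_pos b_less by simp

lemma weight_nonneg [simp]: "weight z \<ge> 0"
  by (simp add: weight_def bessel_line_nonneg)

lemma mixture_nonneg [simp]: "mixture t z \<ge> 0"
  by (simp add: mixture_def)

lemma borel_measurable_weight [measurable]: "weight \<in> borel_measurable borel"
  unfolding weight_def[abs_def] by measurable

lemma borel_measurable_mixture [measurable]:
  "(\<lambda>(t, z). mixture t z) \<in> borel_measurable (borel \<Otimes>\<^sub>M borel)"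
  unfolding mixture_def[abs_def] by measurable

lemma nn_integral_mixture:
  assumes z: "z \<noteq> 0"
  shows "(\<integral>\<^sup>+ t. ennreal (mixture t z) \<partial>lborel) = ennreal (weight z)"
proof -
  have 1: "(\<integral>\<^sup>+ t. ennreal (mixture t z) \<partial>lborel) =
     ennreal (exp (b * Re z)) * (\<integral>\<^sup>+ t. ennreal (exp (\<nu> * t - 1 * exp t - a\<^sup>2 * (cmod z)\<^sup>2 / 4 * exp (- t))) \<partial>lborel)"
    by (subst nn_integral_cmult[symmetric])
       (auto simp: mixture_def ennreal_mult[symmetric] exp_add[symmetric] algebra_simps intro!: nn_integral_cong)
  have 2: "2 * sqrt (1 * (a\<^sup>2 * (cmod z)\<^sup>2 / 4)) = a * cmod z"
    using a_pos by (simp add: real_sqrt_mult real_sqrt_divide)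
  have 3: "(a\<^sup>2 * (cmod z)\<^sup>2 / 4 / 1) powr (\<nu> / 2) = (a * cmod z / 2) powr \<nu>"
  proof -
    have "a\<^sup>2 * (cmod z)\<^sup>2 / 4 / 1 = (a * cmod z / 2) powr 2"
      using a_pos z by (simp add: power_divide power_mult_distrib)
    thus ?thesis by (simp only: powr_powr) simp
  qed
  show ?thesis
    unfolding 1 using a_pos z
    by (subst nn_integral_gaussian_mixture)
       (simp_all only: 2 3, simp_all add: weight_def ennreal_mult[symmetric] bessel_line_nonneg)
qed

lemma AE_nn_integral_mixture: "AE z in lborel. (\<integral>\<^sup>+ t. ennreal (mixture t z) \<partial>lborel) = ennreal (weight z)"
  using AE_lborel_singleton[of "0 :: complex"] by eventually_elim (rule nn_integral_mixture)

lemma nn_integral_weight_mixture: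
  fixes f :: "complex \<Rightarrow> real"
  assumes [measurable]: "f \<in> borel_measurable borel" and f: "\<And>z. f z \<ge> 0"
  shows "(\<integral>\<^sup>+ z. ennreal (f z * weight z) \<partial>lborel) =
           (\<integral>\<^sup>+ t. \<integral>\<^sup>+ z. ennreal (f z * mixture t z) \<partial>lborel \<partial>lborel)"
proof -
  have "(\<integral>\<^sup>+ z. ennreal (f z * weight z) \<partial>lborel) =
      (\<integral>\<^sup>+ z. \<integral>\<^sup>+ t. ennreal (f z * mixture t z) \<partial>lborel \<partial>lborel)"
  proof (rule nn_integral_cong_AE)
    show "AE z in lborel. ennreal (f z * weight z) = (\<integral>\<^sup>+ t. ennreal (f z * mixture t z) \<partial>lborel)"
      using AE_nn_integral_mixture
    proof eventually_elim
      case (elim z)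
      have "(\<integral>\<^sup>+ t. ennreal (f z * mixture t z) \<partial>lborel) = (\<integral>\<^sup>+ t. ennreal (f z) * ennreal (mixture t z) \<partial>lborel)"
        using f by (intro nn_integral_cong ennreal_mult) (auto simp: mixture_def)
      also have "\<dots> = ennreal (f z) * ennreal (weight z)"
        by (subst nn_integral_cmult) (auto simp: elim)
      finally show ?case using f by (simp add: ennreal_mult)
    qed
  qed
  also have "\<dots> = (\<integral>\<^sup>+ t. \<integral>\<^sup>+ z. ennreal (f z * mixture t z) \<partial>lborel \<partial>lborel)"
    by (rule lborel_pair.Fubini') measurable
  finally show ?thesis .
qed

lemma mixture_eq_gaussian:
  "mixture t z = exp (\<nu> * t - exp t) * exp (b * Re z - a\<^sup>2 / 4 * exp (- t) * (cmod z)\<^sup>2)"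
  unfolding mixture_def exp_add[symmetric] by (simp add: algebra_simps)

lemma nn_integral_exp_mixture:
  "(\<integral>\<^sup>+ z. ennreal (exp (u * Re z + v * Im z) * mixture t z) \<partial>lborel) =
     ennreal (4 * pi / a\<^sup>2 * exp ((\<nu> + 1) * t - (1 - ((b + u)\<^sup>2 + v\<^sup>2) / a\<^sup>2) * exp t))"
proof -
  define s where "s = a\<^sup>2 / 4 * exp (- t)"
  have s: "s > 0" using a_pos by (simp add: s_def)
  have "(\<integral>\<^sup>+ z. ennreal (exp (u * Re z + v * Im z) * mixture t z) \<partial>lborel) =
    (\<integral>\<^sup>+ z. ennreal (exp (\<nu> * t - exp t)) * ennreal (exp ((b + u) * Re z + v * Im z - s * (cmod z)\<^sup>2)) \<partial>lborel)"
    unfolding mixture_eq_gaussian s_def[symmetric] 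
    by (intro nn_integral_cong) (simp add: ennreal_mult[symmetric] exp_add[symmetric] algebra_simps)
  also have "\<dots> = ennreal (exp (\<nu> * t - exp t)) * ennreal (pi / s * exp (((b + u)\<^sup>2 + v\<^sup>2) / (4 * s)))"
    by (subst nn_integral_cmult, simp) (simp only: nn_integral_exp_gaussian_plane[OF s])
  also have "\<dots> = ennreal (exp (\<nu> * t - exp t) * (pi / s * exp (((b + u)\<^sup>2 + v\<^sup>2) / (4 * s))))"
    using s by (intro ennreal_mult[symmetric]) auto
  also have "pi / s = 4 * pi / a\<^sup>2 * exp t"
    using a_pos by (simp add: s_def exp_minus field_simps)
  also have "((b + u)\<^sup>2 + v\<^sup>2) / (4 * s) = ((b + u)\<^sup>2 + v\<^sup>2) / a\<^sup>2 * exp t"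
    using a_pos by (simp add: s_def exp_minus field_simps)
  also have "exp (\<nu> * t - exp t) * (4 * pi / a\<^sup>2 * exp t * exp (((b + u)\<^sup>2 + v\<^sup>2) / a\<^sup>2 * exp t)) =
      4 * pi / a\<^sup>2 * (exp (\<nu> * t - exp t) * exp t * exp (((b + u)\<^sup>2 + v\<^sup>2) / a\<^sup>2 * exp t))"
    by (simp only: mult_ac)
  also have "exp (\<nu> * t - exp t) * exp t * exp (((b + u)\<^sup>2 + v\<^sup>2) / a\<^sup>2 * exp t) =
       exp ((\<nu> + 1) * t - (1 - ((b + u)\<^sup>2 + v\<^sup>2) / a\<^sup>2) * exp t)"
    unfolding exp_add[symmetric] by (simp add: algebra_simps)
  finally show ?thesis .
qed

text \<open>For each component of the mixture the integral over the plane is Gaussian; the remaining integral is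
  Euler's.\<close>

lemma nn_integral_exp_weight:
  assumes uv: "(b + u)\<^sup>2 + v\<^sup>2 < a\<^sup>2"
  shows "(\<integral>\<^sup>+ z. ennreal (exp (u * Re z + v * Im z) * weight z) \<partial>lborel) =
     ennreal (4 * pi / a\<^sup>2 * (Gamma (\<nu> + 1) * (1 - ((b + u)\<^sup>2 + v\<^sup>2) / a\<^sup>2) powr (- (\<nu> + 1))))"
proof -
  have d: "1 - ((b + u)\<^sup>2 + v\<^sup>2) / a\<^sup>2 > 0" using uv a_pos by simp
  have "(\<integral>\<^sup>+ z. ennreal (exp (u * Re z + v * Im z) * weight z) \<partial>lborel) =
     (\<integral>\<^sup>+ t. ennreal (4 * pi / a\<^sup>2) * ennreal (exp ((\<nu> + 1) * t - (1 - ((b + u)\<^sup>2 + v\<^sup>2) / a\<^sup>2) * exp t)) \<partial>lborel)"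
    by (subst nn_integral_weight_mixture, simp, simp)
       (simp only: nn_integral_exp_mixture, intro nn_integral_cong ennreal_mult, simp_all)
  also have "\<dots> = ennreal (4 * pi / a\<^sup>2) * ennreal (Gamma (\<nu> + 1) * (1 - ((b + u)\<^sup>2 + v\<^sup>2) / a\<^sup>2) powr (- (\<nu> + 1)))"
    using d nu by (subst nn_integral_cmult, simp, subst nn_integral_exp_Gamma) auto
  also have "\<dots> = ennreal (4 * pi / a\<^sup>2 * (Gamma (\<nu> + 1) * (1 - ((b + u)\<^sup>2 + v\<^sup>2) / a\<^sup>2) powr (- (\<nu> + 1))))"
    using nu by (intro ennreal_mult[symmetric]) (auto intro!: mult_nonneg_nonneg Gamma_real_nonneg)
  finally show ?thesis .
qed

lemma integrable_exp_weight:
  assumes uv: "(b + u)\<^sup>2 + v\<^sup>2 < a\<^sup>2"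
  shows "integrable lborel (\<lambda>z. exp (u * Re z + v * Im z) * weight z)"
  by (rule integrableI_nonneg) (auto simp: nn_integral_exp_weight[OF uv])

text \<open>The pairing of two exponentials, from which all inner products of polynomials are read off. For a
  component of the mixture the horizontal frequency is real and the vertical one imaginary, and the
  difference of their squares factors.\<close>

lemma integral_exp_weight:
  fixes u v :: real
  assumes uv: "\<bar>b + u + v\<bar> < a"
  shows "(LINT z|lborel. exp (of_real u * z + of_real v * cnj z) * of_real (weight z)) =
     complex_of_real (4 * pi / a\<^sup>2 * (Gamma (\<nu> + 1) * (1 - 4 / a\<^sup>2 * ((b / 2 + u) * (b / 2 + v))) powr (- (\<nu> + 1))))"
proof -
  define E where "E z = exp (complex_of_real u * z + of_real v * cnj z)" for z
  have [measurable]: "E \<in> borel_measurable borel"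
    unfolding E_def[abs_def] by measurable
  have nE: "norm (E z) = exp ((u + v) * Re z + 0 * Im z)" for z
    by (simp add: E_def algebra_simps)
  have sq: "(b + (u + v))\<^sup>2 + 0\<^sup>2 < a\<^sup>2"
    using power_strict_mono[OF uv, of 2] by (simp add: add.assoc)
  define \<Phi> where "\<Phi> p = E (snd p) * of_real (mixture (fst p) (snd p))" for p
  have [measurable]: "\<Phi> \<in> borel_measurable (lborel \<Otimes>\<^sub>M lborel)"
    unfolding \<Phi>_def by measurable
  have nn: "(\<integral>\<^sup>+ t. \<integral>\<^sup>+ z. ennreal (norm (\<Phi> (t, z))) \<partial>lborel \<partial>lborel) < \<infinity>"
  proof -
    have "norm (\<Phi> (t, z)) = exp ((u + v) * Re z + 0 * Im z) * mixture t z" for t z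
      unfolding \<Phi>_def norm_mult nE by (simp add: mixture_def)
    hence "(\<integral>\<^sup>+ t. \<integral>\<^sup>+ z. ennreal (norm (\<Phi> (t, z))) \<partial>lborel \<partial>lborel) =
       (\<integral>\<^sup>+ z. ennreal (exp ((u + v) * Re z + 0 * Im z) * weight z) \<partial>lborel)"
      by (subst nn_integral_weight_mixture) auto
    thus ?thesis by (simp only: nn_integral_exp_weight[OF sq] ennreal_less_top infinity_ennreal_def)
  qed
  have int: "integrable (lborel \<Otimes>\<^sub>M lborel) \<Phi>"
    by (rule integrableI_bounded) (use nn in \<open>auto simp: lborel.nn_integral_fst[symmetric]\<close>)
  have w: "(LINT t|lborel. mixture t z) = weight z" if "z \<noteq> 0" for z
    by (rule integral_eq_nn_integral[THEN trans]) 
       (auto simp: nn_integral_mixture[OF that])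
  define d where "d = 1 - 4 / a\<^sup>2 * ((b / 2 + u) * (b / 2 + v))"
  have d_eq: "d = 1 - ((b + (u + v))\<^sup>2 + 0\<^sup>2) / a\<^sup>2 + (u - v)\<^sup>2 / a\<^sup>2"
    using a_pos by (simp add: d_def field_simps power2_eq_square)
  have d: "d > 0"
    unfolding d_eq using sq a_pos by (intro add_pos_nonneg) auto
  have inner: "(LINT z|lborel. \<Phi> (t, z)) = of_real (4 * pi / a\<^sup>2 * exp ((\<nu> + 1) * t - d * exp t))" for t
  proof -
    define s where "s = a\<^sup>2 / 4 * exp (- t)"
    have s: "s > 0" using a_pos by (simp add: s_def)
    have "\<Phi> (t, z) = of_real (exp (\<nu> * t - exp t)) *
       exp (of_real ((b + u + v) * Re z) + \<i> * of_real ((u - v) * Im z) - of_real (s * (cmod z)\<^sup>2))" for z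
    proof -
      have "complex_of_real u * z + of_real v * cnj z + of_real (b * Re z - s * (cmod z)\<^sup>2) =
          of_real ((b + u + v) * Re z) + \<i> * of_real ((u - v) * Im z) - of_real (s * (cmod z)\<^sup>2)"
        by (simp add: complex_eq_iff algebra_simps)
      hence "E z * of_real (exp (b * Re z - s * (cmod z)\<^sup>2)) =
          exp (of_real ((b + u + v) * Re z) + \<i> * of_real ((u - v) * Im z) - of_real (s * (cmod z)\<^sup>2))"
        unfolding E_def exp_of_real[symmetric] exp_add[symmetric] by (simp only:)
      thus ?thesis
        unfolding \<Phi>_def fst_conv snd_conv mixture_eq_gaussian s_def[symmetric] of_real_mult
        by (subst mult.left_commute) (simp only:)
    qed
    hence "(LINT z|lborel. \<Phi> (t, z)) = of_real (exp (\<nu> * t - exp t)) *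
        (LINT z|lborel. exp (of_real ((b + u + v) * Re z) + \<i> * of_real ((u - v) * Im z) - of_real (s * (cmod z)\<^sup>2)))"
      by simp
    also have "\<dots> = of_real (exp (\<nu> * t - exp t)) * of_real (pi / s * exp (((b + u + v)\<^sup>2 - (u - v)\<^sup>2) / (4 * s)))"
      by (simp only: integral_exp_gaussian_plane[OF s])
    also have "\<dots> = of_real (exp (\<nu> * t - exp t) * (pi / s * exp (((b + u + v)\<^sup>2 - (u - v)\<^sup>2) / (4 * s))))"
      by simp
    also have "pi / s = 4 * pi / a\<^sup>2 * exp t"
      using a_pos by (simp add: s_def exp_minus field_simps)
    also have "((b + u + v)\<^sup>2 - (u - v)\<^sup>2) / (4 * s) = (1 - d) * exp t"
      using a_pos by (simp add: s_def d_eq exp_minus field_simps)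
    also have "exp (\<nu> * t - exp t) * (4 * pi / a\<^sup>2 * exp t * exp ((1 - d) * exp t)) =
        4 * pi / a\<^sup>2 * (exp (\<nu> * t - exp t) * exp t * exp ((1 - d) * exp t))"
      by (simp only: mult_ac)
    also have "exp (\<nu> * t - exp t) * exp t * exp ((1 - d) * exp t) = exp ((\<nu> + 1) * t - d * exp t)"
      unfolding exp_add[symmetric] by (simp add: algebra_simps)
    finally show ?thesis .
  qed
  have "(LINT z|lborel. E z * of_real (weight z)) = (LINT z|lborel. LINT t|lborel. \<Phi> (t, z))"
  proof (rule integral_cong_AE)
    show "AE z in lborel. E z * of_real (weight z) = (LINT t|lborel. \<Phi> (t, z))"
      using AE_lborel_singleton[of "0 :: complex"]
      by eventually_elim (simp add: \<Phi>_def w)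
  qed measurable
  also have "\<dots> = (LINT t|lborel. LINT z|lborel. \<Phi> (t, z))"
    using lborel_pair.Fubini_integral[of "\<lambda>t z. \<Phi> (t, z)"] int by simp
  also have "\<dots> = of_real (4 * pi / a\<^sup>2 * (LINT t|lborel. exp ((\<nu> + 1) * t - d * exp t)))"
    unfolding inner by (subst integral_complex_of_real) simp
  also have "(LINT t|lborel. exp ((\<nu> + 1) * t - d * exp t)) = Gamma (\<nu> + 1) * d powr (- (\<nu> + 1))"
    using d nu by (subst integral_eq_nn_integral) (auto simp: nn_integral_exp_Gamma Gamma_real_nonneg)
  finally show ?thesis unfolding E_def d_def .
qed

text \<open>An exponential rate that the weight still absorbs: \<open>b + 2 growth < a\<close>.\<close>

definition growth :: real where "growth = (a - b) / 4"

lemma growth_pos: "growth > 0" using b_less by (simp add: growth_def)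

text \<open>\<open>exp (\<delta> |z|)\<close> is bounded by the sum of the four exponentials of \<open>\<plusminus>\<delta> Re z \<plusminus> \<delta> Im z\<close>.\<close>

lemma integrable_exp_norm_weight: "integrable lborel (\<lambda>z. exp (growth * cmod z) * weight z)"
proof -
  define \<delta> where "\<delta> = growth"
  have \<delta>: "\<delta> > 0" "b + 2 * \<delta> < a" using growth_pos b_less by (auto simp: \<delta>_def growth_def field_simps)
  have sq: "(b + u)\<^sup>2 + v\<^sup>2 < a\<^sup>2" if "u = \<delta> \<or> u = - \<delta>" "v = \<delta> \<or> v = - \<delta>" for u v
  proof -
    have "\<bar>b + u\<bar> \<le> \<bar>b + \<delta>\<bar>" using that \<delta> b_pos by auto
    hence "(b + u)\<^sup>2 \<le> (b + \<delta>)\<^sup>2" by (simp only: abs_le_square_iff)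
    moreover have "v\<^sup>2 = \<delta>\<^sup>2" using that by auto
    moreover have "(b + \<delta>)\<^sup>2 + \<delta>\<^sup>2 \<le> (b + 2 * \<delta>)\<^sup>2"
      using \<delta> b_pos by (simp add: power2_eq_square algebra_simps)
    moreover have "(b + 2 * \<delta>)\<^sup>2 < a\<^sup>2"
      using \<delta> b_pos by (intro power_strict_mono) auto
    ultimately show ?thesis by simp
  qed
  define E where "E u v z = exp (u * Re z + v * Im z) * weight z" for u v z
  have E: "integrable lborel (E u v)" if "u = \<delta> \<or> u = - \<delta>" "v = \<delta> \<or> v = - \<delta>" for u v
    unfolding E_def by (rule integrable_exp_weight[OF sq[OF that]])
  show ?thesis
  proof (rule Bochner_Integration.integrable_bound)
    show "integrable lborel (\<lambda>z. E \<delta> \<delta> z + E \<delta> (-\<delta>) z + (E (-\<delta>) \<delta> z + E (-\<delta>) (-\<delta>) z))"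
      by (intro Bochner_Integration.integrable_add E) auto
    show "AE z in lborel. norm (exp (growth * cmod z) * weight z) \<le>
        norm (E \<delta> \<delta> z + E \<delta> (-\<delta>) z + (E (-\<delta>) \<delta> z + E (-\<delta>) (-\<delta>) z))"
    proof (intro AE_I2)
      fix z :: complex
      have nn: "E u v z \<ge> 0" for u v by (simp add: E_def)
      define u where "u = (if Re z \<ge> 0 then \<delta> else - \<delta>)"
      define v where "v = (if Im z \<ge> 0 then \<delta> else - \<delta>)"
      have "\<delta> * cmod z \<le> \<delta> * (\<bar>Re z\<bar> + \<bar>Im z\<bar>)"
        using \<delta> cmod_le by (intro mult_left_mono) auto
      also have "\<dots> = u * Re z + v * Im z"
        by (auto simp: u_def v_def algebra_simps)
      finally have "exp (growth * cmod z) * weight z \<le> E u v z"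
        unfolding E_def \<delta>_def[symmetric] by (intro mult_right_mono) auto
      also have "\<dots> \<le> E \<delta> \<delta> z + E \<delta> (-\<delta>) z + (E (-\<delta>) \<delta> z + E (-\<delta>) (-\<delta>) z)"
        using nn[of \<delta> \<delta>] nn[of \<delta> "-\<delta>"] nn[of "-\<delta>" \<delta>] nn[of "-\<delta>" "-\<delta>"]
        unfolding u_def v_def by (simp split: if_split)
      finally show "norm (exp (growth * cmod z) * weight z) \<le>
        norm (E \<delta> \<delta> z + E \<delta> (-\<delta>) z + (E (-\<delta>) \<delta> z + E (-\<delta>) (-\<delta>) z))"
        using nn[of \<delta> \<delta>] nn[of \<delta> "-\<delta>"] nn[of "-\<delta>" \<delta>] nn[of "-\<delta>" "-\<delta>"] by simp
    qed
  qed measurable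
qed

end

section \<open>Orthogonality of the scaled Laguerre polynomials\<close>

context bessel_weight
begin

definition tau :: real where "tau = b / a"

text \<open>The scaling that makes the pairing of two generating functions depend on \<open>t\<close> and \<open>r\<close> only through \<open>t r\<close>.\<close>

definition kappa :: real where "kappa = (a\<^sup>2 - b\<^sup>2) / (2 * b)"

text \<open>The squared norm of \<open>L\<^sub>n\<^sup>\<nu>(kappa z)\<close> with respect to the weight and the normalised area measure.\<close>

definition lag_norm :: "nat \<Rightarrow> real" where
  "lag_norm n = 4 / a\<^sup>2 * Gamma (\<nu> + 1) * (1 - tau\<^sup>2) powr (- (\<nu> + 1)) *
     (pochhammer (\<nu> + 1) n / fact n) / tau ^ (2 * n)"

lemma tau_pos: "0 < tau" and tau_less: "tau < 1"
  using b_pos b_less by (auto simp: tau_def)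

lemma kappa_pos: "kappa > 0"
proof -
  have "b\<^sup>2 < a\<^sup>2" using b_pos b_less by (intro power_strict_mono) auto
  thus ?thesis using b_pos by (simp add: kappa_def)
qed

lemma lag_norm_pos: "lag_norm n > 0"
proof -
  have "tau\<^sup>2 < 1" using tau_pos tau_less by (simp add: power_less_one_iff)
  thus ?thesis
    unfolding lag_norm_def using a_pos nu tau_pos
    by (intro mult_pos_pos divide_pos_pos pochhammer_pos Gamma_real_pos) auto
qed

definition lag :: "nat \<Rightarrow> complex \<Rightarrow> complex" where
  "lag n z = laguerre \<nu> n (of_real kappa * z)"

text \<open>The generating function of the scaled Laguerre polynomials at a real parameter.\<close>

definition gen :: "real \<Rightarrow> complex \<Rightarrow> complex" where
  "gen t z = of_real ((1 - t) powr (- (\<nu> + 1))) * exp (of_real (- kappa * t / (1 - t)) * z)"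

text \<open>For \<open>t < rad\<close> the exponent of the generating function stays below half the admissible growth rate, so that
  products of two generating functions are integrable.\<close>

definition rad :: real where
  "rad = min (1 / 2) (min (growth / (4 * kappa)) tau)"

lemma rad_pos: "rad > 0"
  using growth_pos kappa_pos tau_pos by (simp add: rad_def)

lemma rad_le: "rad \<le> 1 / 2" "rad \<le> tau" "rad < 1"
  by (auto simp: rad_def)

lemma rad_exponent:
  assumes t: "0 \<le> t" "t < rad"
  shows "kappa * t / (1 - t) \<le> growth / 2"
proof -
  have "t \<le> 1 / 2" "t \<le> growth / (4 * kappa)" using t by (auto simp: rad_def)
  hence t': "4 * (kappa * t) \<le> growth" using kappa_pos by (simp add: field_simps)
  have "kappa * t / (1 - t) \<le> kappa * t / (1 / 2)"
    using t \<open>t \<le> 1 / 2\<close> kappa_pos by (intro divide_left_mono) auto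
  also have "\<dots> \<le> growth / 2" using t' by simp
  finally show ?thesis .
qed

lemma borel_measurable_lag [measurable]: "lag n \<in> borel_measurable borel"
  unfolding lag_def[abs_def] laguerre_def by measurable

lemma borel_measurable_gen [measurable]: "gen t \<in> borel_measurable borel"
  unfolding gen_def[abs_def] by measurable

lemma gen_sums:
  assumes t: "0 \<le> t" "t < rad"
  shows "(\<lambda>n. of_real t ^ n * lag n z) sums gen t z"
proof -
  have t1: "t < 1" using t rad_le by simp
  have "complex_of_real ((1 - t) powr (- (\<nu> + 1))) = (1 - of_real t) powr of_real (- (\<nu> + 1))"
    using t1 by (simp flip: powr_of_real)
  moreover have "of_real (- kappa * t / (1 - t)) * z = - (of_real kappa * z) * of_real t / (1 - of_real t)"
    by (simp add: mult_ac)
  moreover have "(\<lambda>n. of_real t ^ n * laguerre \<nu> n (of_real kappa * z)) sums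
      ((1 - of_real t) powr of_real (- (\<nu> + 1)) * exp (- (of_real kappa * z) * of_real t / (1 - of_real t)))"
    by (rule laguerre_generating_function(1)[OF nu]) (use t t1 in simp)
  ultimately show ?thesis
    unfolding gen_def lag_def by (simp only:)
qed

lemma sum_norm_lag_le:
  assumes t: "0 \<le> t" "t < rad"
  shows "(\<Sum>n<N. t ^ n * norm (lag n z)) \<le> (1 - t) powr (- (\<nu> + 1)) * exp (growth / 2 * cmod z)"
proof -
  have t1: "t < 1" using t rad_le by simp
  have "(\<Sum>n<N. t ^ n * norm (lag n z)) \<le> (\<Sum>n<N. t ^ n * (\<Sum>k\<le>n. lag_coeff \<nu> n k * norm (of_real kappa * z) ^ k))"
    unfolding lag_def using t by (intro sum_mono mult_left_mono norm_laguerre_le[OF nu]) auto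
  also have "\<dots> \<le> (1 - t) powr (- (\<nu> + 1)) * exp (norm (of_real kappa * z) * t / (1 - t))"
  proof -
    note S = laguerre_majorant_sums[OF nu t(1) t1, of "norm (of_real kappa * z)"]
    show ?thesis
      unfolding sums_unique[OF S] using t lag_coeff_pos[OF nu]
      by (intro sum_le_suminf sums_summable[OF S])
         (auto intro!: mult_nonneg_nonneg sum_nonneg intro: less_imp_le)
  qed
  also have "norm (of_real kappa * z) * t / (1 - t) = (kappa * t / (1 - t)) * cmod z"
    using kappa_pos by (simp add: norm_mult)
  also have "(1 - t) powr (- (\<nu> + 1)) * exp ((kappa * t / (1 - t)) * cmod z) \<le>
      (1 - t) powr (- (\<nu> + 1)) * exp (growth / 2 * cmod z)"
    using mult_right_mono[OF rad_exponent[OF t], of "cmod z"] by (intro mult_left_mono) (simp_all only: exp_le_cancel_iff norm_ge_zero powr_ge_zero)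
  finally show ?thesis .
qed

lemma norm_gen_le:
  assumes t: "0 \<le> t" "t < rad"
  shows "norm (gen t z) \<le> (1 - t) powr (- (\<nu> + 1)) * exp (growth / 2 * cmod z)"
proof (rule LIMSEQ_le_const2)
  show "(\<lambda>N. norm (\<Sum>n<N. of_real t ^ n * lag n z)) \<longlonglongrightarrow> norm (gen t z)"
    using gen_sums[OF t, of z] unfolding sums_def by (rule tendsto_norm)
  have "norm (\<Sum>n<N. of_real t ^ n * lag n z) \<le> (1 - t) powr (- (\<nu> + 1)) * exp (growth / 2 * cmod z)" for N
    by (rule order.trans[OF norm_sum order.trans[OF _ sum_norm_lag_le[OF t, where N = N]]])
       (use t in \<open>simp add: norm_mult norm_power\<close>)
  thus "\<exists>N. \<forall>n\<ge>N. norm (\<Sum>n<n. of_real t ^ n * lag n z) \<le> (1 - t) powr (- (\<nu> + 1)) * exp (growth / 2 * cmod z)"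
    by blast
qed

definition lag_bound :: "nat \<Rightarrow> real" where
  "lag_bound n = (1 - rad / 2) powr (- (\<nu> + 1)) / (rad / 2) ^ n"

lemma norm_lag_le: "norm (lag n z) \<le> lag_bound n * exp (growth / 2 * cmod z)"
proof -
  have t: "0 \<le> rad / 2" "rad / 2 < rad" using rad_pos by auto
  have "(rad / 2) ^ n * norm (lag n z) \<le> (\<Sum>k<Suc n. (rad / 2) ^ k * norm (lag k z))"
    using rad_pos by (intro member_le_sum) auto
  also have "\<dots> \<le> (1 - rad / 2) powr (- (\<nu> + 1)) * exp (growth / 2 * cmod z)"
    by (rule sum_norm_lag_le[OF t])
  finally show ?thesis using rad_pos by (simp add: lag_bound_def field_simps)
qed

lemma lag_bound_nonneg: "lag_bound n \<ge> 0"
  using rad_pos by (simp add: lag_bound_def)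

lemma exp_growth_square: "exp (growth / 2 * cmod z) * exp (growth / 2 * cmod z) = exp (growth * cmod z)"
  by (simp add: exp_add[symmetric])

lemma integrable_lag_products: "integrable lborel (\<lambda>z. of_real (weight z) * (lag m z * cnj (lag n z)))"
proof (rule Bochner_Integration.integrable_bound)
  show "integrable lborel (\<lambda>z. lag_bound m * lag_bound n * (exp (growth * cmod z) * weight z))"
    by (intro integrable_mult_right integrable_exp_norm_weight)
  show "AE z in lborel. norm (of_real (weight z) * (lag m z * cnj (lag n z))) \<le>
      norm (lag_bound m * lag_bound n * (exp (growth * cmod z) * weight z))"
  proof (intro AE_I2)
    fix z
    have "norm (lag m z) * norm (lag n z) \<le>
        (lag_bound m * exp (growth / 2 * cmod z)) * (lag_bound n * exp (growth / 2 * cmod z))"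
      by (intro mult_mono norm_lag_le mult_nonneg_nonneg lag_bound_nonneg) auto
    also have "\<dots> = lag_bound m * lag_bound n * exp (growth * cmod z)"
      unfolding exp_growth_square[symmetric] by (simp only: mult_ac)
    finally have "weight z * (norm (lag m z) * norm (lag n z)) \<le> weight z * (lag_bound m * lag_bound n * exp (growth * cmod z))"
      by (rule mult_left_mono) simp
    thus "norm (of_real (weight z) * (lag m z * cnj (lag n z))) \<le>
      norm (lag_bound m * lag_bound n * (exp (growth * cmod z) * weight z))"
      using lag_bound_nonneg[of m] lag_bound_nonneg[of n] by (simp add: norm_mult mult_ac)
  qed
qed measurable

text \<open>The mixed terms in \<open>(1 - t) (1 - r) (1 - 4 / a\<^sup>2 (b/2 + u) (b/2 + v))\<close> cancel by the choice of \<open>kappa\<close>.\<close>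

lemma integral_gen_gen:
  assumes t: "0 \<le> t" "t < rad" and r: "0 \<le> r" "r < rad"
  shows "(LINT z|lborel. gen t z * cnj (gen r z) * of_real (weight z)) =
     of_real (4 * pi / a\<^sup>2 * Gamma (\<nu> + 1) * (1 - tau\<^sup>2) powr (- (\<nu> + 1)) * (1 - t * r / tau\<^sup>2) powr (- (\<nu> + 1)))"
proof -
  define u where "u = - kappa * t / (1 - t)"
  define v where "v = - kappa * r / (1 - r)"
  have t1: "t < 1" "r < 1" using t r rad_le by auto
  have ub: "u \<le> 0" "v \<le> 0" using t r t1 kappa_pos by (auto simp: u_def v_def)
  have "- u \<le> growth / 2" "- v \<le> growth / 2"
    using rad_exponent[OF t] rad_exponent[OF r] by (auto simp: u_def v_def)
  hence uv: "\<bar>b + u + v\<bar> < a"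
    using ub b_pos b_less by (auto simp: growth_def abs_less_iff field_simps)
  have "gen t z * cnj (gen r z) * of_real (weight z) =
      of_real ((1 - t) powr (- (\<nu> + 1)) * (1 - r) powr (- (\<nu> + 1))) *
       (exp (of_real u * z + of_real v * cnj z) * of_real (weight z))" for z
  proof -
    have "gen t z = of_real ((1 - t) powr (- (\<nu> + 1))) * exp (of_real u * z)"
      by (simp only: gen_def u_def)
    moreover have "cnj (gen r z) = of_real ((1 - r) powr (- (\<nu> + 1))) * exp (of_real v * cnj z)"
      by (simp only: gen_def v_def complex_cnj_mult complex_cnj_complex_of_real exp_cnj)
    ultimately show ?thesis by (simp only: of_real_mult exp_add mult_ac)
  qed
  hence "(LINT z|lborel. gen t z * cnj (gen r z) * of_real (weight z)) =
     of_real ((1 - t) powr (- (\<nu> + 1)) * (1 - r) powr (- (\<nu> + 1))) *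
     of_real (4 * pi / a\<^sup>2 * (Gamma (\<nu> + 1) * (1 - 4 / a\<^sup>2 * ((b / 2 + u) * (b / 2 + v))) powr (- (\<nu> + 1))))"
    by (simp only: integral_mult_right_zero integral_exp_weight[OF uv])
  also have "\<dots> = of_real (4 * pi / a\<^sup>2 * Gamma (\<nu> + 1) *
     ((1 - t) powr (- (\<nu> + 1)) * (1 - r) powr (- (\<nu> + 1)) * (1 - 4 / a\<^sup>2 * ((b / 2 + u) * (b / 2 + v))) powr (- (\<nu> + 1))))"
    unfolding of_real_mult[symmetric] of_real_eq_iff by (simp only: mult_ac)
  also have "(1 - t) powr (- (\<nu> + 1)) * (1 - r) powr (- (\<nu> + 1)) * (1 - 4 / a\<^sup>2 * ((b / 2 + u) * (b / 2 + v))) powr (- (\<nu> + 1)) =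
      (1 - tau\<^sup>2) powr (- (\<nu> + 1)) * (1 - t * r / tau\<^sup>2) powr (- (\<nu> + 1))"
  proof -
    have e1: "(1 - t) * (b / 2 + u) = (b - t * a\<^sup>2 / b) / 2" and e2: "(1 - r) * (b / 2 + v) = (b - r * a\<^sup>2 / b) / 2"
      using t1 b_pos by (auto simp: u_def v_def kappa_def field_simps power2_eq_square)
    have "((1 - t) * (1 - r)) * (1 - 4 / a\<^sup>2 * ((b / 2 + u) * (b / 2 + v))) =
       (1 - t) * (1 - r) - 4 / a\<^sup>2 * (((1 - t) * (b / 2 + u)) * ((1 - r) * (b / 2 + v)))"
    proof -
      have "(p * q) * (1 - k * (x * y)) = p * q - k * ((p * x) * (q * y))" for p q k x y :: real
        by (simp add: algebra_simps)
      thus ?thesis .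
    qed
    also have "\<dots> = (1 - tau\<^sup>2) * (1 - t * r / tau\<^sup>2)"
      unfolding e1 e2 tau_def using a_pos b_pos by (simp add: field_simps power2_eq_square)
    finally have prod: "((1 - t) * (1 - r)) * (1 - 4 / a\<^sup>2 * ((b / 2 + u) * (b / 2 + v))) = (1 - tau\<^sup>2) * (1 - t * r / tau\<^sup>2)" .
    have "4 * ((b / 2 + u) * (b / 2 + v)) = (b + u + v)\<^sup>2 - (u - v)\<^sup>2"
      by (simp add: power2_eq_square algebra_simps)
    hence "4 / a\<^sup>2 * ((b / 2 + u) * (b / 2 + v)) = ((b + u + v)\<^sup>2 - (u - v)\<^sup>2) / a\<^sup>2"
      by (simp only: times_divide_eq_left)
    also have "\<dots> \<le> (b + u + v)\<^sup>2 / a\<^sup>2"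
      by (intro divide_right_mono) auto
    also have "\<dots> < 1" using power_strict_mono[OF uv, of 2] a_pos by simp
    finally have p1: "1 - 4 / a\<^sup>2 * ((b / 2 + u) * (b / 2 + v)) > 0" by simp
    have "t * r < tau * tau"
      using t r rad_le tau_pos by (intro mult_strict_mono') auto
    hence p2: "1 - t * r / tau\<^sup>2 > 0" using tau_pos by (simp add: power2_eq_square)
    have p3: "1 - tau\<^sup>2 > 0" using tau_pos tau_less by (simp add: power_less_one_iff)
    show ?thesis
      using t1 p1 p2 p3 unfolding powr_mult[symmetric] prod by (simp add: powr_mult[symmetric] prod)
  qed
  finally show ?thesis by (simp only: mult.assoc)
qed

text \<open>The pairing of the generating functions at \<open>t\<close> and \<open>r\<close> is a function of \<open>t r\<close>. Comparing coefficients, first of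
  the powers of \<open>t\<close> and then of the powers of \<open>r\<close>, leaves the diagonal only.\<close>

lemma lag_orthogonal:
  "(LINT z|lborel. of_real (weight z) * (lag m z * cnj (lag n z))) = (if m = n then of_real (pi * lag_norm n) else 0)"
proof -
  define C where "C = 4 * pi / a\<^sup>2 * Gamma (\<nu> + 1) * (1 - tau\<^sup>2) powr (- (\<nu> + 1))"
  define V where "V n = pochhammer (\<nu> + 1) n / fact n" for n
  define ip where "ip m n = (LINT z|lborel. of_real (weight z) * (lag m z * cnj (lag n z)))" for m n
  define I where "I n r = (LINT z|lborel. of_real (weight z) * (lag n z * cnj (gen r z)))" for n r
  have intg: "integrable lborel (\<lambda>z. c * (exp (growth * cmod z) * weight z))" for c
    by (intro integrable_mult_right integrable_exp_norm_weight)
  \<comment> \<open>Two expansions of the same pairing in powers of \<open>t\<close> determine \<open>I n r\<close>.\<close>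
  have S1: "(\<lambda>n. I n r * of_real t ^ n) sums of_real (C * (1 - t * r / tau\<^sup>2) powr (- (\<nu> + 1)))"
    if t: "0 \<le> t" "t < rad" and r: "0 \<le> r" "r < rad" for t r
  proof -
    define c where "c = (1 - t) powr (- (\<nu> + 1)) * (1 - r) powr (- (\<nu> + 1))"
    have "(\<lambda>n. LINT z|lborel. of_real (weight z) * (of_real t ^ n * lag n z * cnj (gen r z))) sums
       (LINT z|lborel. of_real (weight z) * (gen t z * cnj (gen r z)))"
    proof (rule sums_integral_dominated[OF intg[of c]])
      show "AE z in lborel. (\<lambda>n. of_real (weight z) * (of_real t ^ n * lag n z * cnj (gen r z))) sums
          (of_real (weight z) * (gen t z * cnj (gen r z)))"
        by (intro AE_I2 sums_mult sums_mult2 gen_sums t)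
      show "norm (\<Sum>n<N. of_real (weight z) * (of_real t ^ n * lag n z * cnj (gen r z))) \<le>
          c * (exp (growth * cmod z) * weight z)" for N z
      proof -
        have "norm (\<Sum>n<N. of_real (weight z) * (of_real t ^ n * lag n z * cnj (gen r z))) =
          weight z * (norm (\<Sum>n<N. of_real t ^ n * lag n z) * norm (gen r z))"
          by (simp only: sum_distrib_left[symmetric] sum_distrib_right[symmetric] norm_mult complex_mod_cnj norm_of_real abs_of_nonneg weight_nonneg)
        also have "\<dots> \<le> weight z * (((1 - t) powr (- (\<nu> + 1)) * exp (growth / 2 * cmod z)) * ((1 - r) powr (- (\<nu> + 1)) * exp (growth / 2 * cmod z)))"
        proof (intro mult_left_mono mult_mono norm_gen_le[OF r])
          show "norm (\<Sum>n<N. of_real t ^ n * lag n z) \<le> (1 - t) powr (- (\<nu> + 1)) * exp (growth / 2 * cmod z)"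
            by (rule order.trans[OF norm_sum order.trans[OF _ sum_norm_lag_le[OF t, where N = N]]])
               (use t in \<open>simp add: norm_mult norm_power\<close>)
        qed auto
        also have "\<dots> = c * (exp (growth * cmod z) * weight z)"
          unfolding exp_growth_square[symmetric] c_def by (simp only: mult_ac)
        finally show ?thesis .
      qed
    qed measurable
    moreover have "(LINT z|lborel. of_real (weight z) * (of_real t ^ n * lag n z * cnj (gen r z))) = I n r * of_real t ^ n" for n
    proof -
      have "(LINT z|lborel. of_real (weight z) * (of_real t ^ n * lag n z * cnj (gen r z))) =
         (LINT z|lborel. of_real (weight z) * (lag n z * cnj (gen r z)) * of_real t ^ n)"
        by (intro Bochner_Integration.integral_cong refl) (simp only: mult_ac)
      thus ?thesis by (simp only: I_def integral_mult_left_zero)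
    qed
    moreover have "(LINT z|lborel. of_real (weight z) * (gen t z * cnj (gen r z))) = of_real (C * (1 - t * r / tau\<^sup>2) powr (- (\<nu> + 1)))"
      using integral_gen_gen[OF t r] by (simp only: C_def mult_ac)
    ultimately show ?thesis by simp
  qed
  have S2: "(\<lambda>n. complex_of_real (C * V n / tau ^ (2 * n) * r ^ n) * of_real t ^ n) sums of_real (C * (1 - t * r / tau\<^sup>2) powr (- (\<nu> + 1)))"
    if t: "0 \<le> t" "t < rad" and r: "0 \<le> r" "r < rad" for t r
  proof -
    have "t * r < tau * tau"
      using t r rad_le tau_pos by (intro mult_strict_mono') auto
    hence "0 \<le> t * r / tau\<^sup>2" "t * r / tau\<^sup>2 < 1" using t r tau_pos by (auto simp: power2_eq_square)
    from sums_mult[OF binomial_series_pochhammer_real[OF this, of "\<nu> + 1"], of C]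
    have "(\<lambda>n. C * (V n * (t * r / tau\<^sup>2) ^ n)) sums (C * (1 - t * r / tau\<^sup>2) powr (- (\<nu> + 1)))"
      by (simp only: V_def)
    moreover have "C * (V n * (t * r / tau\<^sup>2) ^ n) = C * V n / tau ^ (2 * n) * r ^ n * t ^ n" for n
      by (simp add: power_divide power_mult_distrib power_mult)
    ultimately have "(\<lambda>n. complex_of_real (C * V n / tau ^ (2 * n) * r ^ n * t ^ n)) sums of_real (C * (1 - t * r / tau\<^sup>2) powr (- (\<nu> + 1)))"
      by (simp only: sums_of_real_iff)
    thus ?thesis by (simp only: of_real_mult of_real_power)
  qed
  have I: "I n r = of_real (C * V n / tau ^ (2 * n) * r ^ n)" if r: "0 \<le> r" "r < rad" for n r
    by (rule powser_coeff_unique[OF rad_pos S1 S2]) (use r in auto)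
  \<comment> \<open>Two expansions of \<open>I n r\<close> in powers of \<open>r\<close> determine the inner products.\<close>
  have S3: "(\<lambda>m. ip n m * of_real r ^ m) sums I n r" if r: "0 \<le> r" "r < rad" for n r
  proof -
    define c where "c = lag_bound n * (1 - r) powr (- (\<nu> + 1))"
    have "(\<lambda>m. LINT z|lborel. of_real (weight z) * (lag n z * cnj (of_real r ^ m * lag m z))) sums I n r"
      unfolding I_def
    proof (rule sums_integral_dominated[OF intg[of c]])
      show "AE z in lborel. (\<lambda>m. of_real (weight z) * (lag n z * cnj (of_real r ^ m * lag m z))) sums
          (of_real (weight z) * (lag n z * cnj (gen r z)))"
        by (intro AE_I2 sums_mult sums_cnj[THEN iffD2] gen_sums r)
      show "norm (\<Sum>m<N. of_real (weight z) * (lag n z * cnj (of_real r ^ m * lag m z))) \<le>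
          c * (exp (growth * cmod z) * weight z)" for N z
      proof -
        have "norm (\<Sum>m<N. of_real (weight z) * (lag n z * cnj (of_real r ^ m * lag m z))) =
          weight z * (norm (lag n z) * norm (\<Sum>m<N. of_real r ^ m * lag m z))"
          by (simp only: sum_distrib_left[symmetric] cnj_sum[symmetric] norm_mult complex_mod_cnj norm_of_real abs_of_nonneg weight_nonneg)
        also have "\<dots> \<le> weight z * ((lag_bound n * exp (growth / 2 * cmod z)) * ((1 - r) powr (- (\<nu> + 1)) * exp (growth / 2 * cmod z)))"
        proof (intro mult_left_mono mult_mono norm_lag_le)
          show "norm (\<Sum>m<N. of_real r ^ m * lag m z) \<le> (1 - r) powr (- (\<nu> + 1)) * exp (growth / 2 * cmod z)"
            by (rule order.trans[OF norm_sum order.trans[OF _ sum_norm_lag_le[OF r, where N = N]]])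
               (use r in \<open>simp add: norm_mult norm_power\<close>)
        qed (auto intro!: mult_nonneg_nonneg lag_bound_nonneg)
        also have "\<dots> = c * (exp (growth * cmod z) * weight z)"
          unfolding exp_growth_square[symmetric] c_def by (simp only: mult_ac)
        finally show ?thesis .
      qed
    qed measurable
    moreover have "(LINT z|lborel. of_real (weight z) * (lag n z * cnj (of_real r ^ m * lag m z))) = ip n m * of_real r ^ m" for m
    proof -
      have "(LINT z|lborel. of_real (weight z) * (lag n z * cnj (of_real r ^ m * lag m z))) =
         (LINT z|lborel. of_real (weight z) * (lag n z * cnj (lag m z)) * of_real r ^ m)"
        by (intro Bochner_Integration.integral_cong refl) (simp add: mult_ac)
      thus ?thesis by (simp only: ip_def integral_mult_left_zero)
    qed
    ultimately show ?thesis by simp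
  qed
  have S4: "(\<lambda>m. (if m = n then of_real (C * V n / tau ^ (2 * n)) else 0) * of_real r ^ m) sums I n r"
    if r: "0 \<le> r" "r < rad" for n r
  proof -
    have "(\<lambda>m. if m = n then complex_of_real (C * V n / tau ^ (2 * n)) * of_real r ^ m else 0) sums
        (\<Sum>m\<in>{n}. complex_of_real (C * V n / tau ^ (2 * n)) * of_real r ^ m)"
      using sums_If_finite_set[of "{n}" "\<lambda>m. complex_of_real (C * V n / tau ^ (2 * n)) * of_real r ^ m"] by simp
    moreover have "(\<lambda>m. if m = n then of_real (C * V n / tau ^ (2 * n)) * of_real r ^ m else 0) =
        (\<lambda>m. (if m = n then complex_of_real (C * V n / tau ^ (2 * n)) else 0) * of_real r ^ m)"
      by auto
    ultimately show ?thesis using I[OF r, of n] by simp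
  qed
  have "ip m n = (if n = m then of_real (C * V m / tau ^ (2 * m)) else 0)"
    by (rule powser_coeff_unique[OF rad_pos S3 S4]) auto
  moreover have "C * V m / tau ^ (2 * m) = pi * lag_norm m"
    by (simp add: C_def V_def lag_norm_def)
  ultimately show ?thesis
    unfolding ip_def by (cases "m = n") (simp_all only: if_True if_False simp_thms not_sym)
qed

definition lag_poly :: "nat \<Rightarrow> complex poly" where
  "lag_poly n = (\<Sum>k\<le>n. monom (of_real (lag_coeff \<nu> n k) * (- of_real kappa) ^ k) k)"

lemma poly_lag_poly: "poly (lag_poly n) z = lag n z"
proof -
  have "(- of_real kappa) ^ k * z ^ k = (- (of_real kappa * z)) ^ k" for k
    by (simp add: power_mult_distrib[symmetric])
  thus ?thesis
    by (simp add: lag_poly_def lag_def laguerre_def poly_sum poly_monom mult.assoc)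
qed

lemma degree_lag_poly: "degree (lag_poly n) = n"
proof (rule antisym)
  show "degree (lag_poly n) \<le> n"
    unfolding lag_poly_def by (intro degree_sum_le) (auto intro: order.trans[OF degree_monom_le])
  have "poly.coeff (lag_poly n) n = of_real (lag_coeff \<nu> n n) * (- of_real kappa) ^ n"
    by (simp add: lag_poly_def coeff_sum)
  also have "\<dots> \<noteq> 0"
    using lag_coeff_pos[OF nu, of n n] kappa_pos by auto
  finally show "n \<le> degree (lag_poly n)" by (rule le_degree)
qed

end

section \<open>Abel sums along a vertical line\<close>

text \<open>With \<open>t = \<rho> exp (i \<theta>)\<close>, these are the squared distance of \<open>t\<close> from \<open>1\<close> and the real and imaginary parts
  of \<open>t / (1 - t)\<close>.\<close>

definition circD :: "real \<Rightarrow> real \<Rightarrow> real" where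
  "circD \<rho> \<theta> = 1 - 2 * \<rho> * cos \<theta> + \<rho>\<^sup>2"

definition circP :: "real \<Rightarrow> real \<Rightarrow> real" where
  "circP \<rho> \<theta> = (\<rho> * cos \<theta> - \<rho>\<^sup>2) / circD \<rho> \<theta>"

definition circQ :: "real \<Rightarrow> real \<Rightarrow> real" where
  "circQ \<rho> \<theta> = \<rho> * sin \<theta> / circD \<rho> \<theta>"

lemma circD_bounds:
  assumes "0 < \<rho>"
  shows "(1 - \<rho>)\<^sup>2 \<le> circD \<rho> \<theta>" "circD \<rho> \<theta> \<le> (1 + \<rho>)\<^sup>2"
proof -
  have "\<rho> * cos \<theta> \<le> \<rho> * 1" "\<rho> * (-1) \<le> \<rho> * cos \<theta>"
    using assms by (intro mult_left_mono; simp)+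
  thus "(1 - \<rho>)\<^sup>2 \<le> circD \<rho> \<theta>" "circD \<rho> \<theta> \<le> (1 + \<rho>)\<^sup>2"
    by (auto simp: circD_def power2_eq_square algebra_simps)
qed

lemma circD_pos:
  assumes "0 < \<rho>" "\<rho> < 1"
  shows "circD \<rho> \<theta> > 0"
proof -
  have "0 < (1 - \<rho>)\<^sup>2" using assms by simp
  thus ?thesis using circD_bounds(1)[OF assms(1), of \<theta>] by linarith
qed

lemma circ_complex:
  fixes \<rho> \<theta> :: real
  assumes \<rho>: "0 < \<rho>" "\<rho> < 1"
  defines "t \<equiv> of_real \<rho> * exp (\<i> * complex_of_real \<theta>)"
  shows "(cmod (1 - t))\<^sup>2 = circD \<rho> \<theta>" and "t / (1 - t) = Complex (circP \<rho> \<theta>) (circQ \<rho> \<theta>)"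
proof -
  have e: "t = Complex (\<rho> * cos \<theta>) (\<rho> * sin \<theta>)"
    by (simp add: t_def complex_eq_iff Re_exp Im_exp)
  have sc: "(sin \<theta>)\<^sup>2 = 1 - (cos \<theta>)\<^sup>2" by (simp add: sin_squared_eq)
  show 1: "(cmod (1 - t))\<^sup>2 = circD \<rho> \<theta>"
    by (simp add: cmod_power2 e circD_def power_mult_distrib sc) (simp add: power2_eq_square algebra_simps)
  have "t / (1 - t) = t * cnj (1 - t) / of_real ((cmod (1 - t))\<^sup>2)"
    by (rule complex_div_cnj)
  also have "t * cnj (1 - t) = t - of_real ((cmod t)\<^sup>2)"
    by (simp add: algebra_simps complex_norm_square del: of_real_power)
  also have "(cmod t)\<^sup>2 = \<rho>\<^sup>2" using \<rho> by (simp add: t_def norm_mult)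
  finally show "t / (1 - t) = Complex (circP \<rho> \<theta>) (circQ \<rho> \<theta>)"
    unfolding 1 by (simp add: complex_eq_iff e circP_def circQ_def)
qed

lemma circP_eq:
  assumes \<rho>: "0 < \<rho>" "\<rho> < 1"
  shows "circP \<rho> \<theta> = - 1 / 2 + (1 - \<rho>\<^sup>2) / (2 * circD \<rho> \<theta>)"
proof -
  have "\<rho> * cos \<theta> - \<rho>\<^sup>2 = (1 - \<rho>\<^sup>2 - circD \<rho> \<theta>) / 2"
    by (simp add: circD_def)
  thus ?thesis
    unfolding circP_def using circD_pos[OF \<rho>, of \<theta>] by (simp add: diff_divide_distrib)
qed

text \<open>The Moebius map \<open>t \<mapsto> t / (1 - t)\<close> sends the circle of radius \<open>\<rho>\<close> to a circle centred on the real axis.\<close>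

lemma circ_circle:
  assumes \<rho>: "0 < \<rho>" "\<rho> < 1"
  shows "(circP \<rho> \<theta> - \<rho>\<^sup>2 / (1 - \<rho>\<^sup>2))\<^sup>2 + (circQ \<rho> \<theta>)\<^sup>2 = (\<rho> / (1 - \<rho>\<^sup>2))\<^sup>2"
proof -
  define D where "D = circD \<rho> \<theta>"
  define e where "e = 1 - \<rho>\<^sup>2"
  have D: "D > 0" using circD_pos[OF \<rho>] by (simp add: D_def)
  have e: "e > 0" using \<rho> by (simp add: e_def power_less_one_iff)
  have PQ: "(circP \<rho> \<theta>)\<^sup>2 + (circQ \<rho> \<theta>)\<^sup>2 = \<rho>\<^sup>2 / D"
  proof -
    have "(\<rho> * cos \<theta> - \<rho>\<^sup>2)\<^sup>2 + (\<rho> * sin \<theta>)\<^sup>2 = \<rho>\<^sup>2 * D"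
      by (simp add: D_def circD_def power_mult_distrib sin_squared_eq) (simp add: power2_eq_square algebra_simps)
    thus ?thesis
      using D by (simp add: circP_def circQ_def D_def[symmetric] power_divide add_divide_distrib[symmetric] power2_eq_square)
  qed
  have "(circP \<rho> \<theta> - \<rho>\<^sup>2 / e)\<^sup>2 + (circQ \<rho> \<theta>)\<^sup>2 = \<rho>\<^sup>2 / D - 2 * circP \<rho> \<theta> * (\<rho>\<^sup>2 / e) + (\<rho>\<^sup>2 / e)\<^sup>2"
    using PQ by (simp add: power2_diff)
  also have "2 * circP \<rho> \<theta> = e / D - 1"
    unfolding circP_eq[OF \<rho>] D_def[symmetric] e_def[symmetric] by simp
  also have "\<rho>\<^sup>2 / D - (e / D - 1) * (\<rho>\<^sup>2 / e) + (\<rho>\<^sup>2 / e)\<^sup>2 = \<rho>\<^sup>2 * (e + \<rho>\<^sup>2) / e\<^sup>2"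
    using D e by (simp add: field_simps power2_eq_square)
  also have "e + \<rho>\<^sup>2 = 1" by (simp add: e_def)
  finally show ?thesis by (simp add: e_def power_divide)
qed

text \<open>The maximum of \<open>s\<^sup>p exp (- q s)\<close>, attained at \<open>s = p / q\<close>; the proof is \<open>ln u \<le> u - 1\<close> for \<open>u = s q / p\<close>.\<close>

lemma powr_exp_bound:
  fixes p q s :: real
  assumes p: "p > 0" and q: "q > 0" and s: "s > 0"
  shows "s powr p * exp (- (q * s)) \<le> exp (p * ln (p / q) - p)"
proof -
  have "ln (s * q / p) \<le> s * q / p - 1"
    using p q s by (intro ln_le_minus_one) simp
  hence "p * ln (s * q / p) \<le> p * (s * q / p - 1)"
    using p by (intro mult_left_mono) auto
  also have "ln (s * q / p) = ln s - ln (p / q)"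
    using p q s by (simp add: ln_mult ln_div)
  finally have "p * ln s - q * s \<le> p * ln (p / q) - p"
    using p by (simp add: algebra_simps)
  moreover have "s powr p * exp (- (q * s)) = exp (p * ln s - q * s)"
    using s by (simp add: powr_def exp_diff exp_minus divide_inverse)
  ultimately show ?thesis by simp
qed

context bessel_weight
begin

text \<open>The vertical frequency \<open>2 kappa Q\<close> lowers the decay rate \<open>a\<close> of the weight to \<open>a beta\<close>.\<close>

definition beta :: "real \<Rightarrow> real \<Rightarrow> real" where
  "beta \<rho> \<theta> = sqrt (1 - (2 * kappa * circQ \<rho> \<theta> / a)\<^sup>2)"

text \<open>The integrand over the circle that the integral along the vertical line through \<open>x\<close> leaves behind, up to the
  constant \<open>sqrt (2 * pi) / a * (a * x / 2) powr \<nu>\<close>.\<close>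

definition line_density :: "real \<Rightarrow> real \<Rightarrow> real \<Rightarrow> real" where
  "line_density \<rho> x \<theta> = (circD \<rho> \<theta> * beta \<rho> \<theta>) powr (- (\<nu> + 1)) *
     exp (x * (b - 2 * kappa * circP \<rho> \<theta> - a * beta \<rho> \<theta>)) * bessel_scaled (\<nu> + 1 / 2) (a * x * beta \<rho> \<theta>)"

text \<open>The radii for which the vertical frequency stays below \<open>a\<close> on the whole circle, so that the integral along
  the line converges.\<close>

definition admissible :: "real \<Rightarrow> bool" where
  "admissible \<rho> \<longleftrightarrow> 0 < \<rho> \<and> \<rho> < 1 \<and> 2 * kappa * (\<rho> / (1 - \<rho>\<^sup>2)) < a"

lemma circQ_abs_le:
  assumes \<rho>: "0 < \<rho>" "\<rho> < 1"
  shows "\<bar>circQ \<rho> \<theta>\<bar> \<le> \<rho> / (1 - \<rho>\<^sup>2)"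
proof -
  have "1 - \<rho>\<^sup>2 > 0" using \<rho> by (simp add: power_less_one_iff)
  have "(circQ \<rho> \<theta>)\<^sup>2 \<le> (\<rho> / (1 - \<rho>\<^sup>2))\<^sup>2"
    using circ_circle[OF \<rho>, of \<theta>] zero_le_power2[of "circP \<rho> \<theta> - \<rho>\<^sup>2 / (1 - \<rho>\<^sup>2)"] by linarith
  hence "\<bar>circQ \<rho> \<theta>\<bar> \<le> \<bar>\<rho> / (1 - \<rho>\<^sup>2)\<bar>" by (simp only: abs_le_square_iff)
  thus ?thesis using \<rho> \<open>1 - \<rho>\<^sup>2 > 0\<close> by simp
qed

lemma beta_square_ge:
  assumes "admissible \<rho>"
  shows "1 - (2 * kappa * (\<rho> / (1 - \<rho>\<^sup>2)) / a)\<^sup>2 \<le> 1 - (2 * kappa * circQ \<rho> \<theta> / a)\<^sup>2"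
    and "0 < 1 - (2 * kappa * (\<rho> / (1 - \<rho>\<^sup>2)) / a)\<^sup>2"
proof -
  have \<rho>: "0 < \<rho>" "\<rho> < 1" "2 * kappa * (\<rho> / (1 - \<rho>\<^sup>2)) < a"
    using assms by (auto simp: admissible_def)
  have r: "1 - \<rho>\<^sup>2 > 0" using \<rho> by (simp add: power_less_one_iff)
  have "\<bar>2 * kappa * circQ \<rho> \<theta> / a\<bar> \<le> 2 * kappa * (\<rho> / (1 - \<rho>\<^sup>2)) / a"
    using circQ_abs_le[OF \<rho>(1,2), of \<theta>] kappa_pos a_pos
    by (simp only: abs_mult abs_divide abs_of_pos abs_numeral) (intro divide_right_mono mult_left_mono; simp)
  hence "\<bar>2 * kappa * circQ \<rho> \<theta> / a\<bar> \<le> \<bar>2 * kappa * (\<rho> / (1 - \<rho>\<^sup>2)) / a\<bar>" by linarith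
  hence "(2 * kappa * circQ \<rho> \<theta> / a)\<^sup>2 \<le> (2 * kappa * (\<rho> / (1 - \<rho>\<^sup>2)) / a)\<^sup>2"
    by (simp only: abs_le_square_iff)
  thus "1 - (2 * kappa * (\<rho> / (1 - \<rho>\<^sup>2)) / a)\<^sup>2 \<le> 1 - (2 * kappa * circQ \<rho> \<theta> / a)\<^sup>2" by simp
  have "2 * kappa * (\<rho> / (1 - \<rho>\<^sup>2)) / a < 1"
    using \<rho>(3) a_pos by (simp only: divide_less_eq_1_pos)
  moreover have "0 \<le> 2 * kappa * (\<rho> / (1 - \<rho>\<^sup>2)) / a"
    using \<rho> a_pos kappa_pos r by auto
  ultimately show "0 < 1 - (2 * kappa * (\<rho> / (1 - \<rho>\<^sup>2)) / a)\<^sup>2"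
    by (simp add: power_less_one_iff)
qed

lemma beta_pos:
  assumes "admissible \<rho>"
  shows "beta \<rho> \<theta> > 0" and "(beta \<rho> \<theta>)\<^sup>2 = 1 - (2 * kappa * circQ \<rho> \<theta> / a)\<^sup>2"
  using beta_square_ge(1)[OF assms, of \<theta>] beta_square_ge(2)[OF assms] unfolding beta_def by auto

text \<open>The integral in \<open>y\<close> is Gaussian for each component of the mixture, and its value has again the form of a
  mixture, now of order \<open>\<nu> + 1/2\<close>.\<close>

lemma nn_integral_line_weight:
  assumes x: "x > 0" and adm: "admissible \<rho>"
  shows "(\<integral>\<^sup>+ y. ennreal (exp (- 2 * Re (of_real kappa * Complex x y * Complex (circP \<rho> \<theta>) (circQ \<rho> \<theta>))) * weight (Complex x y)) \<partial>lborel) =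
    ennreal (exp (b * x - 2 * kappa * x * circP \<rho> \<theta>) * (2 * sqrt pi / a) * (a * x / (2 * beta \<rho> \<theta>)) powr (\<nu> + 1 / 2) *
       bessel_line (\<nu> + 1 / 2) (a * x * beta \<rho> \<theta>))"
proof -
  define P where "P = circP \<rho> \<theta>"
  define Q where "Q = circQ \<rho> \<theta>"
  define \<beta> where "\<beta> = beta \<rho> \<theta>"
  have \<beta>: "\<beta> > 0" "\<beta>\<^sup>2 = 1 - (2 * kappa * Q / a)\<^sup>2"
    using beta_pos[OF adm, of \<theta>] by (auto simp: \<beta>_def Q_def)
  define F where "F y = exp (- 2 * kappa * x * P + 2 * kappa * Q * y)" for y
  have F: "exp (- 2 * Re (of_real kappa * Complex x y * Complex P Q)) = F y" for y
    by (simp add: F_def algebra_simps)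
  have "(\<integral>\<^sup>+ y. ennreal (F y * weight (Complex x y)) \<partial>lborel) =
     (\<integral>\<^sup>+ y. \<integral>\<^sup>+ t. ennreal (F y * mixture t (Complex x y)) \<partial>lborel \<partial>lborel)"
  proof (intro nn_integral_cong)
    fix y :: real
    have "Complex x y \<noteq> 0" using x by (simp add: complex_eq_iff)
    hence "ennreal (F y * weight (Complex x y)) = ennreal (F y) * (\<integral>\<^sup>+ t. ennreal (mixture t (Complex x y)) \<partial>lborel)"
      by (simp add: nn_integral_mixture ennreal_mult F_def)
    also have "\<dots> = (\<integral>\<^sup>+ t. ennreal (F y) * ennreal (mixture t (Complex x y)) \<partial>lborel)"
      by (subst nn_integral_cmult) auto
    finally show "ennreal (F y * weight (Complex x y)) = (\<integral>\<^sup>+ t. ennreal (F y * mixture t (Complex x y)) \<partial>lborel)"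
      by (simp add: ennreal_mult F_def)
  qed
  also have "\<dots> = (\<integral>\<^sup>+ t. \<integral>\<^sup>+ y. ennreal (F y * mixture t (Complex x y)) \<partial>lborel \<partial>lborel)"
    by (rule lborel_pair.Fubini') (simp add: F_def mixture_def cmod_power2)
  also have "\<dots> = (\<integral>\<^sup>+ t. ennreal (exp (b * x - 2 * kappa * x * P) * (2 * sqrt pi / a)) *
       ennreal (exp ((\<nu> + 1 / 2) * t - \<beta>\<^sup>2 * exp t - (a * x / 2)\<^sup>2 * exp (- t))) \<partial>lborel)"
  proof (intro nn_integral_cong)
    fix t :: real
    define s where "s = a\<^sup>2 / 4 * exp (- t)"
    have s: "s > 0" using a_pos by (simp add: s_def)
    define c where "c = exp (b * x - 2 * kappa * x * P + \<nu> * t - exp t - (a * x / 2)\<^sup>2 * exp (- t))"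
    have "F y * mixture t (Complex x y) = c * exp ((2 * kappa * Q) * y - s * y\<^sup>2)" for y
      unfolding F_def mixture_def c_def exp_add[symmetric] s_def
      by (simp add: cmod_power2 power_mult_distrib power_divide algebra_simps)
    hence "(\<integral>\<^sup>+ y. ennreal (F y * mixture t (Complex x y)) \<partial>lborel) =
       (\<integral>\<^sup>+ y. ennreal c * ennreal (exp ((2 * kappa * Q) * y - s * y\<^sup>2)) \<partial>lborel)"
      by (simp add: ennreal_mult c_def)
    also have "\<dots> = ennreal c * ennreal (sqrt (pi / s) * exp ((2 * kappa * Q)\<^sup>2 / (4 * s)))"
      by (subst nn_integral_cmult, simp) (simp only: nn_integral_exp_gaussian[OF s])
    also have "sqrt (pi / s) = 2 * sqrt pi / a * exp (t / 2)"
      using a_pos by (intro real_sqrt_unique)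
        (simp_all add: s_def power_divide power_mult_distrib exp_minus exp_double[symmetric] field_simps)
    also have "(2 * kappa * Q)\<^sup>2 / (4 * s) = (1 - \<beta>\<^sup>2) * exp t"
      using a_pos by (simp add: s_def \<beta> power_divide exp_minus field_simps)
    also have "ennreal c * ennreal (2 * sqrt pi / a * exp (t / 2) * exp ((1 - \<beta>\<^sup>2) * exp t)) =
        ennreal ((2 * sqrt pi / a) * (c * exp (t / 2) * exp ((1 - \<beta>\<^sup>2) * exp t)))"
      using a_pos by (subst ennreal_mult[symmetric]) (simp_all add: c_def mult_ac)
    also have "c * exp (t / 2) * exp ((1 - \<beta>\<^sup>2) * exp t) =
       exp (b * x - 2 * kappa * x * P) * exp ((\<nu> + 1 / 2) * t - \<beta>\<^sup>2 * exp t - (a * x / 2)\<^sup>2 * exp (- t))"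
      unfolding c_def exp_add[symmetric] by (simp add: algebra_simps)
    finally show "(\<integral>\<^sup>+ y. ennreal (F y * mixture t (Complex x y)) \<partial>lborel) =
        ennreal (exp (b * x - 2 * kappa * x * P) * (2 * sqrt pi / a)) *
         ennreal (exp ((\<nu> + 1 / 2) * t - \<beta>\<^sup>2 * exp t - (a * x / 2)\<^sup>2 * exp (- t)))"
      using a_pos by (subst ennreal_mult[symmetric]) (simp_all add: mult_ac)
  qed
  also have "\<dots> = ennreal (exp (b * x - 2 * kappa * x * P) * (2 * sqrt pi / a)) *
       ennreal (((a * x / 2)\<^sup>2 / \<beta>\<^sup>2) powr ((\<nu> + 1 / 2) / 2) * bessel_line (\<nu> + 1 / 2) (2 * sqrt (\<beta>\<^sup>2 * (a * x / 2)\<^sup>2)))"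
    using \<beta>(1) a_pos x by (subst nn_integral_cmult, simp, subst nn_integral_gaussian_mixture) simp_all
  also have "((a * x / 2)\<^sup>2 / \<beta>\<^sup>2) powr ((\<nu> + 1 / 2) / 2) = (a * x / (2 * \<beta>)) powr (\<nu> + 1 / 2)"
  proof -
    have "(a * x / 2)\<^sup>2 / \<beta>\<^sup>2 = (a * x / (2 * \<beta>)) powr 2"
      using a_pos x \<beta>(1) by (simp add: power_divide power_mult_distrib)
    moreover have "2 * ((\<nu> + 1 / 2) / 2) = \<nu> + 1 / 2" by simp
    ultimately show ?thesis by (simp only: powr_powr)
  qed
  also have "2 * sqrt (\<beta>\<^sup>2 * (a * x / 2)\<^sup>2) = a * x * \<beta>"
    using a_pos x \<beta>(1) by (simp add: real_sqrt_mult)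
  also have "ennreal (exp (b * x - 2 * kappa * x * P) * (2 * sqrt pi / a)) *
      ennreal ((a * x / (2 * \<beta>)) powr (\<nu> + 1 / 2) * bessel_line (\<nu> + 1 / 2) (a * x * \<beta>)) =
      ennreal (exp (b * x - 2 * kappa * x * P) * (2 * sqrt pi / a) * (a * x / (2 * \<beta>)) powr (\<nu> + 1 / 2) *
       bessel_line (\<nu> + 1 / 2) (a * x * \<beta>))"
    using a_pos bessel_line_nonneg by (subst ennreal_mult[symmetric]) (simp_all add: mult.assoc)
  finally show ?thesis
    unfolding F[symmetric] P_def Q_def \<beta>_def .
qed

lemma line_density_eq:
  assumes x: "x > 0" and adm: "admissible \<rho>"
  shows "circD \<rho> \<theta> powr (- (\<nu> + 1)) *
      (exp (b * x - 2 * kappa * x * circP \<rho> \<theta>) * (2 * sqrt pi / a) * (a * x / (2 * beta \<rho> \<theta>)) powr (\<nu> + 1 / 2) *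
       bessel_line (\<nu> + 1 / 2) (a * x * beta \<rho> \<theta>)) =
     sqrt (2 * pi) / a * (a * x / 2) powr \<nu> * line_density \<rho> x \<theta>"
proof -
  define \<beta> where "\<beta> = beta \<rho> \<theta>"
  define D where "D = circD \<rho> \<theta>"
  have \<beta>: "\<beta> > 0" using beta_pos[OF adm, of \<theta>] by (simp add: \<beta>_def)
  have D: "D > 0" using adm by (auto simp: D_def admissible_def intro: circD_pos)
  define y where "y = a * x / 2"
  have y: "y > 0" using a_pos x by (simp add: y_def)
  have X: "a * x * \<beta> = 2 * y * \<beta>" by (simp add: y_def)
  have "bessel_line (\<nu> + 1 / 2) (2 * y * \<beta>) = bessel_scaled (\<nu> + 1 / 2) (2 * y * \<beta>) * exp (- (2 * y * \<beta>)) / sqrt (2 * y * \<beta>)"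
    using y \<beta> by (simp add: bessel_scaled_def exp_minus field_simps)
  moreover have "(y / \<beta>) powr (\<nu> + 1 / 2) / sqrt (2 * y * \<beta>) = y powr \<nu> * \<beta> powr (- (\<nu> + 1)) / sqrt 2"
  proof -
    have "(y / \<beta>) powr (\<nu> + 1 / 2) = (y powr \<nu> * sqrt y) / (\<beta> powr (\<nu> + 1 / 2))"
      using y \<beta> by (simp add: powr_divide powr_add powr_half_sqrt)
    hence "(y / \<beta>) powr (\<nu> + 1 / 2) / sqrt (2 * y * \<beta>) =
        (y powr \<nu> * sqrt y) / (\<beta> powr (\<nu> + 1 / 2)) / (sqrt 2 * sqrt y * sqrt \<beta>)"
      by (simp only: real_sqrt_mult)
    also have "\<dots> = y powr \<nu> * inverse (\<beta> powr (\<nu> + 1 / 2) * sqrt \<beta>) / sqrt 2"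
      using y by (simp add: field_simps)
    also have "\<beta> powr (\<nu> + 1 / 2) * sqrt \<beta> = \<beta> powr (\<nu> + 1)"
      using \<beta> by (simp add: powr_half_sqrt[symmetric] powr_add[symmetric] add.commute)
    finally show ?thesis by (simp only: powr_minus)
  qed
  moreover have "2 * sqrt pi / sqrt 2 = sqrt (2 * pi)"
    by (simp add: real_sqrt_mult field_simps flip: mult.assoc)
  moreover have "exp (x * (b - 2 * kappa * circP \<rho> \<theta> - a * \<beta>)) = exp (b * x - 2 * kappa * x * circP \<rho> \<theta>) * exp (- (2 * y * \<beta>))"
    unfolding exp_add[symmetric] by (simp add: y_def algebra_simps)
  moreover have "(D * \<beta>) powr (- (\<nu> + 1)) = D powr (- (\<nu> + 1)) * \<beta> powr (- (\<nu> + 1))"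
    using D \<beta> by (simp add: powr_mult)
  moreover have "a * x / (2 * \<beta>) = y / \<beta>" by (simp add: y_def)
  moreover have alg: "d * (e * (2 * sp / a) * p * (B * f / r)) = (2 * sp / s2) / a * yn * ((d * bn) * (e * f) * B)"
    if "p / r = yn * bn / s2" for d e sp p B f r s2 yn bn :: real
  proof -
    have "d * (e * (2 * sp / a) * p * (B * f / r)) = d * e * (2 * sp / a) * (p / r) * B * f" by simp
    also have "\<dots> = (2 * sp / s2) / a * yn * ((d * bn) * (e * f) * B)"
      unfolding that by (simp add: mult_ac)
    finally show ?thesis .
  qed
  ultimately show ?thesis
    unfolding line_density_def \<beta>_def[symmetric] D_def[symmetric] X y_def[symmetric]
    by (simp only: alg)
qed

lemma borel_measurable_line_density [measurable]: "line_density \<rho> x \<in> borel_measurable borel"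
  unfolding line_density_def[abs_def] circD_def circP_def circQ_def beta_def bessel_scaled_def by measurable

lemma abel_sum_on_line:
  assumes x: "x > 0" and adm: "admissible \<rho>"
  shows "(\<integral>\<^sup>+ y. (\<Sum>n. ennreal (\<rho> ^ (2 * n) * (cmod (lag n (Complex x y)))\<^sup>2 * weight (Complex x y))) \<partial>lborel) =
     ennreal (sqrt (2 * pi) / a * (a * x / 2) powr \<nu> / (2 * pi)) *
       (\<integral>\<^sup>+ \<theta>. ennreal (line_density \<rho> x \<theta>) \<partial>restrict_space lborel {0..2*pi})"
proof -
  have \<rho>: "0 < \<rho>" "\<rho> < 1" using adm by (auto simp: admissible_def)
  define M where "M = restrict_space lborel {0..2*pi :: real}"
  interpret M: sigma_finite_measure M
    unfolding M_def by (intro sigma_finite_measure_restrict_space sigma_finite_lborel) auto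
  interpret lM: pair_sigma_finite M lborel ..
  define G where "G \<theta> z = circD \<rho> \<theta> powr (- (\<nu> + 1)) *
      exp (- 2 * Re (of_real kappa * z * Complex (circP \<rho> \<theta>) (circQ \<rho> \<theta>)))" for \<theta> z
  have Gnn: "G \<theta> z \<ge> 0" for \<theta> z by (simp add: G_def)
  have sum: "(\<Sum>n. ennreal (\<rho> ^ (2 * n) * (cmod (lag n z))\<^sup>2 * weight z)) =
      ennreal (1 / (2 * pi)) * (\<integral>\<^sup>+ \<theta>. ennreal (G \<theta> z * weight z) \<partial>M)" for z
  proof -
    have [measurable]: "(\<lambda>\<theta>. G \<theta> z) \<in> borel_measurable M"
      unfolding G_def M_def circD_def circP_def circQ_def
      by (intro measurable_restrict_space1) (simp add: complex_eq_iff)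
    have "(\<Sum>n. ennreal (\<rho> ^ (2 * n) * (cmod (lag n z))\<^sup>2 * weight z)) =
        (\<Sum>n. ennreal (\<rho> ^ (2 * n) * (cmod (laguerre \<nu> n (of_real kappa * z)))\<^sup>2) * ennreal (weight z))"
      unfolding lag_def using \<rho> by (intro suminf_cong ennreal_mult) auto
    also have "\<dots> = ennreal (1 / (2 * pi)) * (\<integral>\<^sup>+ \<theta>. ennreal (G \<theta> z) \<partial>M) * ennreal (weight z)"
      by (subst ennreal_suminf_multc, subst laguerre_parseval[OF nu \<rho>])
         (simp add: G_def M_def circ_complex[OF \<rho>] mult.assoc)
    also have "\<dots> = ennreal (1 / (2 * pi)) * (\<integral>\<^sup>+ \<theta>. ennreal (G \<theta> z) * ennreal (weight z) \<partial>M)"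
      by (subst nn_integral_multc) (auto simp: mult.assoc)
    finally show ?thesis using Gnn by (simp add: ennreal_mult)
  qed
  have [measurable]: "(\<lambda>(\<theta>, y). G \<theta> (Complex x y)) \<in> borel_measurable (M \<Otimes>\<^sub>M lborel)"
  proof -
    have [measurable]: "fst \<in> M \<Otimes>\<^sub>M (lborel :: real measure) \<rightarrow>\<^sub>M borel"
      unfolding M_def by (rule measurable_compose[OF measurable_fst]) (rule measurable_restrict_space1, simp)
    show ?thesis
      unfolding G_def circD_def circP_def circQ_def case_prod_beta by (simp add: complex_eq_iff)
  qed
  have [measurable]: "(\<lambda>y. Complex x y) \<in> borel_measurable borel"
    using measurable_compose[OF measurable_Pair[OF measurable_const measurable_ident_sets] measurable_Complex, of x] by simp
  have "(\<integral>\<^sup>+ y. (\<Sum>n. ennreal (\<rho> ^ (2 * n) * (cmod (lag n (Complex x y)))\<^sup>2 * weight (Complex x y))) \<partial>lborel) =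
     ennreal (1 / (2 * pi)) * (\<integral>\<^sup>+ y. \<integral>\<^sup>+ \<theta>. ennreal (G \<theta> (Complex x y) * weight (Complex x y)) \<partial>M \<partial>lborel)"
    unfolding sum by (rule nn_integral_cmult) measurable
  also have "(\<integral>\<^sup>+ y. \<integral>\<^sup>+ \<theta>. ennreal (G \<theta> (Complex x y) * weight (Complex x y)) \<partial>M \<partial>lborel) =
      (\<integral>\<^sup>+ \<theta>. \<integral>\<^sup>+ y. ennreal (G \<theta> (Complex x y) * weight (Complex x y)) \<partial>lborel \<partial>M)"
    by (rule lM.Fubini') measurable
  also have "\<dots> = (\<integral>\<^sup>+ \<theta>. ennreal (sqrt (2 * pi) / a * (a * x / 2) powr \<nu>) * ennreal (line_density \<rho> x \<theta>) \<partial>M)"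
  proof (intro nn_integral_cong)
    fix \<theta> :: real
    have "(\<integral>\<^sup>+ y. ennreal (G \<theta> (Complex x y) * weight (Complex x y)) \<partial>lborel) =
      (\<integral>\<^sup>+ y. ennreal (circD \<rho> \<theta> powr (- (\<nu> + 1))) * 
         ennreal (exp (- 2 * Re (of_real kappa * Complex x y * Complex (circP \<rho> \<theta>) (circQ \<rho> \<theta>))) * weight (Complex x y)) \<partial>lborel)"
      by (intro nn_integral_cong) (simp only: G_def ennreal_mult[symmetric] powr_ge_zero mult_nonneg_nonneg weight_nonneg exp_ge_zero mult.assoc)
    also have "\<dots> = ennreal (circD \<rho> \<theta> powr (- (\<nu> + 1))) * 
       ennreal (exp (b * x - 2 * kappa * x * circP \<rho> \<theta>) * (2 * sqrt pi / a) * (a * x / (2 * beta \<rho> \<theta>)) powr (\<nu> + 1 / 2) *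
       bessel_line (\<nu> + 1 / 2) (a * x * beta \<rho> \<theta>))"
      by (subst nn_integral_cmult, measurable) (simp only: nn_integral_line_weight[OF x adm])
    also have "\<dots> = ennreal (sqrt (2 * pi) / a * (a * x / 2) powr \<nu> * line_density \<rho> x \<theta>)"
      using a_pos bessel_line_nonneg unfolding line_density_eq[OF x adm, symmetric]
      by (intro ennreal_mult[symmetric]) auto
    also have "\<dots> = ennreal (sqrt (2 * pi) / a * (a * x / 2) powr \<nu>) * ennreal (line_density \<rho> x \<theta>)"
      using a_pos x beta_pos[OF adm, of \<theta>]
      by (intro ennreal_mult) (auto simp: line_density_def intro!: mult_nonneg_nonneg bessel_scaled_nonneg)
    finally show "(\<integral>\<^sup>+ y. ennreal (G \<theta> (Complex x y) * weight (Complex x y)) \<partial>lborel) =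
      ennreal (sqrt (2 * pi) / a * (a * x / 2) powr \<nu>) * ennreal (line_density \<rho> x \<theta>)" .
  qed
  also have "\<dots> = ennreal (sqrt (2 * pi) / a * (a * x / 2) powr \<nu>) * (\<integral>\<^sup>+ \<theta>. ennreal (line_density \<rho> x \<theta>) \<partial>M)"
    by (rule nn_integral_cmult) (auto simp: M_def intro!: measurable_restrict_space1)
  also have "ennreal (1 / (2 * pi)) * (ennreal (sqrt (2 * pi) / a * (a * x / 2) powr \<nu>) * (\<integral>\<^sup>+ \<theta>. ennreal (line_density \<rho> x \<theta>) \<partial>M)) =
      ennreal (sqrt (2 * pi) / a * (a * x / 2) powr \<nu> / (2 * pi)) * (\<integral>\<^sup>+ \<theta>. ennreal (line_density \<rho> x \<theta>) \<partial>M)"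
    using a_pos by (simp add: ennreal_mult[symmetric] mult.assoc[symmetric]) (simp add: mult_ac)
  finally show ?thesis unfolding M_def .
qed

text \<open>Put \<open>A = 2 kappa \<rho> / (1 - \<rho>\<^sup>2)\<close> for the largest vertical frequency and \<open>C = 2 kappa (\<rho>\<^sup>2 / (1 - \<rho>\<^sup>2) - P)\<close>.
  Since \<open>P + i Q\<close> moves on a circle, \<open>a beta\<close> is \<open>sqrt (a\<^sup>2 - A\<^sup>2 + C\<^sup>2)\<close>, and the exponent is governed by
  \<open>sqrt (a\<^sup>2 - A\<^sup>2 + C\<^sup>2) - C\<close>. This decreases in \<open>C\<close>, with an explicit rate, down to \<open>a - A\<close> at \<open>C = A\<close>. The
  gain \<open>A - C\<close> is of the order of \<open>1 / circD\<close>, which is what controls the singular factor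
  \<open>circD powr (- (\<nu> + 1))\<close> of the line density uniformly in \<open>N\<close>.\<close>

lemma exponent_bound:
  assumes adm: "admissible \<rho>"
  defines "m2 \<equiv> 1 - (2 * kappa * (\<rho> / (1 - \<rho>\<^sup>2)) / a)\<^sup>2"
  shows "b - 2 * kappa * circP \<rho> \<theta> - a * beta \<rho> \<theta> \<le>
           b - a + 2 * kappa * \<rho> / (1 + \<rho>) - m2 / 4 * kappa * (1 - \<rho>\<^sup>2) * (1 / circD \<rho> \<theta> - 1 / (1 + \<rho>)\<^sup>2)"
proof -
  have \<rho>: "0 < \<rho>" "\<rho> < 1" and lt: "2 * kappa * (\<rho> / (1 - \<rho>\<^sup>2)) < a"
    using adm by (auto simp: admissible_def)
  define e where "e = 1 - \<rho>\<^sup>2"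
  have e: "e > 0" using \<rho> by (simp add: e_def power_less_one_iff)
  define P where "P = circP \<rho> \<theta>"
  define Q where "Q = circQ \<rho> \<theta>"
  define A where "A = 2 * kappa * (\<rho> / e)"
  define C where "C = 2 * kappa * (\<rho>\<^sup>2 / e - P)"
  define S where "S = a * beta \<rho> \<theta>"
  have A: "0 < A" "A < a" using lt \<rho> e kappa_pos by (auto simp: A_def e_def)
  have circ: "C\<^sup>2 + (2 * kappa * Q)\<^sup>2 = A\<^sup>2"
  proof -
    have "C\<^sup>2 + (2 * kappa * Q)\<^sup>2 = (2 * kappa)\<^sup>2 * ((P - \<rho>\<^sup>2 / e)\<^sup>2 + Q\<^sup>2)"
      unfolding C_def power_mult_distrib distrib_left by (simp add: power2_commute)
    also have "\<dots> = A\<^sup>2"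
      unfolding P_def Q_def e_def A_def by (simp only: circ_circle[OF \<rho>] power_mult_distrib)
    finally show ?thesis .
  qed
  have S0: "S > 0" using beta_pos[OF adm, of \<theta>] a_pos by (simp add: S_def)
  have S2: "S\<^sup>2 = a\<^sup>2 - A\<^sup>2 + C\<^sup>2"
  proof -
    have "S\<^sup>2 = a\<^sup>2 - (2 * kappa * Q)\<^sup>2"
      using beta_pos(2)[OF adm, of \<theta>] a_pos by (simp add: S_def power_mult_distrib Q_def right_diff_distrib power_divide)
    thus ?thesis using circ by simp
  qed
  have absC: "\<bar>C\<bar> \<le> A"
  proof -
    have "C\<^sup>2 \<le> A\<^sup>2" using circ zero_le_power2[of "2 * kappa * Q"] by linarith
    hence "\<bar>C\<bar> \<le> \<bar>A\<bar>" by (simp only: abs_le_square_iff)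
    thus ?thesis using A by simp
  qed
  have Sa: "S \<le> a"
  proof -
    have "C\<^sup>2 \<le> A\<^sup>2" using absC A by (simp add: abs_le_square_iff[symmetric])
    hence "S\<^sup>2 \<le> a\<^sup>2" using S2 by simp
    thus ?thesis using a_pos by (intro power2_le_imp_le[of S a]) auto
  qed
  have SC: "S + C > 0"
  proof -
    have "C\<^sup>2 < S\<^sup>2"
      unfolding S2 using A a_pos power_strict_mono[of A a 2] by simp
    hence "\<bar>C\<bar> < \<bar>S\<bar>" by (simp add: abs_le_square_iff not_le[symmetric])
    thus ?thesis using S0 by simp
  qed
  \<comment> \<open>Both \<open>S - C\<close> and \<open>a - A\<close> are \<open>m\<close> divided by the respective sum, and both sums are at most \<open>2 a\<close>.\<close>
  have key: "S - C \<ge> (a - A) + m2 / 4 * (A - C)"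
  proof -
    define m where "m = a\<^sup>2 - A\<^sup>2"
    have m: "m = (a - A) * (a + A)" "m = (S - C) * (S + C)"
      using S2 by (auto simp: m_def power2_eq_square algebra_simps)
    have m0: "m > 0" using A a_pos by (simp add: m(1))
    have "m * (A - C) / (4 * a\<^sup>2) \<le> m * (A - C) / ((S + C) * (a + A))"
    proof (rule divide_left_mono)
      have "(S + C) * (a + A) \<le> (2 * a) * (2 * a)"
        using SC Sa absC A by (intro mult_mono) auto
      thus "(S + C) * (a + A) \<le> 4 * a\<^sup>2" by (simp add: power2_eq_square)
    qed (use m0 absC SC A a_pos in auto)
    also have "\<dots> \<le> m * ((a + A) - (S + C)) / ((S + C) * (a + A))"
      using m0 SC A a_pos Sa by (intro divide_right_mono mult_left_mono) auto
    also have "\<dots> = m / (S + C) - m / (a + A)"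
      using SC A a_pos by (simp add: field_simps)
    also have "\<dots> = (S - C) - (a - A)"
      using SC A a_pos by (simp add: m(2)) (simp add: m(1) flip: m(2))
    finally have "m * (A - C) / (4 * a\<^sup>2) \<le> (S - C) - (a - A)" .
    moreover have "m2 = 1 - (A / a)\<^sup>2"
      by (simp only: m2_def A_def e_def)
    hence "m = a\<^sup>2 * m2"
      using a_pos by (simp add: m_def power_divide right_diff_distrib)
    hence "m * (A - C) / (4 * a\<^sup>2) = m2 / 4 * (A - C)"
      using a_pos by simp
    ultimately show ?thesis by simp
  qed
  have e': "e = (1 - \<rho>) * (1 + \<rho>)" by (simp add: e_def power2_eq_square algebra_simps)
  have re: "(\<rho> - \<rho>\<^sup>2) / e = \<rho> / (1 + \<rho>)"
  proof -
    have "\<rho> - \<rho>\<^sup>2 = (1 - \<rho>) * \<rho>" by (simp add: power2_eq_square algebra_simps)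
    thus ?thesis unfolding e' using \<rho> by simp
  qed
  have AC: "A - C = kappa * e * (1 / circD \<rho> \<theta> - 1 / (1 + \<rho>)\<^sup>2)"
  proof -
    have "A - C = kappa * (2 * (\<rho> - \<rho>\<^sup>2) / e + 2 * P)"
      using e by (simp add: A_def C_def field_simps)
    also have "2 * (\<rho> - \<rho>\<^sup>2) / e = 2 * \<rho> / (1 + \<rho>)"
      using re by (simp only: times_divide_eq_right[symmetric])
    also have "2 * P = e / circD \<rho> \<theta> - 1"
      unfolding P_def circP_eq[OF \<rho>] e_def[symmetric] by simp
    also have "2 * \<rho> / (1 + \<rho>) + (e / circD \<rho> \<theta> - 1) = e / circD \<rho> \<theta> - (1 - \<rho>) / (1 + \<rho>)"
      using \<rho> by (simp add: field_simps)
    also have "(1 - \<rho>) / (1 + \<rho>) = e / (1 + \<rho>)\<^sup>2"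
      using \<rho> unfolding e' by (simp add: power2_eq_square)
    finally show ?thesis by (simp add: right_diff_distrib mult.assoc)
  qed
  have "2 * kappa * P = 2 * kappa * (\<rho>\<^sup>2 / e) - C"
    by (simp add: C_def algebra_simps)
  hence "b - 2 * kappa * P - S = b - 2 * kappa * (\<rho>\<^sup>2 / e) - (S - C)" by simp
  also have "\<dots> \<le> b - 2 * kappa * (\<rho>\<^sup>2 / e) - ((a - A) + m2 / 4 * (A - C))"
    using key by simp
  also have "\<dots> = b - a + 2 * kappa * ((\<rho> - \<rho>\<^sup>2) / e) - m2 / 4 * (A - C)"
    using e by (simp add: A_def field_simps)
  also note re
  finally show ?thesis
    unfolding AC by (simp add: P_def S_def e_def mult.assoc)
qed

end

section \<open>Convergence of moments on the unit interval\<close>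

text \<open>Weierstrass approximation extends convergence from powers to the continuous step functions.\<close>

lemma moments_imp_weak_conv:
  fixes \<mu> :: "nat \<Rightarrow> real measure" and M :: "real measure"
  assumes \<mu>: "\<And>n. real_distribution (\<mu> n)" and M: "real_distribution M"
    and \<mu>01: "\<And>n. AE x in \<mu> n. x \<in> {0..1}" and M01: "AE x in M. x \<in> {0..1}"
    and mom: "\<And>k. (\<lambda>n. LINT x|\<mu> n. x ^ k) \<longlonglongrightarrow> (LINT x|M. x ^ k)"
  shows "weak_conv_m \<mu> M"
proof (rule integral_cts_step_conv_imp_weak_conv[OF \<mu> M])
  have int: "integrable D f" and bound: "\<And>c. (\<And>x. x \<in> {0..1} \<Longrightarrow> \<bar>f x\<bar> \<le> c) \<Longrightarrow> \<bar>LINT x|D. f x\<bar> \<le> c"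
    if D: "real_distribution D" and D01: "AE x in D. x \<in> {0..1}" and f: "continuous_on UNIV f"
    for D and f :: "real \<Rightarrow> real"
  proof -
    interpret real_distribution D by (rule D)
    have [measurable]: "f \<in> borel_measurable borel" using f by (rule borel_measurable_continuous_onI)
    have "compact (f ` {0..1})"
      by (intro compact_continuous_image continuous_on_subset[OF f]) auto
    then obtain B where B: "\<And>x. x \<in> {0..1} \<Longrightarrow> norm (f x) \<le> B"
      using compact_imp_bounded bounded_iff by (metis imageI)
    show int: "integrable D f"
      by (rule integrable_const_bound[of _ B]) (use D01 B in \<open>auto elim: eventually_mono\<close>)
    fix c assume c: "\<And>x. x \<in> {0..1} \<Longrightarrow> \<bar>f x\<bar> \<le> c"
    have "\<bar>LINT x|D. f x\<bar> \<le> (LINT x|D. \<bar>f x\<bar>)"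
      by (rule integral_abs_bound)
    also have "\<dots> \<le> (LINT x|D. c)"
      by (rule integral_mono_AE) (use int D01 c in \<open>auto elim: eventually_mono\<close>)
    finally show "\<bar>LINT x|D. f x\<bar> \<le> c" using prob_space by simp
  qed
  fix a b :: real assume ab: "a < b"
  define f where "f = cts_step a b"
  have f: "continuous_on UNIV f"
    unfolding f_def by (rule uniformly_continuous_imp_continuous[OF cts_step_uniformly_continuous[OF ab]])
  show "(\<lambda>n. integral\<^sup>L (\<mu> n) (cts_step a b)) \<longlonglongrightarrow> integral\<^sup>L M (cts_step a b)"
    unfolding f_def[symmetric]
  proof (rule LIMSEQ_I)
    fix e :: real assume e: "e > 0"
    obtain g where g: "real_polynomial_function g" "\<And>x. x \<in> {0..1} \<Longrightarrow> \<bar>f x - g x\<bar> < e / 3"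
      using Stone_Weierstrass_real_polynomial_function[of "{0..1}" f "e / 3"] f e
      by (metis compact_Icc continuous_on_subset subset_UNIV zero_less_divide_iff zero_less_numeral)
    obtain c d where gs: "g = (\<lambda>x. \<Sum>i\<le>d. c i * x ^ i)"
      using g(1) by (auto simp: real_polynomial_function_iff_sum)
    have gc: "continuous_on UNIV g" unfolding gs by (intro continuous_intros)
    have gint: "(LINT x|D. g x) = (\<Sum>i\<le>d. c i * (LINT x|D. x ^ i))"
      if "real_distribution D" "AE x in D. x \<in> {0..1}" for D
      unfolding gs
      by (subst Bochner_Integration.integral_sum)
         (auto intro!: integrable_mult_right int[OF that] continuous_intros)
    have "(\<lambda>n. LINT x|\<mu> n. g x) \<longlonglongrightarrow> (LINT x|M. g x)"
      unfolding gint[OF \<mu> \<mu>01] gint[OF M M01] by (intro tendsto_intros mom)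
    then obtain n0 where n0: "\<And>n. n \<ge> n0 \<Longrightarrow> \<bar>(LINT x|\<mu> n. g x) - (LINT x|M. g x)\<bar> < e / 3"
      using LIMSEQ_D[of _ _ "e / 3"] e by fastforce
    have close: "\<bar>(LINT x|D. f x) - (LINT x|D. g x)\<bar> \<le> e / 3"
      if D: "real_distribution D" "AE x in D. x \<in> {0..1}" for D
    proof -
      have "\<bar>LINT x|D. f x - g x\<bar> \<le> e / 3"
        by (rule bound[OF D]) (use f gc g(2) in \<open>auto intro!: continuous_intros less_imp_le\<close>)
      thus ?thesis
        by (subst (asm) Bochner_Integration.integral_diff) (auto intro: int[OF D] f gc)
    qed
    have "norm ((LINT x|\<mu> n. f x) - (LINT x|M. f x)) < e" if "n \<ge> n0" for n
      using n0[OF that] close[OF \<mu> \<mu>01, of n] close[OF M M01] by (simp add: abs_if split: if_splits)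
    thus "\<exists>n0. \<forall>n\<ge>n0. norm ((LINT x|\<mu> n. f x) - (LINT x|M. f x)) < e" by blast
  qed
qed

text \<open>The form in which weak convergence is used: finite discrete measures on the unit interval whose moments
  converge also converge when tested with a bounded function that is continuous almost everywhere for the
  limit. Total masses need not be one, since the zeroth moment is among those that converge.\<close>

lemma discrete_moment_convergence:
  fixes p u :: "nat \<Rightarrow> nat \<Rightarrow> real" and P :: "'a measure" and U :: "'a \<Rightarrow> real" and F :: "real \<Rightarrow> real"
  assumes p: "\<And>N n. p N n \<ge> 0" and psum: "\<And>N. summable (p N)" and ppos: "\<And>N. (\<Sum>n. p N n) > 0"
    and u: "\<And>N n. u N n \<in> {0..1}"
    and P: "finite_measure P" and mass: "measure P (space P) > 0"
    and U [measurable]: "U \<in> borel_measurable P" and U01: "\<And>\<theta>. \<theta> \<in> space P \<Longrightarrow> U \<theta> \<in> {0..1}"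
    and mom: "\<And>k. (\<lambda>N. \<Sum>n. p N n * u N n ^ k) \<longlonglongrightarrow> (LINT \<theta>|P. U \<theta> ^ k)"
    and F [measurable]: "F \<in> borel_measurable borel" and FB: "\<And>x. \<bar>F x\<bar> \<le> B"
    and disc: "AE \<theta> in P. isCont F (U \<theta>)"
  shows "(\<lambda>N. \<Sum>n. p N n * F (u N n)) \<longlonglongrightarrow> (LINT \<theta>|P. F (U \<theta>))"
proof -
  interpret P: finite_measure P by (rule P)
  define c where "c N = (\<Sum>n. p N n)" for N
  define C where "C = measure P (space P)"
  have c: "c N > 0" for N using ppos by (simp add: c_def)
  have C: "C > 0" using mass by (simp add: C_def)
  have clim: "c \<longlonglongrightarrow> C"
    using mom[of 0] by (simp add: c_def[abs_def] C_def)
  define K where "K N = density (count_space (UNIV :: nat set)) (\<lambda>n. ennreal (p N n / c N))" for N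
  define \<mu> where "\<mu> N = distr (K N) borel (u N)" for N
  define R where "R = density P (\<lambda>_. ennreal (1 / C))"
  define M where "M = distr R borel U"
  have K: "prob_space (K N)" for N
  proof (rule prob_spaceI)
    have "emeasure (K N) (space (K N)) = (\<integral>\<^sup>+ n. ennreal (p N n / c N) \<partial>count_space UNIV)"
      by (simp add: K_def emeasure_density)
    also have "\<dots> = (\<Sum>n. ennreal (p N n / c N))"
      by (rule nn_integral_count_space_nat)
    also have "\<dots> = ennreal (\<Sum>n. p N n / c N)"
      using p c[of N] psum by (intro suminf_ennreal2 summable_divide) auto
    also have "(\<Sum>n. p N n / c N) = 1"
      using c[of N] psum[of N] by (simp add: suminf_divide c_def)
    finally show "emeasure (K N) (space (K N)) = 1" by simp
  qed
  have R: "prob_space R"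
  proof (rule prob_spaceI)
    have "emeasure R (space R) = ennreal (1 / C) * emeasure P (space P)"
      by (simp add: R_def emeasure_density nn_integral_cmult_indicator)
    also have "\<dots> = 1"
      using C by (simp add: P.emeasure_eq_measure C_def[symmetric] ennreal_mult[symmetric])
    finally show "emeasure R (space R) = 1" .
  qed
  have \<mu>rd: "real_distribution (\<mu> N)" for N
    unfolding \<mu>_def by (rule prob_space.real_distribution_distr[OF K]) (simp add: K_def)
  have Mrd: "real_distribution M"
    unfolding M_def by (rule prob_space.real_distribution_distr[OF R]) (simp add: R_def)
  have \<mu>01: "AE x in \<mu> N. x \<in> {0..1}" for N
    unfolding \<mu>_def by (subst AE_distr_iff) (use u in \<open>auto simp: K_def\<close>)
  have M01: "AE x in M. x \<in> {0..1}"
    unfolding M_def by (subst AE_distr_iff) (use U01 in \<open>auto simp: R_def AE_density\<close>)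
  have \<mu>int: "(LINT x|\<mu> N. f x) = (\<Sum>n. p N n * f (u N n)) / c N"
    if f [measurable]: "f \<in> borel_measurable borel" and fb: "\<And>x. x \<in> {0..1} \<Longrightarrow> \<bar>f x\<bar> \<le> b" for f b N
  proof -
    have "(LINT x|\<mu> N. f x) = (LINT n|K N. f (u N n))"
      unfolding \<mu>_def by (rule integral_distr) (simp_all add: K_def)
    also have "\<dots> = (LINT n|count_space UNIV. (p N n / c N) *\<^sub>R f (u N n))"
      unfolding K_def using p c[of N] by (intro integral_density) auto
    also have "\<dots> = (\<Sum>n. (p N n / c N) *\<^sub>R f (u N n))"
    proof (rule integral_count_space_nat)
      have "summable (\<lambda>n. norm ((p N n / c N) *\<^sub>R f (u N n)))"
      proof (rule summable_comparison_test')
        show "summable (\<lambda>n. p N n / c N * b)" by (intro summable_mult2 summable_divide psum)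
        show "norm (norm ((p N n / c N) *\<^sub>R f (u N n))) \<le> p N n / c N * b" if "n \<ge> 0" for n
          using p[of N n] c[of N] fb[OF u, of N n] by (simp add: abs_mult divide_right_mono mult_left_mono)
      qed
      thus "integrable (count_space UNIV) (\<lambda>n. (p N n / c N) *\<^sub>R f (u N n))"
        by (simp add: integrable_count_space_nat_iff)
    qed
    also have "\<dots> = (\<Sum>n. p N n * f (u N n) / c N)" by simp
    also have "\<dots> = (\<Sum>n. p N n * f (u N n)) / c N"
    proof (rule suminf_divide)
      show "summable (\<lambda>n. p N n * f (u N n))"
      proof (rule summable_comparison_test')
        show "summable (\<lambda>n. p N n * b)" by (intro summable_mult2 psum)
        show "norm (p N n * f (u N n)) \<le> p N n * b" if "n \<ge> 0" for n
          using p[of N n] fb[OF u, of N n] by (simp add: abs_mult mult_left_mono)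
      qed
    qed
    finally show ?thesis .
  qed
  have Mint: "(LINT x|M. f x) = (LINT \<theta>|P. f (U \<theta>)) / C"
    if f [measurable]: "f \<in> borel_measurable borel" for f :: "real \<Rightarrow> real"
  proof -
    have "(LINT x|M. f x) = (LINT \<theta>|R. f (U \<theta>))"
      unfolding M_def by (rule integral_distr) (simp_all add: R_def)
    also have "\<dots> = (LINT \<theta>|P. (1 / C) *\<^sub>R f (U \<theta>))"
      unfolding R_def using C by (intro integral_density) auto
    finally show ?thesis by simp
  qed
  have weak: "weak_conv_m \<mu> M"
  proof (rule moments_imp_weak_conv[OF \<mu>rd Mrd \<mu>01 M01])
    fix k
    have "(\<lambda>N. (\<Sum>n. p N n * u N n ^ k) / c N) \<longlonglongrightarrow> (LINT \<theta>|P. U \<theta> ^ k) / C"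
      using C by (intro tendsto_divide mom clim) auto
    moreover have "(LINT x|\<mu> N. x ^ k) = (\<Sum>n. p N n * u N n ^ k) / c N" for N
      by (rule \<mu>int[of _ 1]) (auto simp: power_abs[symmetric] power_le_one)
    ultimately show "(\<lambda>N. LINT x|\<mu> N. x ^ k) \<longlonglongrightarrow> (LINT x|M. x ^ k)"
      by (simp add: Mint)
  qed
  have contset [measurable]: "{x. \<not> isCont F x} \<in> sets borel"
  proof -
    have "{x \<in> space borel. \<not> isCont F x} \<in> sets borel" by measurable
    thus ?thesis by simp
  qed
  have null: "M {x. \<not> isCont F x} = 0"
  proof -
    have "AE \<theta> in R. isCont F (U \<theta>)"
      unfolding R_def by (subst AE_density) (use disc in auto)
    hence "AE x in M. isCont F x"
      unfolding M_def by (subst AE_distr_iff) (auto simp: R_def)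
    thus ?thesis by (subst (asm) AE_iff_measurable[OF _ refl]) (auto simp: M_def)
  qed
  have "(\<lambda>N. LINT x|\<mu> N. F x) \<longlonglongrightarrow> (LINT x|M. F x)"
    by (rule weak_conv_imp_bdd_ae_continuous_conv[OF \<mu>rd Mrd weak null, of B]) (use FB in auto)
  hence "(\<lambda>N. (\<Sum>n. p N n * F (u N n)) / c N) \<longlonglongrightarrow> (LINT \<theta>|P. F (U \<theta>)) / C"
    using \<mu>int[of F B] FB by (simp add: Mint)
  hence "(\<lambda>N. (\<Sum>n. p N n * F (u N n)) / c N * c N) \<longlonglongrightarrow> (LINT \<theta>|P. F (U \<theta>)) / C * C"
    by (rule tendsto_mult[OF _ clim])
  thus ?thesis using c C by (simp add: less_imp_neq[symmetric])
qed

section \<open>The limit of the line density\<close>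

text \<open>The parameters for \<open>N\<close> points, and the radius \<open>tau exp (- l / (2 N))\<close> for which the Abel sum is the Laplace
  transform at \<open>l\<close>.\<close>

definition scal_a :: "real \<Rightarrow> nat \<Rightarrow> real" where "scal_a c N = (real N)\<^sup>2 / c\<^sup>2"
definition scal_b :: "real \<Rightarrow> nat \<Rightarrow> real" where "scal_b c N = (real N)\<^sup>2 / c\<^sup>2 - real N"
definition scal_kappa :: "real \<Rightarrow> nat \<Rightarrow> real" where
  "scal_kappa c N = ((scal_a c N)\<^sup>2 - (scal_b c N)\<^sup>2) / (2 * scal_b c N)"
definition scal_rho :: "real \<Rightarrow> real \<Rightarrow> nat \<Rightarrow> real" where
  "scal_rho c l N = (1 - c\<^sup>2 / real N) * exp (- l / (2 * real N))"

lemma eventually_N_gt: "\<forall>\<^sub>F N in sequentially. real N > r"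
  using filterlim_real_sequentially by (simp add: filterlim_at_top_dense)

context
  fixes c :: real
  assumes c: "c > 0"
begin

lemma scal_b_pos: "real N > c\<^sup>2 \<Longrightarrow> scal_b c N > 0"
proof -
  assume N: "real N > c\<^sup>2"
  hence "real N > 0" using zero_le_power2[of c] by linarith
  moreover have "scal_b c N = real N * (real N - c\<^sup>2) / c\<^sup>2"
    using c by (simp add: scal_b_def power2_eq_square field_simps)
  ultimately show ?thesis using N c by simp
qed

lemma scal_kappa_eq:
  assumes N: "real N > c\<^sup>2"
  shows "scal_kappa c N = real N * (2 * real N - c\<^sup>2) / (2 * (real N - c\<^sup>2))"
proof -
  have N0: "real N > 0" using N zero_le_power2[of c] by linarith
  have "scal_b c N = real N * (real N - c\<^sup>2) / c\<^sup>2"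
    using c by (simp add: scal_b_def power2_eq_square field_simps)
  moreover have "(scal_a c N)\<^sup>2 - (scal_b c N)\<^sup>2 = (scal_a c N - scal_b c N) * (scal_a c N + scal_b c N)"
    by (simp add: power2_eq_square algebra_simps)
  moreover have "scal_a c N - scal_b c N = real N" by (simp add: scal_a_def scal_b_def)
  moreover have "scal_a c N + scal_b c N = real N * (2 * real N - c\<^sup>2) / c\<^sup>2"
    using c by (simp add: scal_a_def scal_b_def power2_eq_square field_simps)
  ultimately show ?thesis
    using N N0 c by (simp add: scal_kappa_def)
qed

lemma scal_kappa_minus: "(\<lambda>N. scal_kappa c N - real N) \<longlonglongrightarrow> c\<^sup>2 / 2"
proof -
  have "(\<lambda>N. real N * c\<^sup>2 / (2 * (real N - c\<^sup>2))) \<longlonglongrightarrow> c\<^sup>2 / 2"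
    using c by (real_asymp simp: power2_eq_square)
  moreover have "\<forall>\<^sub>F N in sequentially. real N * c\<^sup>2 / (2 * (real N - c\<^sup>2)) = scal_kappa c N - real N"
    using eventually_N_gt[of "c\<^sup>2"]
    by eventually_elim (simp add: scal_kappa_eq, simp add: field_simps)
  ultimately show ?thesis by (rule Lim_transform_eventually)
qed

lemma scal_kappa_a: "(\<lambda>N. (scal_kappa c N)\<^sup>2 / scal_a c N) \<longlonglongrightarrow> c\<^sup>2"
  unfolding scal_kappa_def scal_a_def scal_b_def using c by (real_asymp simp: field_simps power2_eq_square)

lemma scal_kappa_a0: "(\<lambda>N. scal_kappa c N / scal_a c N) \<longlonglongrightarrow> 0"
  unfolding scal_kappa_def scal_a_def scal_b_def using c by (real_asymp simp: field_simps power2_eq_square)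

lemma scal_a_inf: "filterlim (scal_a c) at_top sequentially"
  unfolding scal_a_def[abs_def] using c by real_asymp

lemma scal_tau_a: "(\<lambda>N. scal_a c N * (1 - (scal_b c N / scal_a c N)\<^sup>2) / real N) \<longlonglongrightarrow> 2"
  unfolding scal_a_def scal_b_def using c by (real_asymp simp: field_simps power2_eq_square)

lemma scal_weight:
  fixes \<nu> :: real
  assumes \<nu>: "\<nu> > -1" and N: "real N > c\<^sup>2"
  shows "bessel_weight (scal_a c N) (scal_b c N) \<nu>"
proof
  show "0 < scal_b c N" using scal_b_pos[OF N] .
  have "real N > 0" using N zero_le_power2[of c] by linarith
  thus "scal_b c N < scal_a c N" by (simp add: scal_a_def scal_b_def)
qed (rule \<nu>)

context
  fixes l :: real
  assumes l: "l > 0"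
begin

lemma scal_kappa_rho2: "(\<lambda>N. scal_kappa c N * (1 - (scal_rho c l N)\<^sup>2)) \<longlonglongrightarrow> 2 * c\<^sup>2 + l"
  unfolding scal_kappa_def scal_a_def scal_b_def scal_rho_def using c by (real_asymp simp: field_simps power2_eq_square)

lemma scal_kappa_rho3: "(\<lambda>N. 2 * scal_kappa c N * scal_rho c l N / (1 + scal_rho c l N) - real N) \<longlonglongrightarrow> - l / 4"
  unfolding scal_kappa_def scal_a_def scal_b_def scal_rho_def using c by (real_asymp simp: field_simps power2_eq_square)

lemma scal_rho_1: "(scal_rho c l) \<longlonglongrightarrow> 1"
  unfolding scal_rho_def[abs_def] by real_asymp

text \<open>The limit is below one, so the radius is admissible for all large \<open>N\<close>.\<close>

lemma scal_ratio: "(\<lambda>N. 2 * scal_kappa c N * (scal_rho c l N / (1 - (scal_rho c l N)\<^sup>2)) / scal_a c N) \<longlonglongrightarrow> 2 * c\<^sup>2 / (2 * c\<^sup>2 + l)"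
proof -
  have "(\<lambda>N. 2 * ((scal_kappa c N)\<^sup>2 / scal_a c N) * scal_rho c l N / (scal_kappa c N * (1 - (scal_rho c l N)\<^sup>2)))
          \<longlonglongrightarrow> 2 * c\<^sup>2 * 1 / (2 * c\<^sup>2 + l)"
    using c l by (intro tendsto_intros scal_kappa_a scal_rho_1 scal_kappa_rho2) (auto simp: add_pos_pos less_imp_neq[symmetric])
  moreover have "\<forall>\<^sub>F N in sequentially. scal_kappa c N \<noteq> 0"
    using eventually_N_gt[of "c\<^sup>2"]
  proof eventually_elim
    case (elim N)
    have "real N > 0" "2 * real N > c\<^sup>2" using elim zero_le_power2[of c] by linarith+
    thus ?case using elim by (simp add: scal_kappa_eq)
  qed
  hence "\<forall>\<^sub>F N in sequentially. 2 * ((scal_kappa c N)\<^sup>2 / scal_a c N) * scal_rho c l N / (scal_kappa c N * (1 - (scal_rho c l N)\<^sup>2)) =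
     2 * scal_kappa c N * (scal_rho c l N / (1 - (scal_rho c l N)\<^sup>2)) / scal_a c N"
    by eventually_elim (simp add: power2_eq_square mult_ac)
  ultimately show ?thesis by (simp add: Lim_transform_eventually)
qed

lemma scal_rho_bounds: "\<forall>\<^sub>F N in sequentially. 0 < scal_rho c l N \<and> scal_rho c l N < 1"
  using eventually_N_gt[of "c\<^sup>2"]
proof eventually_elim
  case (elim N)
  have N0: "real N > 0" using elim zero_le_power2[of c] by linarith
  have t: "0 < 1 - c\<^sup>2 / real N" "1 - c\<^sup>2 / real N < 1" using elim N0 c by auto
  have e: "exp (- l / (2 * real N)) < 1" using l N0 by simp
  have "scal_rho c l N < 1 * 1"
    unfolding scal_rho_def using t e by (intro mult_strict_mono) auto
  thus ?case using t by (simp add: scal_rho_def)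
qed

lemma scal_admissible:
  fixes \<nu> :: real
  assumes \<nu>: "\<nu> > -1"
  shows "\<forall>\<^sub>F N in sequentially. bessel_weight.admissible (scal_a c N) (scal_b c N) (scal_rho c l N)"
proof -
  have "2 * c\<^sup>2 / (2 * c\<^sup>2 + l) < 1" using c l by (simp add: add_pos_pos)
  hence "\<forall>\<^sub>F N in sequentially. 2 * scal_kappa c N * (scal_rho c l N / (1 - (scal_rho c l N)\<^sup>2)) / scal_a c N < 1"
    by (rule order_tendstoD(2)[OF scal_ratio])
  with scal_rho_bounds eventually_N_gt[of "c\<^sup>2"] show ?thesis
  proof eventually_elim
    case (elim N)
    interpret bessel_weight "scal_a c N" "scal_b c N" \<nu> by (rule scal_weight[OF \<nu>]) (use elim in simp)
    have "scal_kappa c N = kappa" by (simp add: kappa_def scal_kappa_def)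
    thus ?case
      unfolding admissible_def using elim a_pos by (simp only: divide_less_eq_1_pos)
  qed
qed

text \<open>The leading terms of the exponent, which are of order \<open>N\<^sup>2\<close> and \<open>N\<close>, cancel; the limits of the three bounded
  terms that are left add up to \<open>- l / D\<close> because \<open>(sin \<theta> / D)\<^sup>2 = 1 / D - 1 / 4\<close>.\<close>

lemma line_density_tendsto:
  fixes x \<theta> \<nu> :: real
  assumes \<nu>: "\<nu> > -1" and x: "x > 0" and \<theta>: "cos \<theta> \<noteq> 1"
  shows "(\<lambda>N. bessel_weight.line_density (scal_a c N) (scal_b c N) \<nu> (scal_rho c l N) x \<theta>) \<longlonglongrightarrow>
     sqrt (2 * pi) * ((2 - 2 * cos \<theta>) powr (- (\<nu> + 1)) * exp (- l * x / (2 - 2 * cos \<theta>)))"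
proof -
  define D where "D N = circD (scal_rho c l N) \<theta>" for N
  define D0 where "D0 = 2 - 2 * cos \<theta>"
  have "cos \<theta> < 1" using \<theta> cos_le_one[of \<theta>] by (simp add: less_le)
  hence D0: "D0 > 0" by (simp add: D0_def)
  have D: "D \<longlonglongrightarrow> D0"
  proof -
    have "D \<longlonglongrightarrow> 1 - 2 * 1 * cos \<theta> + 1\<^sup>2"
      unfolding D_def[abs_def] circD_def by (intro tendsto_intros scal_rho_1)
    thus ?thesis by (simp add: D0_def)
  qed
  define Q where "Q N = circQ (scal_rho c l N) \<theta>" for N
  have Q: "Q \<longlonglongrightarrow> sin \<theta> / D0"
  proof -
    have "Q \<longlonglongrightarrow> 1 * sin \<theta> / D0"
      unfolding Q_def[abs_def] circQ_def D_def[symmetric] using D0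
      by (intro tendsto_intros scal_rho_1 D) auto
    thus ?thesis by simp
  qed
  define \<beta> where "\<beta> N = sqrt (1 - (2 * scal_kappa c N * Q N / scal_a c N)\<^sup>2)" for N
  have \<beta>: "\<beta> \<longlonglongrightarrow> 1"
  proof -
    have "(\<lambda>N. sqrt (1 - (2 * (scal_kappa c N / scal_a c N) * Q N)\<^sup>2)) \<longlonglongrightarrow> sqrt (1 - (2 * 0 * (sin \<theta> / D0))\<^sup>2)"
      by (intro tendsto_intros scal_kappa_a0 Q)
    thus ?thesis by (simp add: \<beta>_def[abs_def])
  qed
  \<comment> \<open>The exponent divided by \<open>x\<close>, with \<open>a - a \<beta>\<close> written as a quotient to expose the cancellation.\<close>
  define E where "E N = (scal_kappa c N - real N) - scal_kappa c N * (1 - (scal_rho c l N)\<^sup>2) / D N +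
      4 * ((scal_kappa c N)\<^sup>2 / scal_a c N) * (Q N)\<^sup>2 / (1 + \<beta> N)" for N
  have E: "E \<longlonglongrightarrow> - l / D0"
  proof -
    have "E \<longlonglongrightarrow> c\<^sup>2 / 2 - (2 * c\<^sup>2 + l) / D0 + 4 * c\<^sup>2 * (sin \<theta> / D0)\<^sup>2 / (1 + 1)"
      unfolding E_def[abs_def] using D0
      by (intro tendsto_intros scal_kappa_minus scal_kappa_rho2 scal_kappa_a D Q \<beta>) auto
    moreover have "(sin \<theta> / D0)\<^sup>2 = 1 / D0 - 1 / 4"
    proof -
      have co: "cos \<theta> = 1 - D0 / 2" by (simp add: D0_def field_simps)
      have "(sin \<theta>)\<^sup>2 = D0 - D0\<^sup>2 / 4"
        unfolding sin_squared_eq co by (simp add: power2_eq_square algebra_simps)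
      thus ?thesis using D0 by (simp add: power_divide diff_divide_distrib) (simp add: power2_eq_square)
    qed
    moreover have "c\<^sup>2 / 2 - (2 * c\<^sup>2 + l) / D0 + 4 * c\<^sup>2 * (1 / D0 - 1 / 4) / (1 + 1) = - l / D0"
      using D0 by (simp add: field_simps)
    ultimately show ?thesis by simp
  qed
  have X: "filterlim (\<lambda>N. scal_a c N * x * \<beta> N) at_top sequentially"
    using scal_a_inf x
    by (intro filterlim_at_top_mult_tendsto_pos[OF \<beta>]) (auto intro!: filterlim_at_top_mult_tendsto_pos[OF tendsto_const])
  have "(\<lambda>N. (D N * \<beta> N) powr (- (\<nu> + 1)) * exp (x * E N) * bessel_scaled (\<nu> + 1 / 2) (scal_a c N * x * \<beta> N)) \<longlonglongrightarrow>
     (D0 * 1) powr (- (\<nu> + 1)) * exp (x * (- l / D0)) * sqrt (2 * pi)"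
    using D0 by (intro tendsto_intros D \<beta> E filterlim_compose[OF bessel_scaled_tendsto X]) auto
  moreover have "\<forall>\<^sub>F N in sequentially. (D N * \<beta> N) powr (- (\<nu> + 1)) * exp (x * E N) * bessel_scaled (\<nu> + 1 / 2) (scal_a c N * x * \<beta> N) =
      bessel_weight.line_density (scal_a c N) (scal_b c N) \<nu> (scal_rho c l N) x \<theta>"
    using scal_admissible[OF \<nu>] scal_rho_bounds eventually_N_gt[of "c\<^sup>2"]
  proof eventually_elim
    case (elim N)
    interpret bessel_weight "scal_a c N" "scal_b c N" \<nu> by (rule scal_weight[OF \<nu>]) (use elim in simp)
    have k: "scal_kappa c N = kappa" by (simp add: kappa_def scal_kappa_def)
    have \<beta>N: "\<beta> N = beta (scal_rho c l N) \<theta>" by (simp add: \<beta>_def beta_def Q_def k)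
    have \<beta>p: "\<beta> N > 0" and \<beta>2: "(\<beta> N)\<^sup>2 = 1 - (2 * kappa * Q N / scal_a c N)\<^sup>2"
      using beta_pos[OF elim(1), of \<theta>] by (simp_all add: \<beta>N Q_def)
    have P: "circP (scal_rho c l N) \<theta> = - 1 / 2 + (1 - (scal_rho c l N)\<^sup>2) / (2 * D N)"
      unfolding D_def by (rule circP_eq) (use elim in auto)
    have "scal_a c N * (1 - \<beta> N) * (1 + \<beta> N) = scal_a c N * (1 - (\<beta> N)\<^sup>2)"
      by (simp add: power2_eq_square algebra_simps)
    also have "\<dots> = 4 * (kappa\<^sup>2 / scal_a c N) * (Q N)\<^sup>2"
      using a_pos unfolding \<beta>2 by (simp add: power_divide power_mult_distrib) (simp add: power2_eq_square)
    finally have f: "scal_a c N * (1 - \<beta> N) * (1 + \<beta> N) = 4 * (kappa\<^sup>2 / scal_a c N) * (Q N)\<^sup>2" .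
    have e1: "scal_a c N * (1 - \<beta> N) = 4 * (kappa\<^sup>2 / scal_a c N) * (Q N)\<^sup>2 / (1 + \<beta> N)"
      unfolding f[symmetric] using \<beta>p by simp
    have e2: "E N = kappa - real N - kappa * (1 - (scal_rho c l N)\<^sup>2) / D N + scal_a c N * (1 - \<beta> N)"
      unfolding E_def k e1 ..
    have e3: "2 * kappa * circP (scal_rho c l N) \<theta> = - kappa + kappa * (1 - (scal_rho c l N)\<^sup>2) / D N"
    proof -
      have "2 * k * (- 1 / 2 + y / (2 * d)) = - k + k * y / d" for k y d :: real
        by (cases "d = 0") (simp_all add: field_simps)
      thus ?thesis unfolding P .
    qed
    have "scal_b c N = scal_a c N - real N" by (simp add: scal_a_def scal_b_def)
    hence "scal_b c N - 2 * kappa * circP (scal_rho c l N) \<theta> - scal_a c N * \<beta> N = E N"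
      unfolding e2 e3 by (simp add: right_diff_distrib)
    thus ?case
      unfolding line_density_def \<beta>N[symmetric] D_def[symmetric] by simp
  qed
  ultimately have "(\<lambda>N. bessel_weight.line_density (scal_a c N) (scal_b c N) \<nu> (scal_rho c l N) x \<theta>) \<longlonglongrightarrow>
     (D0 * 1) powr (- (\<nu> + 1)) * exp (x * (- l / D0)) * sqrt (2 * pi)"
    by (rule Lim_transform_eventually)
  thus ?thesis by (simp add: D0_def mult_ac)
qed

text \<open>A constant majorant for dominated convergence. Close to \<open>\<theta> = 0\<close> the power of \<open>circD\<close> is singular, and the
  exponential decay in \<open>1 / circD\<close> compensates it.\<close>

lemma line_density_bounded:
  fixes x \<nu> :: real
  assumes \<nu>: "\<nu> > -1" and x: "x > 0"
  obtains B where "\<forall>\<^sub>F N in sequentially. \<forall>\<theta>.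
      0 \<le> bessel_weight.line_density (scal_a c N) (scal_b c N) \<nu> (scal_rho c l N) x \<theta> \<and>
      bessel_weight.line_density (scal_a c N) (scal_b c N) \<nu> (scal_rho c l N) x \<theta> \<le> B"
proof -
  define r where "r = 2 * c\<^sup>2 / (2 * c\<^sup>2 + l)"
  have r: "0 < r" "r < 1" using c l by (auto simp: r_def add_pos_pos)
  define m2 where "m2 N = 1 - (2 * scal_kappa c N * (scal_rho c l N / (1 - (scal_rho c l N)\<^sup>2)) / scal_a c N)\<^sup>2" for N
  define G where "G N = m2 N / 4 * (scal_kappa c N * (1 - (scal_rho c l N)\<^sup>2))" for N
  define W where "W N = 2 * scal_kappa c N * scal_rho c l N / (1 + scal_rho c l N) - real N" for N
  have m2: "m2 \<longlonglongrightarrow> 1 - r\<^sup>2"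
    unfolding m2_def[abs_def] r_def by (intro tendsto_intros scal_ratio)
  have r2: "1 - r\<^sup>2 > 0" using r by (simp add: power_less_one_iff)
  have G: "G \<longlonglongrightarrow> (1 - r\<^sup>2) / 4 * (2 * c\<^sup>2 + l)"
    unfolding G_def[abs_def] by (intro tendsto_intros m2 scal_kappa_rho2) simp
  define g where "g = (1 - r\<^sup>2) / 4 * (2 * c\<^sup>2 + l)"
  have g: "g > 0" using r2 c l by (auto simp: g_def intro!: mult_pos_pos add_pos_pos)
  define \<beta>0 where "\<beta>0 = sqrt ((1 - r\<^sup>2) / 2)"
  have \<beta>0: "\<beta>0 > 0" using r2 by (simp add: \<beta>0_def)
  define M where "M = exp ((\<nu> + 1) * ln ((\<nu> + 1) / (x * g / 2)) - (\<nu> + 1))"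
  define B where "B = (\<beta>0 powr (- (\<nu> + 1)) * M) * exp (x * (1 + 2 * g)) * bessel_scaled_bound (\<nu> + 1 / 2)"
  have ev: "\<forall>\<^sub>F N in sequentially. m2 N > (1 - r\<^sup>2) / 2" "\<forall>\<^sub>F N in sequentially. G N > g / 2"
     "\<forall>\<^sub>F N in sequentially. G N < 2 * g" "\<forall>\<^sub>F N in sequentially. W N < 1"
     "\<forall>\<^sub>F N in sequentially. scal_a c N > 1 / (x * \<beta>0)"
  proof -
    show "\<forall>\<^sub>F N in sequentially. m2 N > (1 - r\<^sup>2) / 2" using r2 by (intro order_tendstoD(1)[OF m2]) simp
    show "\<forall>\<^sub>F N in sequentially. G N > g / 2"
      by (rule order_tendstoD(1)[OF G[folded g_def]]) (use g in simp)
    show "\<forall>\<^sub>F N in sequentially. G N < 2 * g"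
      by (rule order_tendstoD(2)[OF G[folded g_def]]) (use g in simp)
    show "\<forall>\<^sub>F N in sequentially. W N < 1"
      unfolding W_def using l by (intro order_tendstoD(2)[OF scal_kappa_rho3]) simp
    show "\<forall>\<^sub>F N in sequentially. scal_a c N > 1 / (x * \<beta>0)"
      using scal_a_inf by (simp add: filterlim_at_top_dense)
  qed
  have "\<forall>\<^sub>F N in sequentially. \<forall>\<theta>.
      0 \<le> bessel_weight.line_density (scal_a c N) (scal_b c N) \<nu> (scal_rho c l N) x \<theta> \<and>
      bessel_weight.line_density (scal_a c N) (scal_b c N) \<nu> (scal_rho c l N) x \<theta> \<le> B"
    using scal_admissible[OF \<nu>] scal_rho_bounds eventually_N_gt[of "c\<^sup>2"] ev
  proof eventually_elim
    case (elim N)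
    interpret bessel_weight "scal_a c N" "scal_b c N" \<nu> by (rule scal_weight[OF \<nu>]) (use elim in simp)
    have k: "scal_kappa c N = kappa" by (simp add: kappa_def scal_kappa_def)
    define \<rho> where "\<rho> = scal_rho c l N"
    have \<rho>: "0 < \<rho>" "\<rho> < 1" using elim by (auto simp: \<rho>_def)
    have adm: "admissible \<rho>" using elim by (simp add: \<rho>_def)
    show ?case
    proof (intro allI)
      fix \<theta> :: real
      have D: "circD \<rho> \<theta> > 0" by (rule circD_pos[OF \<rho>])
      have b: "beta \<rho> \<theta> > 0" by (rule beta_pos(1)[OF adm])
      have "\<beta>0\<^sup>2 \<le> (beta \<rho> \<theta>)\<^sup>2"
        using beta_square_ge(1)[OF adm, of \<theta>] beta_pos(2)[OF adm, of \<theta>] elim(4) r2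
        by (simp add: \<beta>0_def m2_def k \<rho>_def)
      hence b0: "\<beta>0 \<le> beta \<rho> \<theta>" using b by (intro power2_le_imp_le[of \<beta>0]) auto
      have X1: "scal_a c N * x * beta \<rho> \<theta> \<ge> 1"
      proof -
        have "1 \<le> scal_a c N * x * \<beta>0" using elim(8) x \<beta>0 by (simp add: divide_less_eq mult_ac)
        also have "\<dots> \<le> scal_a c N * x * beta \<rho> \<theta>" using b0 x a_pos by (intro mult_left_mono) auto
        finally show ?thesis .
      qed
      have ld: "line_density \<rho> x \<theta> = (circD \<rho> \<theta> * beta \<rho> \<theta>) powr (- (\<nu> + 1)) *
         exp (x * (scal_b c N - 2 * kappa * circP \<rho> \<theta> - scal_a c N * beta \<rho> \<theta>)) * bessel_scaled (\<nu> + 1 / 2) (scal_a c N * x * beta \<rho> \<theta>)"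
        by (simp add: line_density_def)
      have bs0: "0 \<le> bessel_scaled (\<nu> + 1 / 2) (scal_a c N * x * beta \<rho> \<theta>)"
        using X1 by (intro bessel_scaled_nonneg) simp
      have bs1: "bessel_scaled (\<nu> + 1 / 2) (scal_a c N * x * beta \<rho> \<theta>) \<le> bessel_scaled_bound (\<nu> + 1 / 2)"
        using X1 by (rule bessel_scaled_le_bound)
      have "scal_b c N - 2 * kappa * circP \<rho> \<theta> - scal_a c N * beta \<rho> \<theta> \<le>
          W N - G N * (1 / circD \<rho> \<theta> - 1 / (1 + \<rho>)\<^sup>2)"
        using exponent_bound[OF adm, of \<theta>]
        by (simp add: W_def G_def m2_def k \<rho>_def scal_a_def scal_b_def mult.assoc)
      also have "\<dots> = W N - G N * (1 / circD \<rho> \<theta>) + G N * (1 / (1 + \<rho>)\<^sup>2)"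
        by (simp add: right_diff_distrib)
      also have "\<dots> \<le> 1 - g / 2 * (1 / circD \<rho> \<theta>) + 2 * g * 1"
      proof (intro add_mono diff_mono mult_mono)
        have "1 \<le> (1 + \<rho>)\<^sup>2" using \<rho> by (simp add: one_le_power)
        thus "1 / (1 + \<rho>)\<^sup>2 \<le> 1" by (simp add: divide_le_eq_1)
      qed (use elim g D in auto)
      finally have ex: "x * (scal_b c N - 2 * kappa * circP \<rho> \<theta> - scal_a c N * beta \<rho> \<theta>) \<le>
          x * (1 - g / 2 * (1 / circD \<rho> \<theta>) + 2 * g * 1)"
        using x by (intro mult_left_mono) auto
      have "(circD \<rho> \<theta> * beta \<rho> \<theta>) powr (- (\<nu> + 1)) * exp (x * (scal_b c N - 2 * kappa * circP \<rho> \<theta> - scal_a c N * beta \<rho> \<theta>)) \<le>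
          (circD \<rho> \<theta> * \<beta>0) powr (- (\<nu> + 1)) * exp (x * (1 - g / 2 * (1 / circD \<rho> \<theta>) + 2 * g * 1))"
        using ex D \<beta>0 b0 \<nu> by (intro mult_mono powr_mono2') (auto intro!: mult_left_mono)
      also have "\<dots> = \<beta>0 powr (- (\<nu> + 1)) * ((1 / circD \<rho> \<theta>) powr (\<nu> + 1) * exp (- (x * g / 2 * (1 / circD \<rho> \<theta>)))) * exp (x * (1 + 2 * g))"
      proof -
        have "exp (x * (1 - g / 2 * (1 / circD \<rho> \<theta>) + 2 * g * 1)) = exp (- (x * g / 2 * (1 / circD \<rho> \<theta>))) * exp (x * (1 + 2 * g))"
          unfolding exp_add[symmetric] by (simp add: algebra_simps)
        moreover have "(circD \<rho> \<theta> * \<beta>0) powr (- (\<nu> + 1)) = (1 / circD \<rho> \<theta>) powr (\<nu> + 1) * \<beta>0 powr (- (\<nu> + 1))"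
        proof -
          have "circD \<rho> \<theta> powr (- (\<nu> + 1)) = (1 / circD \<rho> \<theta>) powr (\<nu> + 1)"
            unfolding powr_minus_divide using D by (simp add: powr_divide)
          moreover have "(circD \<rho> \<theta> * \<beta>0) powr q = circD \<rho> \<theta> powr q * \<beta>0 powr q" for q
            using D \<beta>0 by (simp add: powr_mult)
          ultimately show ?thesis by (simp only:)
        qed
        ultimately show ?thesis by (simp only: mult_ac)
      qed
      also have "\<dots> \<le> \<beta>0 powr (- (\<nu> + 1)) * M * exp (x * (1 + 2 * g))"
      proof (intro mult_right_mono mult_left_mono)
        show "(1 / circD \<rho> \<theta>) powr (\<nu> + 1) * exp (- (x * g / 2 * (1 / circD \<rho> \<theta>))) \<le> M"
          unfolding M_def by (rule powr_exp_bound) (use \<nu> x g D in auto)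
      qed auto
      finally have less: "(circD \<rho> \<theta> * beta \<rho> \<theta>) powr (- (\<nu> + 1)) * exp (x * (scal_b c N - 2 * kappa * circP \<rho> \<theta> - scal_a c N * beta \<rho> \<theta>)) \<le>
          \<beta>0 powr (- (\<nu> + 1)) * M * exp (x * (1 + 2 * g))" .
      have "line_density \<rho> x \<theta> \<le> B"
        unfolding ld B_def by (rule mult_mono[OF less bs1 _ bs0]) (simp add: M_def)
      thus "0 \<le> line_density (scal_rho c l N) x \<theta> \<and> line_density (scal_rho c l N) x \<theta> \<le> B"
        using bs0 unfolding \<rho>_def[symmetric] ld by simp
    qed
  qed
  thus thesis by (rule that)
qed

end

end

section \<open>The limit of the Abel sums\<close>

abbreviation circle_measure :: "real measure" where
  "circle_measure \<equiv> restrict_space lborel {0..2 * pi}"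

lemma finite_measure_circle: "finite_measure circle_measure"
  by (rule finite_measureI) (simp add: emeasure_restrict_space)

lemma measurable_circleI [measurable (raw)]:
  "f \<in> borel_measurable borel \<Longrightarrow> f \<in> borel_measurable circle_measure"
  by (rule measurable_restrict_space1) simp

lemma AE_circle_cos_neq: "AE \<theta> in circle_measure. cos \<theta> \<noteq> r"
proof -
  have "{\<theta> \<in> {0..2 * pi}. cos \<theta> = r} \<subseteq> {arccos r, 2 * pi - arccos r}"
  proof
    fix \<theta> :: real assume "\<theta> \<in> {\<theta> \<in> {0..2 * pi}. cos \<theta> = r}"
    hence \<theta>: "0 \<le> \<theta>" "\<theta> \<le> 2 * pi" "r = cos \<theta>" by auto
    show "\<theta> \<in> {arccos r, 2 * pi - arccos r}"
    proof (cases "\<theta> \<le> pi")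
      case True
      thus ?thesis using \<theta> by (simp add: arccos_cos)
    next
      case False
      hence "arccos (cos (2 * pi - \<theta>)) = 2 * pi - \<theta>" using \<theta> by (intro arccos_cos) auto
      moreover have "cos (2 * pi - \<theta>) = cos \<theta>" by (simp add: cos_diff)
      ultimately show ?thesis using \<theta> by simp
    qed
  qed
  hence "finite {\<theta> \<in> {0..2 * pi}. cos \<theta> = r}" by (rule finite_subset) simp
  hence "AE \<theta> in lborel. \<theta> \<notin> {\<theta> \<in> {0..2 * pi}. cos \<theta> = r}"
    by (intro AE_not_in finite_imp_null_set_lborel)
  hence "AE \<theta> in lborel. \<theta> \<in> {0..2 * pi} \<longrightarrow> cos \<theta> \<noteq> r"
    by eventually_elim auto
  thus ?thesis by (subst AE_restrict_space_iff) auto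
qed

text \<open>The limit of \<open>circD \<rho>\<close> as \<open>\<rho>\<close> tends to \<open>1\<close>, the squared chord \<open>|1 - exp (i \<theta>)|\<^sup>2\<close>.\<close>

definition chord :: "real \<Rightarrow> real" where "chord \<theta> = 2 - 2 * cos \<theta>"

lemma chord_nonneg: "chord \<theta> \<ge> 0" and chord_le: "chord \<theta> \<le> 4"
  unfolding chord_def using cos_le_one[of \<theta>] cos_ge_minus_one[of \<theta>] by linarith+

lemma borel_measurable_chord [measurable]: "chord \<in> borel_measurable borel"
  unfolding chord_def[abs_def] by measurable

lemma AE_chord_pos: "AE \<theta> in circle_measure. chord \<theta> > 0"
  using AE_circle_cos_neq[of 1]
proof eventually_elim
  case (elim \<theta>)
  thus ?case using chord_nonneg[of \<theta>] by (simp add: chord_def less_le)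
qed

text \<open>Where the chord vanishes the value is \<open>0\<close> by the convention for powers of zero.\<close>

definition circle_weight :: "real \<Rightarrow> real \<Rightarrow> real \<Rightarrow> real" where
  "circle_weight \<nu> q \<theta> = chord \<theta> powr (- (\<nu> + 1)) * exp (- q / chord \<theta>)"

lemma borel_measurable_circle_weight [measurable]: "circle_weight \<nu> q \<in> borel_measurable borel"
  unfolding circle_weight_def[abs_def] by measurable

lemma circle_weight_nonneg: "circle_weight \<nu> q \<theta> \<ge> 0"
  by (simp add: circle_weight_def)

lemma integrable_circle_weight:
  assumes \<nu>: "\<nu> > -1" and q: "q > 0"
  shows "integrable circle_measure (circle_weight \<nu> q)"
proof -
  interpret finite_measure circle_measure by (rule finite_measure_circle)
  show ?thesis
  proof (rule integrable_const_bound)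
    show "AE \<theta> in circle_measure. norm (circle_weight \<nu> q \<theta>) \<le> exp ((\<nu> + 1) * ln ((\<nu> + 1) / q) - (\<nu> + 1))"
    proof (intro AE_I2)
      fix \<theta> :: real
      show "norm (circle_weight \<nu> q \<theta>) \<le> exp ((\<nu> + 1) * ln ((\<nu> + 1) / q) - (\<nu> + 1))"
      proof (cases "chord \<theta> = 0")
        case False
        hence D: "chord \<theta> > 0" using chord_nonneg[of \<theta>] by simp
        have "chord \<theta> powr (- (\<nu> + 1)) = (1 / chord \<theta>) powr (\<nu> + 1)"
          unfolding powr_minus_divide using D by (simp add: powr_divide)
        hence "circle_weight \<nu> q \<theta> = (1 / chord \<theta>) powr (\<nu> + 1) * exp (- (q * (1 / chord \<theta>)))"
          by (simp add: circle_weight_def)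
        also have "\<dots> \<le> exp ((\<nu> + 1) * ln ((\<nu> + 1) / q) - (\<nu> + 1))"
          by (rule powr_exp_bound) (use \<nu> q D in auto)
        finally show ?thesis using circle_weight_nonneg[of \<nu> q \<theta>] by simp
      qed (simp add: circle_weight_def)
    qed
  qed measurable
qed

context bessel_weight
begin

definition line_mass :: "nat \<Rightarrow> real \<Rightarrow> real" where
  "line_mass n x = (LINT y|lborel. (cmod (lag n (Complex x y)))\<^sup>2 * weight (Complex x y))"

definition abel_const :: "real \<Rightarrow> real" where
  "abel_const x = sqrt (2 * pi) / a * (a * x / 2) powr \<nu> / (2 * pi)"

lemma measurable_Complex_line [measurable]: "(\<lambda>y. Complex x y) \<in> borel_measurable borel"
  using measurable_compose[OF measurable_Pair[OF measurable_const measurable_ident_sets] measurable_Complex, of x] by simp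

text \<open>Since all terms are non-negative, finiteness of the Abel sum also gives finiteness of each line integral.\<close>

lemma line_mass_sums:
  assumes x: "x > 0" and adm: "admissible \<rho>" 
    and B: "\<And>\<theta>. 0 \<le> line_density \<rho> x \<theta>" "\<And>\<theta>. line_density \<rho> x \<theta> \<le> B"
  shows "(\<lambda>n. \<rho> ^ (2 * n) * line_mass n x) sums (abel_const x * (LINT \<theta>|circle_measure. line_density \<rho> x \<theta>))"
    and "integrable lborel (\<lambda>y. (cmod (lag n (Complex x y)))\<^sup>2 * weight (Complex x y))"
proof -
  interpret finite_measure circle_measure by (rule finite_measure_circle)
  have \<rho>: "0 < \<rho>" using adm by (simp add: admissible_def)
  define g where "g n y = (cmod (lag n (Complex x y)))\<^sup>2 * weight (Complex x y)" for n y
  have [measurable]: "g n \<in> borel_measurable borel" for n unfolding g_def[abs_def] by measurable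
  have g0: "g n y \<ge> 0" for n y by (simp add: g_def)
  have ld: "integrable circle_measure (line_density \<rho> x)"
    by (rule integrable_const_bound[of _ B]) (use B in auto)
  have c0: "abel_const x \<ge> 0" using a_pos by (simp add: abel_const_def)
  define S where "S = abel_const x * (LINT \<theta>|circle_measure. line_density \<rho> x \<theta>)"
  have S0: "S \<ge> 0" using c0 B by (simp add: S_def)
  have "(\<Sum>n. ennreal (\<rho> ^ (2 * n)) * (\<integral>\<^sup>+ y. ennreal (g n y) \<partial>lborel)) =
      (\<Sum>n. \<integral>\<^sup>+ y. ennreal (\<rho> ^ (2 * n)) * ennreal (g n y) \<partial>lborel)"
    by (intro suminf_cong nn_integral_cmult[symmetric]) measurable
  also have "\<dots> = (\<integral>\<^sup>+ y. (\<Sum>n. ennreal (\<rho> ^ (2 * n)) * ennreal (g n y)) \<partial>lborel)"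
    by (rule nn_integral_suminf[symmetric]) measurable
  also have "\<dots> = (\<integral>\<^sup>+ y. (\<Sum>n. ennreal (\<rho> ^ (2 * n) * (cmod (lag n (Complex x y)))\<^sup>2 * weight (Complex x y))) \<partial>lborel)"
    using \<rho> by (simp add: g_def ennreal_mult[symmetric] mult.assoc)
  also have "\<dots> = ennreal (abel_const x) * (\<integral>\<^sup>+ \<theta>. ennreal (line_density \<rho> x \<theta>) \<partial>circle_measure)"
    unfolding abel_const_def by (rule abel_sum_on_line[OF x adm])
  also have "\<dots> = ennreal S"
    using c0 B by (simp add: S_def nn_integral_eq_integral[OF ld] ennreal_mult)
  finally have total: "(\<Sum>n. ennreal (\<rho> ^ (2 * n)) * (\<integral>\<^sup>+ y. ennreal (g n y) \<partial>lborel)) = ennreal S" .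
  have fin: "(\<integral>\<^sup>+ y. ennreal (g n y) \<partial>lborel) < \<infinity>" for n
  proof (rule ccontr)
    assume "\<not> ?thesis"
    hence "(\<integral>\<^sup>+ y. ennreal (g n y) \<partial>lborel) = \<top>" by (simp add: less_top[symmetric])
    hence "ennreal (\<rho> ^ (2 * n)) * (\<integral>\<^sup>+ y. ennreal (g n y) \<partial>lborel) = \<top>"
      using \<rho> by (simp add: ennreal_mult_top)
    moreover have "ennreal (\<rho> ^ (2 * n)) * (\<integral>\<^sup>+ y. ennreal (g n y) \<partial>lborel) \<le> ennreal S"
      unfolding total[symmetric] using sum_le_suminf[of "\<lambda>n. ennreal (\<rho> ^ (2 * n)) * (\<integral>\<^sup>+ y. ennreal (g n y) \<partial>lborel)" "{n}"]
      by simp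
    ultimately show False by (simp add: top_unique)
  qed
  have gint: "integrable lborel (g n)" for n
    by (rule integrableI_nonneg) (use fin[of n] g0 in auto)
  thus "integrable lborel (\<lambda>y. (cmod (lag n (Complex x y)))\<^sup>2 * weight (Complex x y))"
    by (simp add: g_def[abs_def])
  have lm: "(\<integral>\<^sup>+ y. ennreal (g n y) \<partial>lborel) = ennreal (line_mass n x)" for n
  proof -
    have "line_mass n x = (LINT y|lborel. g n y)" by (simp only: line_mass_def g_def)
    thus ?thesis using nn_integral_eq_integral[OF gint] g0 by simp
  qed
  have lm0: "line_mass n x \<ge> 0" for n by (simp add: line_mass_def)
  have "(\<Sum>n. ennreal (\<rho> ^ (2 * n) * line_mass n x)) = ennreal S"
    using total \<rho> unfolding lm by (simp add: ennreal_mult[symmetric] lm0)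
  hence "(\<lambda>n. ennreal (\<rho> ^ (2 * n) * line_mass n x)) sums ennreal S"
    by (metis summable_sums summableI)
  thus "(\<lambda>n. \<rho> ^ (2 * n) * line_mass n x) sums (abel_const x * (LINT \<theta>|circle_measure. line_density \<rho> x \<theta>))"
    unfolding S_def[symmetric] using \<rho> lm0 S0 by (subst (asm) sums_ennreal) auto
qed

lemma line_mass_nonneg: "line_mass n x \<ge> 0"
  by (simp add: line_mass_def)

definition norm_const :: real where
  "norm_const = 4 / a\<^sup>2 * Gamma (\<nu> + 1) * (1 - tau\<^sup>2) powr (- (\<nu> + 1))"

lemma norm_const_pos: "norm_const > 0"
proof -
  have "tau\<^sup>2 < 1" using tau_pos tau_less by (simp add: power_less_one_iff)
  thus ?thesis
    unfolding norm_const_def using a_pos nu by (intro mult_pos_pos divide_pos_pos Gamma_real_pos) auto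
qed

lemma lag_norm_eq: "lag_norm n = norm_const * (pochhammer (\<nu> + 1) n / fact n) / tau ^ (2 * n)"
  by (simp add: lag_norm_def norm_const_def)

end

text \<open>\<open>\<Gamma>(n + \<nu> + 1) / (n! \<Gamma>(\<nu> + 1))\<close>, the factor of the squared norm that grows like \<open>n powr \<nu>\<close>.\<close>

definition lag_ratio :: "real \<Rightarrow> nat \<Rightarrow> real" where
  "lag_ratio \<nu> n = pochhammer (\<nu> + 1) n / fact n"

lemma lag_ratio_pos: "\<nu> > -1 \<Longrightarrow> lag_ratio \<nu> n > 0"
  unfolding lag_ratio_def by (intro divide_pos_pos pochhammer_pos) auto

text \<open>Euler's limit formula for the Gamma function.\<close>

lemma lag_ratio_asymp:
  assumes \<nu>: "\<nu> > -1"
  shows "(\<lambda>n. real n powr \<nu> / lag_ratio \<nu> n) \<longlonglongrightarrow> Gamma (\<nu> + 1)"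
proof -
  have G: "Gamma_series (\<nu> + 1) \<longlonglongrightarrow> Gamma (\<nu> + 1)" by (rule Gamma_series_LIMSEQ)
  have "(\<lambda>n. (\<nu> + 1 + real n) / real n) \<longlonglongrightarrow> 1" by real_asymp
  from tendsto_mult[OF G this]
  have "(\<lambda>n. Gamma_series (\<nu> + 1) n * ((\<nu> + 1 + real n) / real n)) \<longlonglongrightarrow> Gamma (\<nu> + 1)" by simp
  moreover have "\<forall>\<^sub>F n in sequentially. Gamma_series (\<nu> + 1) n * ((\<nu> + 1 + real n) / real n) = real n powr \<nu> / lag_ratio \<nu> n"
    using eventually_gt_at_top[of 0]
  proof eventually_elim
    case (elim n)
    have "\<nu> + 1 + real n > 0" using \<nu> by simp
    moreover have "exp ((\<nu> + 1) * ln (real n)) = real n powr \<nu> * real n"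
      using elim by (simp add: powr_def exp_add[symmetric] algebra_simps) (simp add: exp_add)
    moreover have "pochhammer (\<nu> + 1) n > 0" using \<nu> by (intro pochhammer_pos) simp
    moreover have "f * (r * k) / (p * m) * (m / k) = r / (p / f)"
      if "m > 0" "p > 0" "k > 0" for f r k p m :: real
      using that by (simp add: field_simps)
    ultimately show ?case
      using elim by (simp add: Gamma_series_def lag_ratio_def pochhammer_Suc)
  qed
  ultimately show ?thesis by (rule Lim_transform_eventually)
qed

lemma lag_ratio_inverse_bound:
  assumes \<nu>: "\<nu> > -1"
  obtains B where "B > 0" "\<And>n. 1 / lag_ratio \<nu> n \<le> B * real (n + 1) powr \<bar>\<nu>\<bar>"
proof -
  have "Bseq (\<lambda>n. real n powr \<nu> / lag_ratio \<nu> n)"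
    using lag_ratio_asymp[OF \<nu>] by (intro convergent_imp_Bseq convergentI)
  then obtain K where K: "K > 0" "\<And>n. norm (real n powr \<nu> / lag_ratio \<nu> n) \<le> K"
    by (auto simp: Bseq_def)
  show ?thesis
  proof (rule that[of "max K 1"])
    show "max K 1 > 0" by simp
    show "1 / lag_ratio \<nu> n \<le> max K 1 * real (n + 1) powr \<bar>\<nu>\<bar>" for n
    proof (cases "n = 0")
      case True
      thus ?thesis by (simp add: lag_ratio_def)
    next
      case False
      have "1 / lag_ratio \<nu> n = (real n powr \<nu> / lag_ratio \<nu> n) * real n powr (- \<nu>)"
        using False by (simp add: powr_minus)
      also have "\<dots> \<le> K * real n powr (- \<nu>)"
        using K(2)[of n] lag_ratio_pos[OF \<nu>, of n] by (intro mult_right_mono) auto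
      also have "\<dots> \<le> max K 1 * real (n + 1) powr \<bar>\<nu>\<bar>"
      proof (intro mult_mono)
        have "real n powr (- \<nu>) \<le> real n powr \<bar>\<nu>\<bar>"
          using False by (intro powr_mono) auto
        also have "\<dots> \<le> real (n + 1) powr \<bar>\<nu>\<bar>" by (intro powr_mono2) auto
        finally show "real n powr (- \<nu>) \<le> real (n + 1) powr \<bar>\<nu>\<bar>" .
      qed auto
      finally show ?thesis .
    qed
  qed
qed

context
  fixes c \<nu> x :: real
  assumes c: "c > 0" and \<nu>: "\<nu> > -1" and x: "x > 0"
begin

text \<open>The contribution of the \<open>n\<close>-th orthonormal density to the cross-section at \<open>x\<close>.\<close>

definition scal_mass :: "nat \<Rightarrow> nat \<Rightarrow> real" where
  "scal_mass N n = bessel_weight.line_mass (scal_a c N) (scal_b c N) \<nu> n x /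
     (real N * bessel_weight.lag_norm (scal_a c N) (scal_b c N) \<nu> n)"

text \<open>The factor \<open>lag_ratio\<close> cancels the Gamma quotient in the norms, so that these masses have an explicit Abel
  sum; the power of \<open>N\<close> keeps them bounded.\<close>

definition scal_atom :: "nat \<Rightarrow> nat \<Rightarrow> real" where
  "scal_atom N n = lag_ratio \<nu> n / real N powr \<nu> * scal_mass N n"

text \<open>The constant in front of the integral of the line density, after division by the norms.\<close>

definition scal_const :: "nat \<Rightarrow> real" where
  "scal_const N = sqrt (2 * pi) / (8 * pi * Gamma (\<nu> + 1)) * (x / 2) powr \<nu> *
     (scal_a c N * (1 - (scal_b c N / scal_a c N)\<^sup>2) / real N) powr (\<nu> + 1)"

lemma scal_mass_eq:
  assumes "real N > 0"
  shows "scal_mass N n = scal_atom N n * real N powr \<nu> * (1 / lag_ratio \<nu> n)"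
  using assms lag_ratio_pos[OF \<nu>, of n] by (simp add: scal_atom_def)

lemma scal_const_nonneg: "scal_const N \<ge> 0"
  using \<nu> by (auto simp: scal_const_def intro!: mult_nonneg_nonneg divide_nonneg_nonneg Gamma_real_nonneg)

lemma scal_const_tendsto: "scal_const \<longlonglongrightarrow> sqrt (2 * pi) / (8 * pi * Gamma (\<nu> + 1)) * (x / 2) powr \<nu> * 2 powr (\<nu> + 1)"
  unfolding scal_const_def[abs_def] by (intro tendsto_intros scal_tau_a[OF c]) simp

text \<open>All powers of \<open>N\<close> combine to powers of \<open>a (1 - tau\<^sup>2) / N\<close>, which tends to \<open>2\<close>.\<close>

lemma scal_const_eq:
  assumes N: "real N > c\<^sup>2"
  shows "bessel_weight.abel_const (scal_a c N) \<nu> x / (real N * real N powr \<nu> * bessel_weight.norm_const (scal_a c N) (scal_b c N) \<nu>) = scal_const N"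
proof -
  interpret bessel_weight "scal_a c N" "scal_b c N" \<nu> by (rule scal_weight[OF c \<nu> N])
  have N0: "real N > 0" using N zero_le_power2[of c] by linarith
  define A where "A = scal_a c N"
  define t where "t = 1 - tau\<^sup>2"
  have A: "A > 0" using a_pos by (simp add: A_def)
  have t: "t > 0" using tau_pos tau_less by (simp add: t_def power_less_one_iff)
  have G: "Gamma (\<nu> + 1) > 0" using \<nu> by (intro Gamma_real_pos) simp
  have "abel_const x / (real N * real N powr \<nu> * norm_const) =
     (sqrt (2 * pi) / A * (A powr \<nu> * (x / 2) powr \<nu>) / (2 * pi)) / (real N powr (\<nu> + 1) * (4 / A\<^sup>2 * Gamma (\<nu> + 1) * (1 / t powr (\<nu> + 1))))"
  proof -
    have "(A * x / 2) powr \<nu> = A powr \<nu> * (x / 2) powr \<nu>"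
      using A x by (simp add: powr_mult[symmetric])
    moreover have "real N * real N powr \<nu> = real N powr (\<nu> + 1)"
      using N0 by (simp add: powr_add)
    moreover have "t powr (- (\<nu> + 1)) = 1 / t powr (\<nu> + 1)" by (rule powr_minus_divide)
    ultimately show ?thesis
      unfolding abel_const_def norm_const_def unfolding t_def[symmetric] unfolding A_def[symmetric]
      by (simp only:)
  qed
  also have "\<dots> = sqrt (2 * pi) / (8 * pi * Gamma (\<nu> + 1)) * (x / 2) powr \<nu> * ((A powr \<nu> * A) * t powr (\<nu> + 1) / real N powr (\<nu> + 1))"
    using A t N0 G by (simp add: field_simps power2_eq_square)
  also have "(A powr \<nu> * A) * t powr (\<nu> + 1) / real N powr (\<nu> + 1) = (A * t / real N) powr (\<nu> + 1)"
    using A t N0 by (simp add: powr_divide powr_mult powr_add)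
  finally show ?thesis
    by (simp add: scal_const_def A_def t_def tau_def)
qed

lemma scal_atom_sums:
  fixes \<rho> B :: real
  assumes N: "real N > c\<^sup>2"
    and adm: "bessel_weight.admissible (scal_a c N) (scal_b c N) \<rho>"
    and B: "\<And>\<theta>. 0 \<le> bessel_weight.line_density (scal_a c N) (scal_b c N) \<nu> \<rho> x \<theta>"
           "\<And>\<theta>. bessel_weight.line_density (scal_a c N) (scal_b c N) \<nu> \<rho> x \<theta> \<le> B"
  shows "(\<lambda>n. scal_atom N n * (\<rho> / (1 - c\<^sup>2 / real N)) ^ (2 * n)) sums
     (scal_const N * (LINT \<theta>|circle_measure. bessel_weight.line_density (scal_a c N) (scal_b c N) \<nu> \<rho> x \<theta>))"
proof -
  interpret bessel_weight "scal_a c N" "scal_b c N" \<nu> by (rule scal_weight[OF c \<nu> N])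
  have N0: "real N > 0" using N zero_le_power2[of c] by linarith
  have tau: "tau = 1 - c\<^sup>2 / real N"
    unfolding tau_def using N0 c by (simp add: scal_a_def scal_b_def field_simps power2_eq_square)
  define K where "K = real N * real N powr \<nu> * norm_const"
  have K: "K > 0" using N0 norm_const_pos by (simp add: K_def)
  have ln: "lag_norm n = norm_const * lag_ratio \<nu> n / tau ^ (2 * n)" for n
    by (simp only: lag_norm_eq lag_ratio_def)
  have "scal_atom N n * (\<rho> / tau) ^ (2 * n) = (\<rho> ^ (2 * n) * line_mass n x) / K" for n
    using N0 tau_pos norm_const_pos lag_ratio_pos[OF \<nu>, of n]
    by (simp add: scal_atom_def scal_mass_def ln K_def power_divide field_simps)
  moreover have "abel_const x * (LINT \<theta>|circle_measure. line_density \<rho> x \<theta>) / K =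
      scal_const N * (LINT \<theta>|circle_measure. line_density \<rho> x \<theta>)"
    unfolding scal_const_eq[OF N, symmetric] K_def by simp
  ultimately show ?thesis
    using sums_divide[OF line_mass_sums(1)[OF x adm B], of K] unfolding tau[symmetric] by (simp only:)
qed

lemma scal_atom_nonneg: "real N > c\<^sup>2 \<Longrightarrow> scal_mass N n \<ge> 0" "real N > c\<^sup>2 \<Longrightarrow> scal_atom N n \<ge> 0"
proof -
  assume N: "real N > c\<^sup>2"
  interpret bessel_weight "scal_a c N" "scal_b c N" \<nu> by (rule scal_weight[OF c \<nu> N])
  show "scal_mass N n \<ge> 0"
    unfolding scal_mass_def using line_mass_nonneg lag_norm_pos[of n] by (intro divide_nonneg_nonneg mult_nonneg_nonneg) auto
  thus "scal_atom N n \<ge> 0"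
    using lag_ratio_pos[OF \<nu>, of n] by (simp add: scal_atom_def)
qed

text \<open>The Laplace transforms of the masses at the points \<open>n / N\<close>.\<close>

lemma scal_atom_abel_tendsto:
  assumes l: "l > 0"
  shows "\<forall>\<^sub>F N in sequentially. summable (\<lambda>n. scal_atom N n * exp (- l * real n / real N))"
    and "(\<lambda>N. \<Sum>n. scal_atom N n * exp (- l * real n / real N)) \<longlonglongrightarrow>
       x powr \<nu> / (2 * Gamma (\<nu> + 1)) * (LINT \<theta>|circle_measure. circle_weight \<nu> (l * x) \<theta>)"
proof -
  define ld where "ld N \<theta> = bessel_weight.line_density (scal_a c N) (scal_b c N) \<nu> (scal_rho c l N) x \<theta>" for N \<theta>
  obtain B where B: "\<forall>\<^sub>F N in sequentially. \<forall>\<theta>. 0 \<le> ld N \<theta> \<and> ld N \<theta> \<le> B"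
    using line_density_bounded[OF c l \<nu> x] unfolding ld_def by blast
  have ev: "\<forall>\<^sub>F N in sequentially. (\<lambda>n. scal_atom N n * exp (- l * real n / real N)) sums
      (scal_const N * (LINT \<theta>|circle_measure. ld N \<theta>))"
    using B scal_admissible[OF c l \<nu>] eventually_N_gt[of "c\<^sup>2"]
  proof eventually_elim
    case (elim N)
    have N0: "real N > 0" using elim zero_le_power2[of c] by linarith
    have "1 - c\<^sup>2 / real N > 0" using elim N0 by simp
    hence "scal_rho c l N / (1 - c\<^sup>2 / real N) = exp (- l / (2 * real N))"
      unfolding scal_rho_def by (intro nonzero_mult_div_cancel_left) (rule less_imp_neq[symmetric])
    moreover have "exp (- l / (2 * real N)) ^ (2 * n) = exp (- l * real n / real N)" for n
      using N0 by (simp add: exp_of_nat_mult[symmetric])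
    ultimately show ?case
      using scal_atom_sums[OF elim(3) elim(2), of B] elim(1) unfolding ld_def by simp
  qed
  thus "\<forall>\<^sub>F N in sequentially. summable (\<lambda>n. scal_atom N n * exp (- l * real n / real N))"
    by eventually_elim (rule sums_summable)
  have ldm: "ld N \<in> borel_measurable circle_measure" if N: "real N > c\<^sup>2" for N
  proof -
    interpret bessel_weight "scal_a c N" "scal_b c N" \<nu> by (rule scal_weight[OF c \<nu> N])
    show ?thesis unfolding ld_def by measurable
  qed
  interpret finite_measure circle_measure by (rule finite_measure_circle)
  have int: "(\<lambda>N. LINT \<theta>|circle_measure. ld N \<theta>) \<longlonglongrightarrow> (LINT \<theta>|circle_measure. sqrt (2 * pi) * circle_weight \<nu> (l * x) \<theta>)"
  proof -
    obtain N1 where N1: "\<And>N \<theta>. N \<ge> N1 \<Longrightarrow> 0 \<le> ld N \<theta> \<and> ld N \<theta> \<le> B" "\<And>N. N \<ge> N1 \<Longrightarrow> real N > c\<^sup>2"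
      using eventually_conj[OF B eventually_N_gt[of "c\<^sup>2"]] unfolding eventually_sequentially by blast
    have "(\<lambda>N. LINT \<theta>|circle_measure. ld (N + N1) \<theta>) \<longlonglongrightarrow> (LINT \<theta>|circle_measure. sqrt (2 * pi) * circle_weight \<nu> (l * x) \<theta>)"
    proof (rule integral_dominated_convergence[where w = "\<lambda>_. B"])
      show "ld (N + N1) \<in> borel_measurable circle_measure" for N by (rule ldm[OF N1(2)]) simp
      show "AE \<theta> in circle_measure. norm (ld (N + N1) \<theta>) \<le> B" for N using N1(1)[of "N + N1"] by auto
      show "AE \<theta> in circle_measure. (\<lambda>N. ld (N + N1) \<theta>) \<longlonglongrightarrow> sqrt (2 * pi) * circle_weight \<nu> (l * x) \<theta>"
        using AE_circle_cos_neq[of 1]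
      proof eventually_elim
        case (elim \<theta>)
        show ?case
          using LIMSEQ_ignore_initial_segment[OF line_density_tendsto[OF c l \<nu> x elim], of N1]
          by (simp add: ld_def circle_weight_def chord_def)
      qed
    qed measurable
    thus ?thesis by (rule LIMSEQ_offset)
  qed
  have "(\<lambda>N. scal_const N * (LINT \<theta>|circle_measure. ld N \<theta>)) \<longlonglongrightarrow>
     sqrt (2 * pi) / (8 * pi * Gamma (\<nu> + 1)) * (x / 2) powr \<nu> * 2 powr (\<nu> + 1) *
       (LINT \<theta>|circle_measure. sqrt (2 * pi) * circle_weight \<nu> (l * x) \<theta>)"
    by (intro tendsto_mult scal_const_tendsto int)
  moreover have "sqrt (2 * pi) / (8 * pi * Gamma (\<nu> + 1)) * (x / 2) powr \<nu> * 2 powr (\<nu> + 1) *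
       (LINT \<theta>|circle_measure. sqrt (2 * pi) * circle_weight \<nu> (l * x) \<theta>) =
     x powr \<nu> / (2 * Gamma (\<nu> + 1)) * (LINT \<theta>|circle_measure. circle_weight \<nu> (l * x) \<theta>)"
  proof -
    have "(x / 2) powr \<nu> * 2 powr (\<nu> + 1) = 2 * x powr \<nu>"
      using x by (simp add: powr_divide powr_add)
    moreover have "sqrt (2 * pi) / (8 * pi * Gamma (\<nu> + 1)) * (x / 2) powr \<nu> * 2 powr (\<nu> + 1) *
       (LINT \<theta>|circle_measure. sqrt (2 * pi) * circle_weight \<nu> (l * x) \<theta>) =
       (sqrt (2 * pi) * sqrt (2 * pi)) / (8 * pi * Gamma (\<nu> + 1)) * ((x / 2) powr \<nu> * 2 powr (\<nu> + 1)) * (LINT \<theta>|circle_measure. circle_weight \<nu> (l * x) \<theta>)"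
    proof -
      have "s / (8 * pi * g) * y * z * (s * i) = (s * s) / (8 * pi * g) * (y * z) * i" for s g y z i :: real
        by simp
      thus ?thesis by (simp only: integral_mult_right_zero)
    qed
    ultimately show ?thesis by simp
  qed
  ultimately have lim: "(\<lambda>N. scal_const N * (LINT \<theta>|circle_measure. ld N \<theta>)) \<longlonglongrightarrow>
     x powr \<nu> / (2 * Gamma (\<nu> + 1)) * (LINT \<theta>|circle_measure. circle_weight \<nu> (l * x) \<theta>)"
    by (simp only:)
  show "(\<lambda>N. \<Sum>n. scal_atom N n * exp (- l * real n / real N)) \<longlonglongrightarrow>
       x powr \<nu> / (2 * Gamma (\<nu> + 1)) * (LINT \<theta>|circle_measure. circle_weight \<nu> (l * x) \<theta>)"
    by (rule Lim_transform_eventually[OF lim]) (use ev in eventually_elim, simp add: sums_iff)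
qed

end

section \<open>From Abel sums to partial sums\<close>

text \<open>An antiderivative of \<open>1 / chord\<close> is \<open>- cot (\<theta> / 2) / 2\<close>, and \<open>chord \<theta> > x\<close> describes an arc that is
  symmetric about \<open>pi\<close>.\<close>

lemma integral_inverse_chord:
  fixes x :: real
  assumes x: "0 < x" "x < 4"
  shows "(LINT \<theta>|circle_measure. (if chord \<theta> > x then 1 / chord \<theta> else 0)) = sqrt ((4 - x) * x) / x"
proof -
  define t0 where "t0 = arccos (1 - x / 2)"
  have xr: "-1 < 1 - x / 2" "1 - x / 2 < 1" using x by auto
  have t0: "0 < t0" "t0 < pi" and ct0: "cos t0 = 1 - x / 2"
    using arccos_lt_bounded[OF xr] xr by (auto simp: t0_def)
  have iff: "chord \<theta> > x \<longleftrightarrow> t0 < \<theta> \<and> \<theta> < 2 * pi - t0" if \<theta>: "0 \<le> \<theta>" "\<theta> \<le> 2 * pi" for \<theta>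
  proof -
    have "chord \<theta> > x \<longleftrightarrow> cos \<theta> < cos t0" by (auto simp: chord_def ct0)
    also have "\<dots> \<longleftrightarrow> t0 < \<theta> \<and> \<theta> < 2 * pi - t0"
    proof (cases "\<theta> \<le> pi")
      case True
      thus ?thesis using cos_mono_less_eq[of \<theta> t0] \<theta> t0 by auto
    next
      case False
      have "cos \<theta> = cos (2 * pi - \<theta>)" by (simp add: cos_diff)
      thus ?thesis using cos_mono_less_eq[of "2 * pi - \<theta>" t0] \<theta> t0 False by auto
    qed
    finally show ?thesis .
  qed
  define G where "G \<theta> = - sin \<theta> / (2 * (1 - cos \<theta>))" for \<theta> :: real
  have pos: "chord \<theta> > 0" if "t0 \<le> \<theta>" "\<theta> \<le> 2 * pi - t0" for \<theta>
  proof -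
    have "cos \<theta> \<noteq> 1"
    proof
      assume "cos \<theta> = 1"
      moreover have "cos \<theta> \<le> cos t0"
      proof (cases "\<theta> \<le> pi")
        case True
        thus ?thesis using that t0 by (intro cos_monotone_0_pi_le) auto
      next
        case False
        have "cos \<theta> = cos (2 * pi - \<theta>)" by (simp add: cos_diff)
        also have "\<dots> \<le> cos t0" using that t0 False by (intro cos_monotone_0_pi_le) auto
        finally show ?thesis .
      qed
      ultimately show False using x by (simp add: ct0)
    qed
    thus ?thesis using cos_le_one[of \<theta>] by (simp add: chord_def less_le)
  qed
  have "(LINT \<theta>|circle_measure. (if chord \<theta> > x then 1 / chord \<theta> else 0)) =
     (LINT \<theta>|lborel. indicator {0..2*pi} \<theta> *\<^sub>R (if chord \<theta> > x then 1 / chord \<theta> else 0))"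
    by (subst integral_restrict_space) auto
  also have "\<dots> = (LINT \<theta>|lborel. indicator {t0..2 * pi - t0} \<theta> *\<^sub>R (1 / chord \<theta>))"
  proof (rule integral_cong_AE)
    show "AE \<theta> in lborel. indicator {0..2*pi} \<theta> *\<^sub>R (if chord \<theta> > x then 1 / chord \<theta> else 0) =
       indicator {t0..2 * pi - t0} \<theta> *\<^sub>R (1 / chord \<theta>)"
      using AE_lborel_singleton[of t0] AE_lborel_singleton[of "2 * pi - t0"]
    proof eventually_elim
      case (elim \<theta>)
      show ?case
      proof (cases "\<theta> \<in> {0..2*pi}")
        case True
        thus ?thesis using iff[of \<theta>] elim by (auto split: split_indicator)
      next
        case False
        thus ?thesis using t0 by (auto split: split_indicator)
      qed
    qed
  qed measurable
  also have "\<dots> = G (2 * pi - t0) - G t0"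
  proof (rule integral_FTC_Icc)
    show "t0 \<le> 2 * pi - t0" using t0 by simp
    show "(G has_vector_derivative 1 / chord \<theta>) (at \<theta> within {t0..2 * pi - t0})" if "t0 \<le> \<theta>" "\<theta> \<le> 2 * pi - t0" for \<theta>
    proof -
      have D: "1 - cos \<theta> > 0" using pos[OF that] by (simp add: chord_def)
      have "(G has_real_derivative ((- cos \<theta>) * (2 * (1 - cos \<theta>)) - (- sin \<theta>) * (2 * sin \<theta>)) / (2 * (1 - cos \<theta>) * (2 * (1 - cos \<theta>)))) (at \<theta> within {t0..2 * pi - t0})"
        unfolding G_def
      proof (rule DERIV_divide)
        show "((\<lambda>\<theta>. - sin \<theta>) has_real_derivative - cos \<theta>) (at \<theta> within {t0..2 * pi - t0})"
          by (auto intro!: derivative_eq_intros)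
        show "((\<lambda>\<theta>. 2 * (1 - cos \<theta>)) has_real_derivative 2 * sin \<theta>) (at \<theta> within {t0..2 * pi - t0})"
          by (auto intro!: derivative_eq_intros)
        show "2 * (1 - cos \<theta>) \<noteq> 0" using D by simp
      qed
      moreover have "((- cos \<theta>) * (2 * (1 - cos \<theta>)) - (- sin \<theta>) * (2 * sin \<theta>)) = 2 * (1 - cos \<theta>)"
      proof -
        have "sin \<theta> * sin \<theta> = 1 - cos \<theta> * cos \<theta>" using sin_squared_eq[of \<theta>] by (simp add: power2_eq_square)
        have "(- cos \<theta>) * (2 * (1 - cos \<theta>)) - (- sin \<theta>) * (2 * sin \<theta>) =
            2 * (sin \<theta> * sin \<theta>) - 2 * cos \<theta> + 2 * (cos \<theta> * cos \<theta>)"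
          by (simp add: algebra_simps)
        also have "\<dots> = 2 * (1 - cos \<theta>)"
          unfolding \<open>sin \<theta> * sin \<theta> = 1 - cos \<theta> * cos \<theta>\<close> by (simp add: algebra_simps)
        finally show ?thesis .
      qed
      moreover have "2 * (1 - cos \<theta>) / (2 * (1 - cos \<theta>) * (2 * (1 - cos \<theta>))) = 1 / chord \<theta>"
        using D by (simp add: chord_def)
      ultimately show ?thesis by (simp only: has_real_derivative_iff_has_vector_derivative)
    qed
    show "continuous_on {t0..2 * pi - t0} (\<lambda>\<theta>. 1 / chord \<theta>)"
    proof -
      have "2 - 2 * cos \<theta> \<noteq> 0" if "\<theta> \<in> {t0..2 * pi - t0}" for \<theta>
        using pos[of \<theta>] that by (auto simp: chord_def)
      thus ?thesis unfolding chord_def by (intro continuous_intros) blast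
    qed
  qed
  also have "G (2 * pi - t0) = - G t0"
    by (simp add: G_def sin_diff cos_diff)
  also have "- G t0 - G t0 = sin t0 / (1 - cos t0)"
  proof -
    have "- (- s / (2 * d)) - (- s / (2 * d)) = s / d" for s d :: real
      by (cases "d = 0") (simp_all add: field_simps)
    thus ?thesis unfolding G_def .
  qed
  also have "sin t0 = sqrt ((4 - x) * x) / 2"
  proof -
    have "sin t0 = sqrt (1 - (1 - x / 2)\<^sup>2)"
      unfolding t0_def using xr by (intro sin_arccos) auto
    also have "1 - (1 - x / 2)\<^sup>2 = ((4 - x) * x) / 4" by (simp add: power2_eq_square field_simps)
    finally show ?thesis by (simp add: real_sqrt_divide)
  qed
  also have "1 - cos t0 = x / 2" by (simp add: ct0)
  finally show ?thesis by simp
qed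

context
  fixes c \<nu> x :: real
  assumes c: "c > 0" and \<nu>: "\<nu> > -1" and x: "x > 0"
begin

interpretation cm: finite_measure circle_measure by (rule finite_measure_circle)

text \<open>With \<open>u = exp (- s)\<close> this is \<open>exp s\<close> times \<open>s powr (- \<nu>)\<close> on \<open>x / 6 \<le> s < 1\<close>. The factor \<open>exp s\<close> undoes the damping by
  \<open>exp (- n / N)\<close> that makes the masses summable, and the power undoes the factor \<open>lag_ratio\<close>. The cut-off \<open>x / 6\<close>
  keeps the function bounded and lies below the support of the limit.\<close>

definition test_fun :: "real \<Rightarrow> real" where
  "test_fun u = (if exp (-1) < u \<and> u \<le> exp (- (x / 6)) then (1 / u) * (- ln u) powr (- \<nu>) else 0)"

lemma borel_measurable_test_fun [measurable]: "test_fun \<in> borel_measurable borel"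
  unfolding test_fun_def[abs_def] by measurable

lemma test_fun_bounded: "\<bar>test_fun u\<bar> \<le> exp 1 * (1 + (x / 6) powr (- \<nu>))"
proof (cases "exp (-1) < u \<and> u \<le> exp (- (x / 6))")
  case True
  hence u: "u > 0" using exp_gt_zero[of "-1"] by linarith
  have "- 1 < ln u" using True u by (metis exp_less_cancel_iff exp_ln)
  moreover have "ln u \<le> - (x / 6)" using True u by (metis exp_le_cancel_iff exp_ln)
  ultimately have s: "x / 6 \<le> - ln u" "- ln u < 1" by auto
  have "1 / u \<le> exp 1"
    using True u by (simp add: exp_minus field_simps)
  moreover have "(- ln u) powr (- \<nu>) \<le> 1 + (x / 6) powr (- \<nu>)"
  proof (cases "\<nu> \<le> 0")
    case True
    hence "(- ln u) powr (- \<nu>) \<le> 1" using s x by (intro powr_le1) auto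
    thus ?thesis by (simp add: add_increasing2)
  next
    case False
    hence "(- ln u) powr (- \<nu>) \<le> (x / 6) powr (- \<nu>)" using s x by (intro powr_mono2') auto
    thus ?thesis by simp
  qed
  ultimately have "(1 / u) * (- ln u) powr (- \<nu>) \<le> exp 1 * (1 + (x / 6) powr (- \<nu>))"
    using u by (intro mult_mono) auto
  thus ?thesis using True u by (simp add: test_fun_def)
next
  case False
  have "0 \<le> exp 1 * (1 + (x / 6) powr (- \<nu>))" by (intro mult_nonneg_nonneg add_nonneg_nonneg) auto
  thus ?thesis using False by (auto simp: test_fun_def)
qed

lemma isCont_test_fun:
  assumes u: "u > 0" "u \<noteq> exp (-1)" "u \<noteq> exp (- (x / 6))"
  shows "isCont test_fun u"
proof (cases "exp (-1) < u \<and> u < exp (- (x / 6))")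
  case True
  have "u < 1" using True x by (auto intro: less_trans)
  have "\<forall>\<^sub>F v in nhds u. v \<in> {exp (-1)<..<exp (- (x / 6))}"
    using True by (intro eventually_nhds_in_open) auto
  hence ev: "\<forall>\<^sub>F v in nhds u. test_fun v = (1 / v) * (- ln v) powr (- \<nu>)"
    by eventually_elim (auto simp: test_fun_def)
  have "isCont (\<lambda>v. (1 / v) * (- ln v) powr (- \<nu>)) u"
    using u \<open>u < 1\<close> by (intro continuous_intros) auto
  thus ?thesis using isCont_cong[OF ev] by simp
next
  case False
  hence "u \<in> {..<exp (-1)} \<union> {exp (- (x / 6))<..}" using u by auto
  hence "\<forall>\<^sub>F v in nhds u. v \<in> {..<exp (-1)} \<union> {exp (- (x / 6))<..}"
    by (intro eventually_nhds_in_open) auto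
  hence ev: "\<forall>\<^sub>F v in nhds u. test_fun v = 0"
    by eventually_elim (auto simp: test_fun_def)
  show ?thesis using isCont_cong[OF ev] by simp
qed

abbreviation mass where "mass \<equiv> scal_mass c \<nu> x"
abbreviation atom where "atom \<equiv> scal_atom c \<nu> x"

text \<open>The moments of the damped masses are their Laplace transforms at \<open>1, 2, 3, \<dots>\<close>. The test function is
  discontinuous at two points only; the first is \<open>chord = x\<close>, a finite set of angles, and the second is never
  reached because \<open>chord \<le> 4\<close>.\<close>

lemma test_sum_tendsto:
  assumes x4: "x < 4"
  shows "(\<lambda>N. \<Sum>n. atom N n * exp (- real n / real N) * test_fun (exp (- real n / real N))) \<longlonglongrightarrow>
     1 / (2 * Gamma (\<nu> + 1)) * (sqrt ((4 - x) * x) / x)"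
proof -
  define C where "C = x powr \<nu> / (2 * Gamma (\<nu> + 1))"
  have G: "Gamma (\<nu> + 1) > 0" using \<nu> by (intro Gamma_real_pos) simp
  have C: "C > 0" using G x by (simp add: C_def)
  define w where "w \<theta> = C * circle_weight \<nu> x \<theta>" for \<theta>
  have [measurable]: "w \<in> borel_measurable borel" unfolding w_def[abs_def] by measurable
  have w0: "w \<theta> \<ge> 0" for \<theta> using C circle_weight_nonneg by (simp add: w_def)
  have wint: "integrable circle_measure w"
    unfolding w_def using \<nu> x by (intro integrable_mult_right integrable_circle_weight)
  define P where "P = density circle_measure (\<lambda>\<theta>. ennreal (w \<theta>))"
  define U where "U \<theta> = exp (- x / chord \<theta>)" for \<theta>
  have [measurable]: "U \<in> borel_measurable borel" unfolding U_def[abs_def] by measurable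
  have emP: "emeasure P (space P) = ennreal (LINT \<theta>|circle_measure. w \<theta>)"
  proof -
    have "emeasure P (space circle_measure) =
        (\<integral>\<^sup>+ \<theta>. ennreal (w \<theta>) * indicator (space circle_measure) \<theta> \<partial>circle_measure)"
      unfolding P_def by (rule emeasure_density[OF _ sets.top]) measurable
    also have "\<dots> = (\<integral>\<^sup>+ \<theta>. ennreal (w \<theta>) \<partial>circle_measure)"
      by (intro nn_integral_cong) simp
    also have "space circle_measure = space P" by (simp add: P_def)
    finally show ?thesis using nn_integral_eq_integral[OF wint] w0 by simp
  qed
  have finP: "finite_measure P" by (rule finite_measureI) (simp add: emP)
  have P_int: "(LINT \<theta>|P. f \<theta>) = (LINT \<theta>|circle_measure. w \<theta> * f \<theta>)" if "f \<in> borel_measurable borel" for f :: "real \<Rightarrow> real"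
    unfolding P_def using w0 that by (subst integral_density) (auto intro!: measurable_circleI)
  have wpos: "(LINT \<theta>|circle_measure. w \<theta>) > 0"
  proof -
    have "(LINT \<theta>|circle_measure. w \<theta>) \<noteq> 0"
    proof
      assume "(LINT \<theta>|circle_measure. w \<theta>) = 0"
      hence "AE \<theta> in circle_measure. w \<theta> = 0"
        using integral_nonneg_eq_0_iff_AE[OF wint] w0 by simp
      hence "AE \<theta> in circle_measure. False"
        using AE_chord_pos by eventually_elim (use C in \<open>auto simp: w_def circle_weight_def\<close>)
      hence "AE \<theta> in lborel. \<theta> \<notin> {0..2 * pi}"
        by (subst (asm) AE_restrict_space_iff) auto
      hence "{0..2 * pi} \<in> null_sets lborel"
        by (subst AE_iff_null_sets) auto
      thus False by (auto dest!: null_setsD1)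
    qed
    moreover have "(LINT \<theta>|circle_measure. w \<theta>) \<ge> 0" using w0 by simp
    ultimately show ?thesis by simp
  qed
  have massP: "measure P (space P) > 0"
    using emP wpos by (simp add: measure_def)
  define p where "p N n = atom N n * exp (- real n / real N)" for N n
  define u where "u N n = exp (- real n / real N)" for N n :: nat
  have pu: "p N n * u N n ^ k = atom N n * exp (- (1 + real k) * real n / real N)" for N n k
  proof -
    have "exp (- real n / real N) * u N n ^ k = exp (- (1 + real k) * real n / real N)"
      unfolding u_def exp_of_nat_mult[symmetric] exp_add[symmetric]
      by (cases "N = 0") (simp_all add: field_simps)
    thus ?thesis by (simp add: p_def mult.assoc)
  qed
  have cw: "C * circle_weight \<nu> ((1 + real k) * x) \<theta> = w \<theta> * U \<theta> ^ k" for k \<theta>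
  proof -
    have "exp (- x / chord \<theta>) * U \<theta> ^ k = exp (- ((1 + real k) * x) / chord \<theta>)"
      unfolding U_def exp_of_nat_mult[symmetric] exp_add[symmetric] by (simp add: algebra_simps add_divide_distrib diff_divide_distrib)
    thus ?thesis by (simp add: w_def circle_weight_def mult.assoc)
  qed
  have mom: "(\<lambda>N. \<Sum>n. p N n * u N n ^ k) \<longlonglongrightarrow> (LINT \<theta>|P. U \<theta> ^ k)" for k
  proof -
    have "(\<lambda>N. \<Sum>n. atom N n * exp (- (1 + real k) * real n / real N)) \<longlonglongrightarrow>
        C * (LINT \<theta>|circle_measure. circle_weight \<nu> ((1 + real k) * x) \<theta>)"
      unfolding C_def by (rule scal_atom_abel_tendsto(2)[OF c \<nu> x]) simp
    also have "C * (LINT \<theta>|circle_measure. circle_weight \<nu> ((1 + real k) * x) \<theta>) = (LINT \<theta>|P. U \<theta> ^ k)"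
      by (subst P_int) (simp_all flip: cw)
    finally show ?thesis unfolding pu .
  qed
  have ev1: "\<forall>\<^sub>F N in sequentially. summable (p N)"
    using scal_atom_abel_tendsto(1)[OF c \<nu> x, of 1] by (simp add: p_def[abs_def])
  have ev2: "\<forall>\<^sub>F N in sequentially. (\<Sum>n. p N n) > 0"
    using mom[of 0] massP by (intro order_tendstoD(1)[of _ "measure P (space P)"]) auto
  \<comment> \<open>For small \<open>N\<close> the weight need not be integrable, so the sequence is shifted.\<close>
  obtain N0 where N0: "\<And>N. N \<ge> N0 \<Longrightarrow> summable (p N) \<and> (\<Sum>n. p N n) > 0 \<and> real N > c\<^sup>2"
    using eventually_conj[OF ev1 eventually_conj[OF ev2 eventually_N_gt[of "c\<^sup>2"]]] unfolding eventually_sequentially by blast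
  have "(\<lambda>N. \<Sum>n. p (N + N0) n * test_fun (u (N + N0) n)) \<longlonglongrightarrow> (LINT \<theta>|P. test_fun (U \<theta>))"
  proof (rule discrete_moment_convergence[where p = "\<lambda>N. p (N + N0)" and u = "\<lambda>N. u (N + N0)" and F = test_fun
        and U = U and P = P, OF _ _ _ _ finP massP])
    show "0 \<le> p (N + N0) n" for N n
      using scal_atom_nonneg(2)[OF c \<nu> x, of "N + N0" n] N0[of "N + N0"] by (simp add: p_def)
    show "summable (p (N + N0))" "0 < (\<Sum>n. p (N + N0) n)" for N using N0[of "N + N0"] by auto
    show "u (N + N0) n \<in> {0..1}" for N n by (simp add: u_def)
    show "U \<in> borel_measurable P" by (simp add: P_def)
    show "U \<theta> \<in> {0..1}" for \<theta> using chord_nonneg[of \<theta>] x by (simp add: U_def)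
    show "(\<lambda>N. \<Sum>n. p (N + N0) n * u (N + N0) n ^ k) \<longlonglongrightarrow> (LINT \<theta>|P. U \<theta> ^ k)" for k
      by (rule LIMSEQ_ignore_initial_segment[OF mom])
    show "\<bar>test_fun v\<bar> \<le> exp 1 * (1 + (x / 6) powr (- \<nu>))" for v by (rule test_fun_bounded)
    have "AE \<theta> in circle_measure. isCont test_fun (U \<theta>)"
      using AE_chord_pos AE_circle_cos_neq[of "1 - x / 2"]
    proof eventually_elim
      case (elim \<theta>)
      have "x / chord \<theta> \<ge> x / 4"
        using elim chord_le[of \<theta>] x by (intro divide_left_mono) auto
      hence "x / chord \<theta> \<noteq> x / 6" using x by auto
      moreover have "x / chord \<theta> \<noteq> 1" using elim by (auto simp: chord_def field_simps)
      ultimately show ?case by (intro isCont_test_fun) (auto simp: U_def)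
    qed
    thus "AE \<theta> in P. isCont test_fun (U \<theta>)"
      unfolding P_def by (subst AE_density) auto
  qed measurable
  hence "(\<lambda>N. \<Sum>n. p N n * test_fun (u N n)) \<longlonglongrightarrow> (LINT \<theta>|P. test_fun (U \<theta>))"
    by (rule LIMSEQ_offset)
  also have "(LINT \<theta>|P. test_fun (U \<theta>)) = (LINT \<theta>|circle_measure. w \<theta> * test_fun (U \<theta>))"
    by (rule P_int) measurable
  also have "\<dots> = (LINT \<theta>|circle_measure. 1 / (2 * Gamma (\<nu> + 1)) * (if chord \<theta> > x then 1 / chord \<theta> else 0))"
  proof (rule integral_cong_AE)
    show "AE \<theta> in circle_measure. w \<theta> * test_fun (U \<theta>) = 1 / (2 * Gamma (\<nu> + 1)) * (if chord \<theta> > x then 1 / chord \<theta> else 0)"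
      using AE_chord_pos
    proof eventually_elim
      case (elim \<theta>)
      have "x / chord \<theta> \<ge> x / 4"
        using elim chord_le[of \<theta>] x by (intro divide_left_mono) auto
      hence le: "U \<theta> \<le> exp (- (x / 6))" using x by (simp add: U_def)
      have less: "exp (-1) < U \<theta> \<longleftrightarrow> chord \<theta> > x" using elim by (simp add: U_def divide_less_eq)
      have "C * (chord \<theta> powr (- (\<nu> + 1)) * (x / chord \<theta>) powr (- \<nu>)) = 1 / (2 * Gamma (\<nu> + 1)) * (1 / chord \<theta>)"
      proof -
        have "chord \<theta> powr (- (\<nu> + 1)) * (x / chord \<theta>) powr (- \<nu>) = (chord \<theta> powr (- (\<nu> + 1)) * chord \<theta> powr \<nu>) * x powr (- \<nu>)"
          using elim x by (simp add: powr_divide powr_minus field_simps)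
        also have "chord \<theta> powr (- (\<nu> + 1)) * chord \<theta> powr \<nu> = 1 / chord \<theta>"
          using elim by (simp add: powr_add[symmetric] powr_minus_divide)
        finally show ?thesis using x by (simp add: C_def powr_minus)
      qed
      moreover have "w \<theta> * test_fun (U \<theta>) = C * (chord \<theta> powr (- (\<nu> + 1)) * (x / chord \<theta>) powr (- \<nu>))" if "chord \<theta> > x"
      proof -
        have "test_fun (U \<theta>) = 1 / U \<theta> * (x / chord \<theta>) powr (- \<nu>)"
          using le less that by (simp add: test_fun_def U_def)
        thus ?thesis by (simp add: w_def circle_weight_def U_def)
      qed
      ultimately show ?case using less le by (auto simp: test_fun_def)
    qed
  qed measurable
  also have "\<dots> = 1 / (2 * Gamma (\<nu> + 1)) * (sqrt ((4 - x) * x) / x)"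
    using integral_inverse_chord[OF x x4] by simp
  finally show ?thesis by (simp only: p_def u_def)
qed

text \<open>The Abel sum at the fixed radius \<open>1 / 2\<close> is at most of order \<open>exp (- x N / 3)\<close> up to powers of \<open>N\<close>, and
  restricting to \<open>n < x N / 6\<close> costs a factor \<open>4\<^sup>n \<le> exp (ln 4 x N / 6)\<close>, which the decay outweighs since \<open>ln 4 < 2\<close>.\<close>

lemma small_index_sum_tendsto:
  "(\<lambda>N. \<Sum>n | n < N \<and> real n < x / 6 * real N. mass N n) \<longlonglongrightarrow> 0"
proof -
  define ld where "ld N \<theta> = bessel_weight.line_density (scal_a c N) (scal_b c N) \<nu> (1 / 2) x \<theta>" for N \<theta>
  define B1 where "B1 = (1 / 4 * (1 / 2)) powr (- (\<nu> + 1)) * bessel_scaled_bound (\<nu> + 1 / 2) * exp (x * c\<^sup>2)"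
  have bsb: "bessel_scaled_bound \<mu> \<ge> 0" for \<mu> by (simp add: bessel_scaled_bound_def)
  have B1: "B1 \<ge> 0" using bsb by (simp add: B1_def)
  obtain B2 where B2: "B2 > 0" "\<And>n. 1 / lag_ratio \<nu> n \<le> B2 * real (n + 1) powr \<bar>\<nu>\<bar>"
    using lag_ratio_inverse_bound[OF \<nu>] by blast
  have ev1: "\<forall>\<^sub>F N in sequentially. scal_kappa c N / scal_a c N < 1 / 4"
    by (rule order_tendstoD(2)[OF scal_kappa_a0[OF c]]) simp
  have ev2: "\<forall>\<^sub>F N in sequentially. scal_kappa c N - real N < c\<^sup>2"
    by (rule order_tendstoD(2)[OF scal_kappa_minus[OF c]]) (use c in simp)
  have ev3: "\<forall>\<^sub>F N in sequentially. scal_a c N > 2 / x"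
    using scal_a_inf[OF c] by (simp add: filterlim_at_top_dense)
  have ldb: "\<forall>\<^sub>F N in sequentially. bessel_weight.admissible (scal_a c N) (scal_b c N) (1 / 2) \<and>
       (\<forall>\<theta>. 0 \<le> ld N \<theta> \<and> ld N \<theta> \<le> B1 * exp (- (x / 3 * real N)))"
    using ev1 ev2 ev3 eventually_N_gt[of "c\<^sup>2"]
  proof eventually_elim
    case (elim N)
    interpret bessel_weight "scal_a c N" "scal_b c N" \<nu> by (rule scal_weight[OF c \<nu> elim(4)])
    have k: "scal_kappa c N = kappa" by (simp add: kappa_def scal_kappa_def)
    have ka: "kappa / scal_a c N < 1 / 4" using elim k by simp
    have quot: "2 * kappa * ((1 / 2) / (1 - (1 / 2)\<^sup>2)) / scal_a c N = 4 / 3 * (kappa / scal_a c N)"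
      by (simp add: power2_eq_square)
    have "2 * kappa * ((1 / 2) / (1 - (1 / 2)\<^sup>2)) / scal_a c N < 1"
      unfolding quot using ka by linarith
    hence adm: "admissible (1 / 2)"
      unfolding admissible_def using a_pos by (simp only: divide_less_eq_1_pos) simp
    have "0 \<le> line_density (1 / 2) x \<theta> \<and> line_density (1 / 2) x \<theta> \<le> B1 * exp (- (x / 3 * real N))" for \<theta>
    proof -
      have D: "circD (1 / 2) \<theta> > 0" "circD (1 / 2) \<theta> \<ge> 1 / 4" "circD (1 / 2) \<theta> \<le> (1 + 1 / 2)\<^sup>2"
        using circD_bounds[of "1 / 2" \<theta>] by (auto simp: power2_eq_square)
      have b: "beta (1 / 2) \<theta> > 0" by (rule beta_pos(1)[OF adm])
      have "(1 / 2)\<^sup>2 \<le> (beta (1 / 2) \<theta>)\<^sup>2"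
      proof -
        have "(4 / 3 * (kappa / scal_a c N))\<^sup>2 \<le> (1 / 2)\<^sup>2"
          using ka kappa_pos a_pos by (intro power_mono) auto
        thus ?thesis
          using beta_square_ge(1)[OF adm, of \<theta>] beta_pos(2)[OF adm, of \<theta>] unfolding quot by (simp add: power2_eq_square)
      qed
      hence b2: "beta (1 / 2) \<theta> \<ge> 1 / 2" using b by (intro power2_le_imp_le[of "1 / 2"]) auto
      have X1: "scal_a c N * x * beta (1 / 2) \<theta> \<ge> 1"
      proof -
        have "1 \<le> scal_a c N * x * (1 / 2)" using elim(3) x by (simp add: divide_less_eq mult_ac)
        also have "\<dots> \<le> scal_a c N * x * beta (1 / 2) \<theta>" using b2 x a_pos by (intro mult_left_mono) auto
        finally show ?thesis .
      qed
      have bs: "0 \<le> bessel_scaled (\<nu> + 1 / 2) (scal_a c N * x * beta (1 / 2) \<theta>)"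
        "bessel_scaled (\<nu> + 1 / 2) (scal_a c N * x * beta (1 / 2) \<theta>) \<le> bessel_scaled_bound (\<nu> + 1 / 2)"
        using X1 by (auto intro: bessel_scaled_nonneg bessel_scaled_le_bound)
      have "0 \<le> (1 - (2 * kappa * ((1 / 2) / (1 - (1 / 2)\<^sup>2)) / scal_a c N)\<^sup>2) / 4 * kappa * (1 - (1 / 2)\<^sup>2) * (1 / circD (1 / 2) \<theta> - 1 / (1 + 1 / 2)\<^sup>2)"
      proof -
        have "1 / (1 + 1 / 2)\<^sup>2 \<le> 1 / circD (1 / 2) \<theta>"
          by (rule divide_left_mono) (use D in auto)
        thus ?thesis
          using beta_square_ge(2)[OF adm] kappa_pos
          by (intro mult_nonneg_nonneg) (simp_all add: less_imp_le power2_eq_square)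
      qed
      hence "scal_b c N - 2 * kappa * circP (1 / 2) \<theta> - scal_a c N * beta (1 / 2) \<theta> \<le>
          scal_b c N - scal_a c N + 2 * kappa * (1 / 2) / (1 + 1 / 2)"
        using exponent_bound[OF adm, of \<theta>] by linarith
      also have "\<dots> \<le> - (real N / 3) + c\<^sup>2"
      proof -
        have "kappa < real N + c\<^sup>2" using elim(2) k by simp
        moreover have "c\<^sup>2 \<ge> 0" by simp
        moreover have "scal_b c N - scal_a c N = - real N" by (simp add: scal_a_def scal_b_def)
        moreover have "2 * kappa * (1 / 2) / (1 + 1 / 2) = 2 / 3 * kappa" by simp
        ultimately show ?thesis by linarith
      qed
      finally have ex: "x * (scal_b c N - 2 * kappa * circP (1 / 2) \<theta> - scal_a c N * beta (1 / 2) \<theta>) \<le> x * (- (real N / 3) + c\<^sup>2)"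
        using x by (intro mult_left_mono) auto
      have "line_density (1 / 2) x \<theta> \<le> (1 / 4 * (1 / 2)) powr (- (\<nu> + 1)) * exp (x * (- (real N / 3) + c\<^sup>2)) * bessel_scaled_bound (\<nu> + 1 / 2)"
        unfolding line_density_def using ex bs D b2 \<nu>
        by (intro mult_mono powr_mono2') (auto intro!: mult_mono mult_nonneg_nonneg simp: bsb)
      also have "\<dots> = B1 * exp (- (x / 3 * real N))"
        by (simp add: B1_def exp_add[symmetric] algebra_simps)
      finally show ?thesis using bs by (simp add: line_density_def)
    qed
    thus ?case unfolding ld_def using adm by simp
  qed
  define K where "K N = scal_const c \<nu> x N * (2 * pi * B1) * B2 * (real N powr (\<nu> + \<bar>\<nu>\<bar>) * exp (- (x / 3 - x / 6 * ln 4) * real N))" for N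
  have bound: "\<forall>\<^sub>F N in sequentially. (\<Sum>n | n < N \<and> real n < x / 6 * real N. mass N n) \<le> 
      scal_const c \<nu> x N * (2 * pi * B1) * B2 * (real N powr (\<nu> + \<bar>\<nu>\<bar>) * exp (- (x / 3 - x / 6 * ln 4) * real N))"
    using ldb eventually_N_gt[of "c\<^sup>2"]
  proof eventually_elim
    case (elim N)
    have N0: "real N > 0" using elim zero_le_power2[of c] by linarith
    have tau: "0 < 1 - c\<^sup>2 / real N" "1 - c\<^sup>2 / real N \<le> 1" using elim N0 by auto
    have adm: "bessel_weight.admissible (scal_a c N) (scal_b c N) (1 / 2)" using elim by simp
    define r where "r = (1 / 2) / (1 - c\<^sup>2 / real N)"
    have r: "r \<ge> 1 / 2" using tau by (simp add: r_def le_divide_eq)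
    have sums: "(\<lambda>n. atom N n * r ^ (2 * n)) sums (scal_const c \<nu> x N * (LINT \<theta>|circle_measure. ld N \<theta>))"
      unfolding r_def ld_def
      by (rule scal_atom_sums[OF c \<nu> x elim(2) adm, of "B1 * exp (- (x / 3 * real N))"]) (use elim in \<open>auto simp: ld_def\<close>)
    have sc0: "scal_const c \<nu> x N \<ge> 0" by (rule scal_const_nonneg[OF c \<nu> x])
    have at0: "atom N n \<ge> 0" for n by (rule scal_atom_nonneg(2)[OF c \<nu> x elim(2)])
    have ldint: "(LINT \<theta>|circle_measure. ld N \<theta>) \<le> 2 * pi * (B1 * exp (- (x / 3 * real N)))"
    proof -
      have "(LINT \<theta>|circle_measure. ld N \<theta>) \<le> (LINT \<theta>|circle_measure. B1 * exp (- (x / 3 * real N)))"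
        by (rule integral_mono') (use elim B1 in auto)
      also have "\<dots> = 2 * pi * (B1 * exp (- (x / 3 * real N)))"
        by (simp add: measure_restrict_space space_restrict_space)
      finally show ?thesis .
    qed
    define I where "I = {n. n < N \<and> real n < x / 6 * real N}"
    have "mass N n \<le> B2 * real N powr (\<nu> + \<bar>\<nu>\<bar>) * 4 powr (x / 6 * real N) * (atom N n * r ^ (2 * n))" if n: "n \<in> I" for n
    proof -
      have lr: "lag_ratio \<nu> n > 0" by (rule lag_ratio_pos[OF \<nu>])
      have m: "mass N n = atom N n * real N powr \<nu> * (1 / lag_ratio \<nu> n)"
        by (rule scal_mass_eq[OF c \<nu> x N0])
      have "1 / lag_ratio \<nu> n \<le> B2 * real N powr \<bar>\<nu>\<bar>"
      proof -
        have "real (n + 1) powr \<bar>\<nu>\<bar> \<le> real N powr \<bar>\<nu>\<bar>"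
          using n by (intro powr_mono2) (auto simp: I_def)
        thus ?thesis using B2 by (meson less_imp_le mult_left_mono order.trans)
      qed
      hence "mass N n \<le> atom N n * real N powr \<nu> * (B2 * real N powr \<bar>\<nu>\<bar>)"
        unfolding m using at0 by (intro mult_left_mono mult_nonneg_nonneg) auto
      also have "\<dots> = B2 * real N powr (\<nu> + \<bar>\<nu>\<bar>) * (1 * atom N n)"
        by (simp add: powr_add)
      also have "\<dots> \<le> B2 * real N powr (\<nu> + \<bar>\<nu>\<bar>) * ((4 powr (x / 6 * real N) * r ^ (2 * n)) * atom N n)"
      proof (intro mult_left_mono mult_right_mono)
        \<comment> \<open>The radius \<open>1 / 2\<close> of the Abel sum becomes the damping factor \<open>1 / 4\<close> per index.\<close>
        have "1 = 4 powr real n * (1 / 2 :: real) ^ (2 * n)"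
          by (simp add: powr_realpow power_mult power_divide power2_eq_square)
        also have "\<dots> \<le> 4 powr (x / 6 * real N) * r ^ (2 * n)"
          using n r by (intro mult_mono powr_mono power_mono) (auto simp: I_def)
        finally show "1 \<le> 4 powr (x / 6 * real N) * r ^ (2 * n)" .
      qed (use at0 B2 in auto)
      finally show ?thesis by (simp add: mult_ac)
    qed
    hence "(\<Sum>n\<in>I. mass N n) \<le> (\<Sum>n\<in>I. B2 * real N powr (\<nu> + \<bar>\<nu>\<bar>) * 4 powr (x / 6 * real N) * (atom N n * r ^ (2 * n)))"
      by (rule sum_mono)
    also have "\<dots> = B2 * real N powr (\<nu> + \<bar>\<nu>\<bar>) * 4 powr (x / 6 * real N) * (\<Sum>n\<in>I. atom N n * r ^ (2 * n))"
      by (rule sum_distrib_left[symmetric])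
    also have "\<dots> \<le> B2 * real N powr (\<nu> + \<bar>\<nu>\<bar>) * 4 powr (x / 6 * real N) * (scal_const c \<nu> x N * (2 * pi * (B1 * exp (- (x / 3 * real N)))))"
    proof (intro mult_left_mono)
      have "(\<Sum>n\<in>I. atom N n * r ^ (2 * n)) \<le> (\<Sum>n. atom N n * r ^ (2 * n))"
        by (rule sum_le_suminf[OF sums_summable[OF sums]]) (use at0 r in \<open>auto simp: I_def\<close>)
      also have "\<dots> \<le> scal_const c \<nu> x N * (2 * pi * (B1 * exp (- (x / 3 * real N))))"
        unfolding sums_unique[OF sums, symmetric] using ldint sc0 by (rule mult_left_mono)
      finally show "(\<Sum>n\<in>I. atom N n * r ^ (2 * n)) \<le> scal_const c \<nu> x N * (2 * pi * (B1 * exp (- (x / 3 * real N))))" .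
    qed (use B2 in auto)
    also have "\<dots> = scal_const c \<nu> x N * (2 * pi * B1) * B2 * (real N powr (\<nu> + \<bar>\<nu>\<bar>) * (4 powr (x / 6 * real N) * exp (- (x / 3 * real N))))"
      by (simp add: mult_ac)
    also have "4 powr (x / 6 * real N) * exp (- (x / 3 * real N)) = exp (- (x / 3 - x / 6 * ln 4) * real N)"
      by (simp add: powr_def exp_add[symmetric] algebra_simps)
    finally show ?case unfolding I_def .
  qed
  have "ln (4::real) < 2"
  proof -
    have "(4::real) < exp 2"
    proof -
      have "exp (2::real) = (exp 1)\<^sup>2" by (simp add: exp_double[symmetric])
      moreover have "(exp 1 :: real) \<ge> 1 + 1 + 1 / 2"
        using exp_lower_Taylor_quadratic[of "1 :: real"] by simp
      hence "(exp 1 :: real)\<^sup>2 \<ge> (5 / 2)\<^sup>2" by (intro power_mono) auto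
      ultimately show ?thesis by (simp add: power2_eq_square)
    qed
    thus ?thesis by (metis exp_less_cancel_iff exp_ln zero_less_numeral)
  qed
  hence eta: "x / 3 - x / 6 * ln 4 > 0" using x by (simp add: field_simps)
  have decay: "(\<lambda>N. real N powr q * exp (- e * real N)) \<longlonglongrightarrow> 0" if "e > 0" for q e :: real
    using that by real_asymp
  have lim0: "(\<lambda>N. scal_const c \<nu> x N * (2 * pi * B1) * B2 * (real N powr (\<nu> + \<bar>\<nu>\<bar>) * exp (- (x / 3 - x / 6 * ln 4) * real N))) \<longlonglongrightarrow>
      sqrt (2 * pi) / (8 * pi * Gamma (\<nu> + 1)) * (x / 2) powr \<nu> * 2 powr (\<nu> + 1) * (2 * pi * B1) * B2 * 0"
    by (intro tendsto_mult tendsto_const scal_const_tendsto[OF c \<nu> x] decay eta)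
  show ?thesis
  proof (rule tendsto_sandwich[OF _ bound tendsto_const])
    show "\<forall>\<^sub>F N in sequentially. 0 \<le> (\<Sum>n | n < N \<and> real n < x / 6 * real N. mass N n)"
      using eventually_N_gt[of "c\<^sup>2"] by eventually_elim (intro sum_nonneg scal_atom_nonneg(1)[OF c \<nu> x])
  qed (use lim0 in simp)
qed

text \<open>Above the cut-off, \<open>(n / N)\<^bsup>-\<nu>\<^esup>\<close> and the factor \<open>N\<^sup>\<nu> / lag_ratio\<close> that separates the two kinds of masses differ by
  a quotient that tends to \<open>\<Gamma>(\<nu> + 1)\<close> uniformly, because all indices there tend to infinity with \<open>N\<close>.\<close>

lemma mass_sum_tendsto:
  assumes x4: "x < 4"
  shows "(\<lambda>N. \<Sum>n<N. mass N n) \<longlonglongrightarrow> sqrt ((4 - x) * x) / (2 * x)"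
proof -
  define G where "G = Gamma (\<nu> + 1)"
  have G: "G > 0" unfolding G_def using \<nu> by (intro Gamma_real_pos) simp
  define T where "T N = (\<Sum>n. atom N n * exp (- real n / real N) * test_fun (exp (- real n / real N)))" for N
  define L where "L = 1 / (2 * G) * (sqrt ((4 - x) * x) / x)"
  have T: "T \<longlonglongrightarrow> L"
    unfolding T_def[abs_def] L_def G_def by (rule test_sum_tendsto[OF x4])
  define J where "J N = {n. n < N \<and> \<not> real n < x / 6 * real N}" for N
  define R where "R N = (\<Sum>n\<in>J N. mass N n)" for N
  define b where "b N n = atom N n * (real n / real N) powr (- \<nu>)" for N n
  have T_eq: "T N = (\<Sum>n\<in>J N. b N n)" if N: "N > 0" for N
  proof -
    have t: "exp (- real n / real N) * test_fun (exp (- real n / real N)) = (if n \<in> J N then (real n / real N) powr (- \<nu>) else 0)" for n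
    proof -
      have "exp (-1) < exp (- real n / real N) \<longleftrightarrow> n < N" using N by simp
      moreover have "exp (- real n / real N) \<le> exp (- (x / 6)) \<longleftrightarrow> \<not> real n < x / 6 * real N"
        using N by (simp add: field_simps not_less)
      ultimately show ?thesis by (simp add: test_fun_def J_def)
    qed
    have "T N = (\<Sum>n. atom N n * (if n \<in> J N then (real n / real N) powr (- \<nu>) else 0))"
      unfolding T_def by (simp only: mult.assoc t)
    also have "\<dots> = (\<Sum>n\<in>J N. atom N n * (if n \<in> J N then (real n / real N) powr (- \<nu>) else 0))"
      by (rule suminf_finite) (auto simp: J_def)
    finally show ?thesis by (simp add: b_def)
  qed
  have L0: "L \<ge> 0" using G x x4 by (simp add: L_def)
  have diff: "(\<lambda>N. R N - G * T N) \<longlonglongrightarrow> 0"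
  proof (rule LIMSEQ_I)
    fix e :: real assume e: "e > 0"
    define e' where "e' = e / (L + 1)"
    have e': "e' > 0" using e L0 by (simp add: e'_def)
    obtain n1 where n1: "\<And>n. n \<ge> n1 \<Longrightarrow> \<bar>real n powr \<nu> / lag_ratio \<nu> n - G\<bar> < e'"
      using LIMSEQ_D[OF lag_ratio_asymp[OF \<nu>] e'] unfolding G_def by auto
    have evT: "\<forall>\<^sub>F N in sequentially. T N < L + 1"
      by (rule order_tendstoD(2)[OF T]) simp
    have "\<forall>\<^sub>F N in sequentially. norm (R N - G * T N - 0) < e"
      using evT eventually_N_gt[of "c\<^sup>2"] eventually_N_gt[of "real n1 / (x / 6)"]
    proof eventually_elim
      case (elim N)
      have N0: "real N > 0" using elim zero_le_power2[of c] by linarith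
      have at0: "atom N n \<ge> 0" for n by (rule scal_atom_nonneg(2)[OF c \<nu> x elim(2)])
      have b0: "b N n \<ge> 0" for n using at0 by (simp add: b_def)
      have "\<bar>mass N n - G * b N n\<bar> \<le> e' * b N n" if n: "n \<in> J N" for n
      proof -
        have nN: "real n \<ge> x / 6 * real N" using n by (simp add: J_def)
        have "x / 6 * real N > 0" using N0 x by simp
        hence n0: "real n > 0" using nN by linarith
        have "real n1 < x / 6 * real N" using elim(3) x by (simp add: field_simps)
        hence "n \<ge> n1" using nN by linarith
        hence close: "\<bar>real n powr \<nu> / lag_ratio \<nu> n - G\<bar> \<le> e'" using n1 by (simp add: less_imp_le)
        have lr: "lag_ratio \<nu> n > 0" by (rule lag_ratio_pos[OF \<nu>])
        have m: "mass N n = atom N n * real N powr \<nu> * (1 / lag_ratio \<nu> n)"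
          by (rule scal_mass_eq[OF c \<nu> x N0])
        have "(real n / real N) powr (- \<nu>) * real n powr \<nu> = real N powr \<nu>"
          using N0 n0 by (simp add: powr_divide powr_minus)
        hence "mass N n = b N n * (real n powr \<nu> / lag_ratio \<nu> n)"
          unfolding m b_def by (metis (no_types, lifting) mult.assoc mult.right_neutral times_divide_eq_right)
        hence "mass N n - G * b N n = (real n powr \<nu> / lag_ratio \<nu> n - G) * b N n"
          by (simp add: algebra_simps)
        thus ?thesis using mult_right_mono[OF close b0[of n]] b0[of n] by (simp add: abs_mult)
      qed
      hence "(\<Sum>n\<in>J N. \<bar>mass N n - G * b N n\<bar>) \<le> (\<Sum>n\<in>J N. e' * b N n)"
        by (rule sum_mono)
      moreover have "R N - G * T N = (\<Sum>n\<in>J N. mass N n - G * b N n)"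
        using N0 by (simp add: R_def T_eq sum_subtractf sum_distrib_left)
      ultimately have "\<bar>R N - G * T N\<bar> \<le> (\<Sum>n\<in>J N. e' * b N n)"
        by (metis order.trans sum_abs)
      also have "\<dots> = e' * T N"
        using N0 by (simp add: T_eq sum_distrib_left)
      also have "\<dots> < e' * (L + 1)" using elim(1) e' by simp
      also have "\<dots> = e" using L0 by (simp add: e'_def)
      finally show ?case by simp
    qed
    thus "\<exists>no. \<forall>n\<ge>no. norm (R n - G * T n - 0) < e" by (simp add: eventually_sequentially)
  qed
  have "R \<longlonglongrightarrow> G * L"
    using tendsto_add[OF diff tendsto_mult[OF tendsto_const[of G] T]] by simp
  hence "(\<lambda>N. (\<Sum>n | n < N \<and> real n < x / 6 * real N. mass N n) + R N) \<longlonglongrightarrow> 0 + G * L"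
    by (intro tendsto_add small_index_sum_tendsto)
  moreover have "(\<Sum>n | n < N \<and> real n < x / 6 * real N. mass N n) + R N = (\<Sum>n<N. mass N n)" for N
  proof -
    have "{..<N} = {n. n < N \<and> real n < x / 6 * real N} \<union> J N" by (auto simp: J_def)
    thus ?thesis unfolding R_def by (subst sum.union_disjoint[symmetric]) (auto simp: J_def)
  qed
  moreover have "G * L = sqrt ((4 - x) * x) / (2 * x)" using G by (simp add: L_def)
  ultimately show ?thesis by simp
qed

end

section \<open>The one-point function and the cross-section\<close>

lemma integral_dA: "(LINT z|dA. f z) = (LINT z|lborel. (1 / pi) *\<^sub>R f z)"
  if "f \<in> borel_measurable borel" for f :: "complex \<Rightarrow> 'a :: {banach, second_countable_topology}"
  unfolding dA_def using that by (intro integral_density) auto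

lemma integrable_dA: "integrable dA f \<longleftrightarrow> integrable lborel f"
  if "f \<in> borel_measurable borel" for f :: "complex \<Rightarrow> complex"
proof -
  have "integrable dA f \<longleftrightarrow> integrable lborel (\<lambda>z. (1 / pi) *\<^sub>R f z)"
    unfolding dA_def using that by (intro integrable_density) auto
  also have "\<dots> \<longleftrightarrow> integrable lborel f"
  proof
    assume "integrable lborel (\<lambda>z. (1 / pi) *\<^sub>R f z)"
    hence "integrable lborel (\<lambda>z. pi *\<^sub>R ((1 / pi) *\<^sub>R f z))"
      by (rule integrable_scaleR_right)
    thus "integrable lborel f" by simp
  qed (rule integrable_scaleR_right)
  finally show ?thesis .
qed

lemma measure_ball_complex: "r > 0 \<Longrightarrow> measure lborel (ball (z :: complex) r) = pi * r\<^sup>2"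
  by (simp add: content_ball unit_ball_vol_2)

text \<open>Lebesgue differentiation at a point of continuity; the one-point function is the limit of such averages.\<close>

lemma ball_average_tendsto:
  fixes f :: "complex \<Rightarrow> real"
  assumes f [measurable]: "f \<in> borel_measurable borel" and cont: "isCont f \<zeta>"
  shows "((\<lambda>\<epsilon>. (LINT z|lborel. indicator (ball \<zeta> \<epsilon>) z * f z) / (pi * \<epsilon>\<^sup>2)) \<longlongrightarrow> f \<zeta>) (at_right 0)"
proof (rule tendstoI)
  fix e :: real assume e: "e > 0"
  obtain d where d: "d > 0" "\<And>z. dist z \<zeta> < d \<Longrightarrow> dist (f z) (f \<zeta>) < e / 2"
    using cont[unfolded continuous_at_eps_delta, rule_format, of "e / 2"] e by (auto simp: dist_commute)
  have "dist ((LINT z|lborel. indicator (ball \<zeta> \<epsilon>) z * f z) / (pi * \<epsilon>\<^sup>2)) (f \<zeta>) < e"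
    if \<epsilon>: "0 < \<epsilon>" "\<epsilon> < d" for \<epsilon>
  proof -
    have [measurable]: "ball \<zeta> \<epsilon> \<in> sets borel" by simp
    have near: "\<bar>f z - f \<zeta>\<bar> \<le> e / 2" if "z \<in> ball \<zeta> \<epsilon>" for z
      using d(2)[of z] that \<epsilon> by (auto simp: dist_real_def dist_commute)
    have ind: "integrable lborel (indicator (ball \<zeta> \<epsilon>) :: complex \<Rightarrow> real)"
      using emeasure_lborel_ball_finite[of \<zeta> \<epsilon>] by (intro integrable_real_indicator) auto
    have gint: "integrable lborel (\<lambda>z. indicator (ball \<zeta> \<epsilon>) z * (f z - f \<zeta>))"
    proof (rule Bochner_Integration.integrable_bound[OF integrable_mult_right[OF ind, of "e / 2"]])
      show "AE z in lborel. norm (indicator (ball \<zeta> \<epsilon>) z * (f z - f \<zeta>)) \<le> norm (e / 2 * indicator (ball \<zeta> \<epsilon>) z)"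
        using near e by (intro AE_I2) (auto split: split_indicator)
    qed measurable
    have "(LINT z|lborel. indicator (ball \<zeta> \<epsilon>) z * f z) =
       (LINT z|lborel. indicator (ball \<zeta> \<epsilon>) z * (f z - f \<zeta>) + f \<zeta> * indicator (ball \<zeta> \<epsilon>) z)"
      by (intro Bochner_Integration.integral_cong refl) (simp add: algebra_simps)
    also have "\<dots> = (LINT z|lborel. indicator (ball \<zeta> \<epsilon>) z * (f z - f \<zeta>)) + f \<zeta> * (pi * \<epsilon>\<^sup>2)"
      using \<epsilon> by (subst Bochner_Integration.integral_add[OF gint integrable_mult_right[OF ind]]) (simp add: measure_ball_complex)
    finally have "(LINT z|lborel. indicator (ball \<zeta> \<epsilon>) z * f z) / (pi * \<epsilon>\<^sup>2) - f \<zeta> =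
        (LINT z|lborel. indicator (ball \<zeta> \<epsilon>) z * (f z - f \<zeta>)) / (pi * \<epsilon>\<^sup>2)"
      using \<epsilon> by (simp add: field_simps)
    moreover have "\<bar>LINT z|lborel. indicator (ball \<zeta> \<epsilon>) z * (f z - f \<zeta>)\<bar> \<le> (LINT z|lborel. e / 2 * indicator (ball \<zeta> \<epsilon>) z)"
    proof (rule order.trans[OF integral_abs_bound integral_mono])
      show "integrable lborel (\<lambda>z. \<bar>indicator (ball \<zeta> \<epsilon>) z * (f z - f \<zeta>)\<bar>)" using gint by simp
      show "integrable lborel (\<lambda>z. e / 2 * indicator (ball \<zeta> \<epsilon>) z)" by (rule integrable_mult_right[OF ind])
      show "\<bar>indicator (ball \<zeta> \<epsilon>) z * (f z - f \<zeta>)\<bar> \<le> e / 2 * indicator (ball \<zeta> \<epsilon>) z" for z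
        using near by (auto split: split_indicator)
    qed
    hence "\<bar>LINT z|lborel. indicator (ball \<zeta> \<epsilon>) z * (f z - f \<zeta>)\<bar> \<le> e / 2 * (pi * \<epsilon>\<^sup>2)"
      using \<epsilon> by (simp add: measure_ball_complex)
    ultimately have "\<bar>(LINT z|lborel. indicator (ball \<zeta> \<epsilon>) z * f z) / (pi * \<epsilon>\<^sup>2) - f \<zeta>\<bar> \<le> e / 2"
      using \<epsilon> by (simp add: abs_mult divide_le_eq)
    thus ?thesis using e by (simp add: dist_real_def)
  qed
  thus "\<forall>\<^sub>F \<epsilon> in at_right 0. dist ((LINT z|lborel. indicator (ball \<zeta> \<epsilon>) z * f z) / (pi * \<epsilon>\<^sup>2)) (f \<zeta>) < e"
    unfolding eventually_at_right_field using d(1) by blast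
qed

lemma borel_measurable_bessel_K [measurable]: "bessel_K \<nu> \<in> borel_measurable borel"
  unfolding bessel_K_def[abs_def] set_lebesgue_integral_def by measurable

lemma borel_measurable_Q_bessel [measurable]: "Q_bessel c \<nu> N \<in> borel_measurable borel"
  unfolding Q_bessel_def[abs_def] by measurable

lemma (in bessel_weight) isCont_weight:
  assumes "z \<noteq> 0"
  shows "isCont weight z"
proof -
  have "isCont (\<lambda>z. bessel_line \<nu> (a * cmod z)) z"
    by (rule isCont_o2[OF _ continuous_bessel_line]) (use assms a_pos in \<open>auto intro!: continuous_intros\<close>)
  thus ?thesis
    unfolding weight_def[abs_def] using assms a_pos by (intro continuous_intros) auto
qed

lemma (in bessel_weight) isCont_lag: "isCont (lag n) z"
  unfolding lag_def[abs_def] laguerre_def by (intro continuous_intros)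

text \<open>The one-point function: the diagonal of the reproducing kernel of the polynomials of degree below \<open>N\<close>.\<close>

definition (in bessel_weight) lag_density :: "nat \<Rightarrow> complex \<Rightarrow> real" where
  "lag_density N z = (\<Sum>n<N. weight z * (cmod (lag n z))\<^sup>2 / lag_norm n)"

context
  fixes c \<nu> :: real and N :: nat
  assumes c: "c > 0" and \<nu>: "\<nu> > -1" and N: "real N > c\<^sup>2"
begin

interpretation bessel_weight "scal_a c N" "scal_b c N" \<nu>
  by (rule scal_weight[OF c \<nu> N])

text \<open>The term \<open>N (N / c\<^sup>2 - 1) Re z\<close> of the potential is \<open>b Re z\<close>.\<close>

lemma exp_Q_bessel:
  assumes z: "z \<noteq> 0"
  shows "exp (- real N * Q_bessel c \<nu> N z) = (2 / scal_a c N) powr \<nu> / 2 * weight z"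
proof -
  have N0: "real N > 0" using N zero_le_power2[of c] by linarith
  define r where "r = cmod z"
  have r: "r > 0" using z by (simp add: r_def)
  have ar: "scal_a c N * r > 0" using a_pos r by simp
  have K: "bessel_K \<nu> (scal_a c N * r) = bessel_line \<nu> (scal_a c N * r) / 2"
    by (rule bessel_K_eq_bessel_line[OF ar])
  have pos: "bessel_K \<nu> (scal_a c N * r) * r powr \<nu> > 0"
    unfolding K using bessel_line_pos[OF ar] r by simp
  have "(real N)\<^sup>2 * cmod z / c\<^sup>2 = scal_a c N * r" by (simp add: scal_a_def r_def)
  moreover have "real N * (real N / c\<^sup>2 - 1) = scal_b c N"
    by (simp add: scal_b_def power2_eq_square right_diff_distrib)
  moreover have "- n * (- (1 / n) * A - k * q) = A + (n * k) * q" if "n > 0" for n A k q :: real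
    using that by (simp add: field_simps)
  ultimately have "- real N * Q_bessel c \<nu> N z = ln (bessel_K \<nu> (scal_a c N * r) * r powr \<nu>) + scal_b c N * Re z"
    using N0 unfolding Q_bessel_def by (simp only: r_def)
  hence "exp (- real N * Q_bessel c \<nu> N z) = bessel_K \<nu> (scal_a c N * r) * r powr \<nu> * exp (scal_b c N * Re z)"
    using pos by (simp add: exp_add)
  moreover have "r powr \<nu> = (2 / scal_a c N) powr \<nu> * (scal_a c N * r / 2) powr \<nu>"
    using a_pos r by (simp add: powr_mult[symmetric])
  ultimately show ?thesis
    unfolding K weight_def r_def[symmetric] by simp
qed

text \<open>The constant between \<open>exp (- N Q)\<close> and the weight drops out, since the norms scale with it.\<close>

lemma one_point_bessel:
  assumes z: "\<zeta> \<noteq> 0"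
  shows "one_point N (Q_bessel c \<nu> N) \<zeta> = lag_density N \<zeta>"
proof -
  have N0: "N > 0" using N zero_le_power2[of c] by (cases N) auto
  define C where "C = (2 / scal_a c N) powr \<nu> / 2"
  have C: "C > 0" using a_pos by (simp add: C_def)
  define W where "W z = exp (- real N * Q_bessel c \<nu> N z)" for z
  have [measurable]: "W \<in> borel_measurable borel" unfolding W_def[abs_def] by measurable
  have W: "AE z in lborel. W z = C * weight z"
    using AE_lborel_singleton[of "0 :: complex"]
    by eventually_elim (unfold W_def C_def, rule exp_Q_bessel)
  have AEi: "AE z in lborel. of_real (W z) * (lag m z * cnj (lag n z)) = of_real C * (of_real (weight z) * (lag m z * cnj (lag n z)))" for m n
    using W by eventually_elim simp
  have Pint: "integrable dA (\<lambda>z. of_real (W z) * (poly (lag_poly m) z * cnj (poly (lag_poly n) z)))" for m n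
  proof -
    have "integrable lborel (\<lambda>z. of_real (W z) * (lag m z * cnj (lag n z)))"
      using integrable_mult_right[OF integrable_lag_products[of m n], of "of_real C"]
      by (subst integrable_cong_AE[OF _ _ AEi]) measurable
    thus ?thesis unfolding poly_lag_poly by (subst integrable_dA) measurable
  qed
  have orth: "(LINT z|dA. of_real (W z) * (poly (lag_poly m) z * cnj (poly (lag_poly n) z))) =
      (if m = n then of_real (C * lag_norm n) else 0)" for m n
  proof -
    have "(LINT z|dA. of_real (W z) * (poly (lag_poly m) z * cnj (poly (lag_poly n) z))) =
       (LINT z|lborel. (1 / pi) *\<^sub>R (of_real (W z) * (lag m z * cnj (lag n z))))"
      unfolding poly_lag_poly by (subst integral_dA) auto
    also have "\<dots> = (1 / pi) *\<^sub>R (LINT z|lborel. of_real (W z) * (lag m z * cnj (lag n z)))"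
      by (rule integral_scaleR_right)
    also have "(LINT z|lborel. of_real (W z) * (lag m z * cnj (lag n z))) =
       (LINT z|lborel. of_real C * (of_real (weight z) * (lag m z * cnj (lag n z))))"
      by (rule integral_cong_AE[OF _ _ AEi]) measurable
    also have "\<dots> = of_real C * (if m = n then of_real (pi * lag_norm n) else 0)"
      by (simp only: integral_mult_right_zero lag_orthogonal)
    finally show ?thesis by (simp add: scaleR_conv_of_real)
  qed
  have h: "C * lag_norm n > 0" for n using C lag_norm_pos by simp
  have count: "(LINT z|gibbs N (Q_bessel c \<nu> N). real (card {j. j < N \<and> z j \<in> ball \<zeta> \<epsilon>})) =
      (LINT z|lborel. indicator (ball \<zeta> \<epsilon>) z * lag_density N z) / pi" for \<epsilon>
  proof -
    have [measurable]: "ball \<zeta> \<epsilon> \<in> sets borel" by simp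
    have int: "integrable lborel (\<lambda>z. indicator (ball \<zeta> \<epsilon>) z * (weight z * (cmod (lag n z))\<^sup>2))" for n
    proof -
      have "integrable lborel (\<lambda>z. complex_of_real (weight z * (cmod (lag n z))\<^sup>2))"
        using integrable_lag_products[of n n] by (simp only: of_real_mult complex_norm_square)
      hence "integrable lborel (\<lambda>z. weight z * (cmod (lag n z))\<^sup>2)"
        by (rule complex_of_real_integrable_eq[THEN iffD1])
      hence "integrable lborel (\<lambda>z. indicator (ball \<zeta> \<epsilon>) z *\<^sub>R (weight z * (cmod (lag n z))\<^sup>2))"
        by (intro integrable_mult_indicator) auto
      thus ?thesis by simp
    qed
    have "(LINT z|gibbs N (Q_bessel c \<nu> N). real (card {j. j < N \<and> z j \<in> ball \<zeta> \<epsilon>})) =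
      (\<Sum>n<N. (LINT z|dA. indicator (ball \<zeta> \<epsilon>) z * (W z * (cmod (poly (lag_poly n) z))\<^sup>2)) / (C * lag_norm n))"
      unfolding W_def
      by (rule expected_count_orthogonal_polynomials[OF N0 borel_measurable_Q_bessel degree_lag_poly
            Pint[unfolded W_def] orth[unfolded W_def] h]) simp
    also have "\<dots> = (\<Sum>n<N. (LINT z|lborel. indicator (ball \<zeta> \<epsilon>) z * (weight z * (cmod (lag n z))\<^sup>2)) / lag_norm n / pi)"
    proof (intro sum.cong refl)
      fix n
      have "(LINT z|dA. indicator (ball \<zeta> \<epsilon>) z * (W z * (cmod (poly (lag_poly n) z))\<^sup>2)) =
         (LINT z|lborel. (1 / pi) *\<^sub>R (indicator (ball \<zeta> \<epsilon>) z * (W z * (cmod (lag n z))\<^sup>2)))"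
        unfolding poly_lag_poly by (rule integral_dA) measurable
      also have "\<dots> = (LINT z|lborel. (C / pi) * (indicator (ball \<zeta> \<epsilon>) z * (weight z * (cmod (lag n z))\<^sup>2)))"
      proof (rule integral_cong_AE)
        show "AE z in lborel. (1 / pi) *\<^sub>R (indicator (ball \<zeta> \<epsilon>) z * (W z * (cmod (lag n z))\<^sup>2)) =
            (C / pi) * (indicator (ball \<zeta> \<epsilon>) z * (weight z * (cmod (lag n z))\<^sup>2))"
          using W by eventually_elim simp
      qed measurable
      also have "\<dots> = (C / pi) * (LINT z|lborel. indicator (ball \<zeta> \<epsilon>) z * (weight z * (cmod (lag n z))\<^sup>2))"
        by (rule integral_mult_right_zero)
      finally show "(LINT z|dA. indicator (ball \<zeta> \<epsilon>) z * (W z * (cmod (poly (lag_poly n) z))\<^sup>2)) / (C * lag_norm n) =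
        (LINT z|lborel. indicator (ball \<zeta> \<epsilon>) z * (weight z * (cmod (lag n z))\<^sup>2)) / lag_norm n / pi"
        using C by simp
    qed
    also have "\<dots> = (LINT z|lborel. (\<Sum>n<N. indicator (ball \<zeta> \<epsilon>) z * (weight z * (cmod (lag n z))\<^sup>2) / lag_norm n)) / pi"
      using int by (subst Bochner_Integration.integral_sum) (auto simp: sum_divide_distrib)
    also have "(LINT z|lborel. (\<Sum>n<N. indicator (ball \<zeta> \<epsilon>) z * (weight z * (cmod (lag n z))\<^sup>2) / lag_norm n)) =
        (LINT z|lborel. indicator (ball \<zeta> \<epsilon>) z * lag_density N z)"
      by (simp add: lag_density_def sum_distrib_left)
    finally show ?thesis .
  qed
  have "isCont (lag_density N) \<zeta>"
    unfolding lag_density_def[abs_def] using lag_norm_pos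
    by (intro continuous_intros isCont_weight isCont_lag z) (auto simp: less_imp_neq[symmetric])
  moreover have "lag_density N \<in> borel_measurable borel"
    unfolding lag_density_def[abs_def] by measurable
  ultimately have "((\<lambda>\<epsilon>. (LINT z|lborel. indicator (ball \<zeta> \<epsilon>) z * lag_density N z) / (pi * \<epsilon>\<^sup>2)) \<longlongrightarrow> lag_density N \<zeta>) (at_right 0)"
    by (intro ball_average_tendsto)
  hence "((\<lambda>\<epsilon>. (LINT z|gibbs N (Q_bessel c \<nu> N). real (card {j. j < N \<and> z j \<in> ball \<zeta> \<epsilon>})) / \<epsilon>\<^sup>2) \<longlongrightarrow> lag_density N \<zeta>) (at_right 0)"
    unfolding count by (simp add: divide_divide_eq_left)
  thus ?thesis
    unfolding one_point_def by (intro tendsto_Lim) auto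
qed

lemma cross_section_bessel:
  assumes x: "\<xi> > 0" and adm: "admissible \<rho>" 
    and B: "\<And>\<theta>. 0 \<le> line_density \<rho> \<xi> \<theta>" "\<And>\<theta>. line_density \<rho> \<xi> \<theta> \<le> B"
  shows "cross_section N (Q_bessel c \<nu> N) \<xi> = (\<Sum>n<N. scal_mass c \<nu> \<xi> N n)"
proof -
  have "Complex \<xi> \<eta> \<noteq> 0" for \<eta> using x by (simp add: complex_eq_iff)
  hence "cross_section N (Q_bessel c \<nu> N) \<xi> =
     1 / real N * (LINT \<eta>|lborel. (\<Sum>n<N. (cmod (lag n (Complex \<xi> \<eta>)))\<^sup>2 * weight (Complex \<xi> \<eta>) / lag_norm n))"
    by (simp add: cross_section_def one_point_bessel lag_density_def mult.commute)
  also have "(LINT \<eta>|lborel. (\<Sum>n<N. (cmod (lag n (Complex \<xi> \<eta>)))\<^sup>2 * weight (Complex \<xi> \<eta>) / lag_norm n)) =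
     (\<Sum>n<N. line_mass n \<xi> / lag_norm n)"
    using line_mass_sums(2)[OF x adm B]
    by (subst Bochner_Integration.integral_sum) (auto simp: line_mass_def)
  also have "1 / real N * (\<Sum>n<N. line_mass n \<xi> / lag_norm n) = (\<Sum>n<N. scal_mass c \<nu> \<xi> N n)"
    unfolding sum_distrib_left by (intro sum.cong refl) (simp add: scal_mass_def[OF c \<nu> x])
  finally show ?thesis .
qed

end

theorem theorem1p6:
  fixes c \<nu> \<xi> :: real
  assumes "c > 0" and "\<nu> > -1" and "0 < \<xi>" and "\<xi> < 4"
  shows "(\<lambda>N. cross_section N (Q_bessel c \<nu> N) \<xi>) \<longlonglongrightarrow> pi * sigma_MP \<xi>"
proof -
  have one: "(1 :: real) > 0" by simp
  note c = assms(1) and \<nu> = assms(2) and x = assms(3)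
  obtain B where B: "\<forall>\<^sub>F N in sequentially. \<forall>\<theta>.
      0 \<le> bessel_weight.line_density (scal_a c N) (scal_b c N) \<nu> (scal_rho c 1 N) \<xi> \<theta> \<and>
      bessel_weight.line_density (scal_a c N) (scal_b c N) \<nu> (scal_rho c 1 N) \<xi> \<theta> \<le> B"
    using line_density_bounded[OF c one \<nu> x] by blast
  have "\<forall>\<^sub>F N in sequentially. (\<Sum>n<N. scal_mass c \<nu> \<xi> N n) = cross_section N (Q_bessel c \<nu> N) \<xi>"
    using B scal_admissible[OF c one \<nu>] eventually_N_gt[of "c\<^sup>2"]
  proof eventually_elim
    case (elim N)
    show ?case
      by (rule cross_section_bessel[OF c \<nu> elim(3) x elim(2), symmetric, of B]) (use elim(1) in auto)
  qed
  with mass_sum_tendsto[OF c \<nu> x assms(4)]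
  have "(\<lambda>N. cross_section N (Q_bessel c \<nu> N) \<xi>) \<longlonglongrightarrow> sqrt ((4 - \<xi>) * \<xi>) / (2 * \<xi>)"
    by (rule Lim_transform_eventually)
  moreover have "pi * sigma_MP \<xi> = sqrt ((4 - \<xi>) * \<xi>) / (2 * \<xi>)"
    using assms by (simp add: sigma_MP_def)
  ultimately show ?thesis by simp
qed

end
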